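(* Let $T$ be a tree on $n$ vertices, and suppose $T\ne S_n$ (up to isomorphism). Then $\operatorname{tr}(T)\le \operatorname{tr}(DS(n-3,1))$, with equality if and only if $T=DS(n-3,1)$ (up to isomorphism).
   Context: Graphs are finite and simple. For a graph $X$, let $L=D-A$ be its Laplacian matrix, with spectral decomposition $L=\sum_\lambda \lambda E_\lambda$, where $\lambda$ runs over the distinct eigenvalues of $L$ and $E_\lambda$ is the orthogonal projection onto the $\lambda$-eigenspace. The average mixing matrix is $\widehat{M}=\sum_\lambda E_\lambda\circ E_\lambda$ ($\circ$ is the entrywise product), and the laziness of $X$ is $\operatorname{tr}(X):=\operatorname{tr}(\widehat M)=\sum_\lambda\sum_{u\in V(X)} ((E_\lambda)_{uu})^2$. $S_n$ is the star on $n$ vertices. The double star $DS(\ell,r)$ ($\ell,r\ge 1$) is the tree on $n=\ell+r+2$ vertices obtained from an edge $ab$ by attaching $\ell$ leaves to $a$ and $r$ leaves to $b$. (Every tree with at most $3$ vertices is a star, so the hypothesis $T\neq S_n$ forces $n\ge 4$.) *)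

theory Defs
  imports Complex_Main "Graph_Theory.Graph_Theory"
begin

text \<open>
  A finite simple graph is a \<open>pair_graph\<close>: a finite loopless digraph without parallel arcs whose
  arc set is symmetric, an edge \<open>uv\<close> being represented by the two arcs \<open>(u, v)\<close> and \<open>(v, u)\<close>.

  The library's \<open>tree\<close> cannot be used for these: its \<open>forest\<close> also forbids the closed walk
  \<open>u, v, u\<close>, which every edge of a symmetric digraph provides. A cycle of the undirected
  graph is a \<open>cycle\<close> of length at least 3.
\<close>

definition undirected_tree :: "'a pair_pre_digraph \<Rightarrow> bool" where
  "undirected_tree G \<longleftrightarrow>
     pair_graph G \<and> Digraph_Component.connected (with_proj G) \<and>
     \<not> (\<exists>p. pre_digraph.cycle (with_proj G) p \<and> 3 \<le> length p)"

definition star_graph :: "nat \<Rightarrow> nat pair_pre_digraph" where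
  "star_graph n =
     \<lparr> pverts = {0..<n},
       parcs = symcl {(0, i) | i. i \<in> {1..<n}} \<rparr>"

text \<open>In \<open>double_star l r\<close> the two centres are \<open>0\<close> and \<open>1\<close>.\<close>

definition double_star :: "nat \<Rightarrow> nat \<Rightarrow> nat pair_pre_digraph" where
  "double_star l r =
     \<lparr> pverts = {0..<l + r + 2},
       parcs = symcl ({(0, 1)} \<union> {(0, i) | i. i \<in> {2..<l + 2}}
                               \<union> {(1, i) | i. i \<in> {l + 2..<l + r + 2}}) \<rparr>"

text \<open>
  Matrices indexed by a finite set \<open>V\<close> are functions \<open>'a \<Rightarrow> 'a \<Rightarrow> real\<close>, only their entries on
  \<open>V \<times> V\<close> being relevant; a vector of \<open>\<real>\<^sup>V\<close> is a function \<open>'a \<Rightarrow> real\<close> vanishing outside \<open>V\<close>.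
\<close>

definition degree_matrix :: "'a pair_pre_digraph \<Rightarrow> 'a \<Rightarrow> 'a \<Rightarrow> real" where
  "degree_matrix G u v = (if u = v then real (out_degree (with_proj G) u) else 0)"

definition adjacency_matrix :: "'a pair_pre_digraph \<Rightarrow> 'a \<Rightarrow> 'a \<Rightarrow> real" where
  "adjacency_matrix G u v = (if (u, v) \<in> parcs G then 1 else 0)"

definition laplacian :: "'a pair_pre_digraph \<Rightarrow> 'a \<Rightarrow> 'a \<Rightarrow> real" where
  "laplacian G u v = degree_matrix G u v - adjacency_matrix G u v"

definition vectors_on :: "'a set \<Rightarrow> ('a \<Rightarrow> real) set" where
  "vectors_on V = {x. \<forall>u. u \<notin> V \<longrightarrow> x u = 0}"

definition eigenspace_on :: "'a set \<Rightarrow> ('a \<Rightarrow> 'a \<Rightarrow> real) \<Rightarrow> real \<Rightarrow> ('a \<Rightarrow> real) set" where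
  "eigenspace_on V M \<theta> =
     {x \<in> vectors_on V. \<forall>u\<in>V. (\<Sum>v\<in>V. M u v * x v) = \<theta> * x u}"

definition eigenvalues_on :: "'a set \<Rightarrow> ('a \<Rightarrow> 'a \<Rightarrow> real) \<Rightarrow> real set" where
  "eigenvalues_on V M = {\<theta>. \<exists>x \<in> eigenspace_on V M \<theta>. x \<noteq> (\<lambda>_. 0)}"

definition orthogonal_projection_on ::
    "'a set \<Rightarrow> ('a \<Rightarrow> real) set \<Rightarrow> ('a \<Rightarrow> real) \<Rightarrow> 'a \<Rightarrow> real" where
  "orthogonal_projection_on V S x =
     (THE p. p \<in> S \<and> (\<forall>s\<in>S. (\<Sum>u\<in>V. (x u - p u) * s u) = 0))"

text \<open>
  The \<open>(u, v)\<close> entry of the matrix \<open>E\<^sub>\<theta>\<close> of the orthogonal projection onto the \<open>\<theta>\<close>-eigenspace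
  of the Laplacian: the \<open>u\<close>-th coordinate of the projection of the \<open>v\<close>-th standard basis vector.
\<close>

definition eigenprojection :: "'a pair_pre_digraph \<Rightarrow> real \<Rightarrow> 'a \<Rightarrow> 'a \<Rightarrow> real" where
  "eigenprojection G \<theta> u v =
     orthogonal_projection_on (pverts G) (eigenspace_on (pverts G) (laplacian G) \<theta>)
       (\<lambda>w. if w = v then 1 else 0) u"

definition average_mixing_matrix :: "'a pair_pre_digraph \<Rightarrow> 'a \<Rightarrow> 'a \<Rightarrow> real" where
  "average_mixing_matrix G u v =
     (\<Sum>\<theta>\<in>eigenvalues_on (pverts G) (laplacian G).
        eigenprojection G \<theta> u v * eigenprojection G \<theta> u v)"

definition laziness :: "'a pair_pre_digraph \<Rightarrow> real" where
  "laziness G = (\<Sum>u\<in>pverts G. average_mixing_matrix G u u)"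

end

theory Submission
  imports Defs "HOL-Analysis.Function_Topology" "HOL-Analysis.Convex"
begin

text \<open>
  For a vertex \<open>u\<close> the numbers \<open>p\<^sub>u(\<theta>) = (E\<^sub>\<theta>)\<^sub>u\<^sub>u\<close> form a probability distribution on the Laplacian
  eigenvalues with \<open>p\<^sub>u(0) = 1 / n\<close>, and \<open>n\<close> minus the laziness is the sum over \<open>u\<close> of the probability
  that two independent samples of \<open>p\<^sub>u\<close> differ. Splitting off the eigenvalue \<open>0\<close>, which contributes
  \<open>2 (1 - 1 / n)\<close> for every connected graph, leaves the excess of \<open>u\<close>; it is large as soon as no positive
  eigenvalue carries almost all of \<open>p\<^sub>u\<close>.

  The total excess of \<open>DS(n - 3, 1)\<close> is computed from the moments of \<open>p\<^sub>u\<close>, the eigenvalues other than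
  \<open>0\<close> and \<open>1\<close> being the roots of a cubic. In any other tree that is not a star, the last few
  vertices at both ends of a longest path force more excess. There one finds families of \<open>k \<ge> 2\<close> leaves at
  a common vertex, whose mass at the eigenvalue \<open>1\<close> is about \<open>1 - 1 / k\<close>, or pendant paths of length
  two, where the eigenvalue equations bound all atoms of \<open>p\<^sub>u\<close> away from \<open>1\<close>.
\<close>

section \<open>The spectral theorem on a finite set\<close>

text \<open>The limit value 4 / 5 for \<open>DS(n - 3, 1)\<close> arises as follows. As the number
  of leaves at its centre grows, one root of the cubic escapes to infinity and the other two tend to
  the roots of t^2 - t - 1, where t = \<theta> - 1. At both vertices of the pendant path the mass
  then sits on two atoms with product 1 / 5, so each of them has excess 2 / 5, and everything else
  contributes O(1 / n). For the other trees one end of a longest path is not enough. A family of k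
  leaves has excess about 2 (1 - 1 / k) (1 - k / n), which is small when it fills most of the tree,
  and the two vertices of a pendant path alone only guarantee about 0.739. Therefore disjoint vertex
  sets are combined: two families share the n vertices, so together they lose little more than one
  of their nearly two units. A lone pendant path is counted together with its root if the root has
  degree 2 or 3; a root of larger degree offers a second pendant path or a family of leaves. The
  margins are thin for n between 5 and 8, which dictates the precision of the constants.\<close>

definition ip :: "'a set \<Rightarrow> ('a \<Rightarrow> real) \<Rightarrow> ('a \<Rightarrow> real) \<Rightarrow> real" where
  "ip V x y = (\<Sum>u\<in>V. x u * y u)"

definition mat_app :: "'a set \<Rightarrow> ('a \<Rightarrow> 'a \<Rightarrow> real) \<Rightarrow> ('a \<Rightarrow> real) \<Rightarrow> 'a \<Rightarrow> real" where
  "mat_app V M x = (\<lambda>u. if u \<in> V then \<Sum>v\<in>V. M u v * x v else 0)"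

lemma ip_commute: "ip V x y = ip V y x"
  by (simp add: ip_def mult.commute)

lemma ip_add: "ip V (\<lambda>u. x u + y u) w = ip V x w + ip V y w"
  by (simp add: ip_def distrib_right sum.distrib)

lemma ip_scale: "ip V (\<lambda>u. c * x u) w = c * ip V x w"
  by (simp add: ip_def sum_distrib_left mult.assoc)

lemma ip_diff: "ip V (\<lambda>u. x u - y u) w = ip V x w - ip V y w"
  by (simp add: ip_def left_diff_distrib sum_subtractf)

lemma ip_sum: "ip V (\<lambda>u. \<Sum>b\<in>B. f b u) w = (\<Sum>b\<in>B. ip V (f b) w)"
  unfolding ip_def by (simp add: sum_distrib_right) (rule sum.swap)

lemma ip_nonneg: "0 \<le> ip V x x"
  by (simp add: ip_def sum_nonneg)

lemma ip_zero_iff: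
  assumes "finite V" "x \<in> vectors_on V"
  shows "ip V x x = 0 \<longleftrightarrow> x = (\<lambda>_. 0)"
proof -
  have "ip V x x = 0 \<longleftrightarrow> (\<forall>u\<in>V. x u = 0)"
    unfolding ip_def using assms by (subst sum_nonneg_eq_0_iff) auto
  then show ?thesis using assms unfolding vectors_on_def by auto
qed

lemma ip_delta:
  assumes "finite V" "v \<in> V"
  shows "ip V (\<lambda>w. if w = v then 1 else 0) y = y v"
  using assms by (simp add: ip_def if_distrib[of "\<lambda>c. c * _"] cong: if_cong)

lemma eigenspace_on_iff:
  "x \<in> eigenspace_on V M \<theta> \<longleftrightarrow> x \<in> vectors_on V \<and> mat_app V M x = (\<lambda>u. \<theta> * x u)"
  unfolding eigenspace_on_def mat_app_def vectors_on_def by (auto simp: fun_eq_iff)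

lemma eigenspace_on_scale:
  "x \<in> eigenspace_on V M \<theta> \<Longrightarrow> (\<lambda>u. c * x u) \<in> eigenspace_on V M \<theta>"
  unfolding eigenspace_on_def vectors_on_def
  by (auto simp: mult.left_commute[of _ c] sum_distrib_left[symmetric])

lemma eigenspace_on_sum:
  assumes "\<And>b. b \<in> B \<Longrightarrow> f b \<in> eigenspace_on V M \<theta>"
  shows "(\<lambda>u. \<Sum>b\<in>B. f b u) \<in> eigenspace_on V M \<theta>"
proof -
  have "(\<Sum>v\<in>V. M u v * (\<Sum>b\<in>B. f b v)) = \<theta> * (\<Sum>b\<in>B. f b u)" if "u \<in> V" for u
  proof -
    have "(\<Sum>v\<in>V. M u v * (\<Sum>b\<in>B. f b v)) = (\<Sum>b\<in>B. \<Sum>v\<in>V. M u v * f b v)"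
      unfolding sum_distrib_left by (rule sum.swap)
    also have "\<dots> = (\<Sum>b\<in>B. \<theta> * f b u)"
      using assms that by (intro sum.cong) (auto simp: eigenspace_on_def)
    finally show ?thesis by (simp add: sum_distrib_left)
  qed
  moreover have "(\<Sum>b\<in>B. f b u) = 0" if "u \<notin> V" for u
    using assms that by (intro sum.neutral) (auto simp: eigenspace_on_def vectors_on_def)
  ultimately show ?thesis by (auto simp: eigenspace_on_def vectors_on_def)
qed

lemma closed_Collect_all_fun:
  fixes f g :: "'i \<Rightarrow> ('a \<Rightarrow> real) \<Rightarrow> real"
  assumes "\<And>i. continuous_on UNIV (f i)" "\<And>i. continuous_on UNIV (g i)"
  shows "closed {x. \<forall>i\<in>I. f i x = g i x}"
proof -
  have "{x. \<forall>i\<in>I. f i x = g i x} = (\<Inter>i\<in>I. {x. f i x = g i x})" by auto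
  then show ?thesis using assms by (auto intro!: closed_INT closed_Collect_eq)
qed

lemma continuous_ip: "continuous_on UNIV (\<lambda>x. ip V x b)"
  unfolding ip_def by (intro continuous_intros) simp

text \<open>The topology is the product topology on all functions. A unit vector vanishing outside V
  has all coordinates in [-1, 1], so the set is a closed part of a product of intervals, and
  Tychonoff's theorem applies even when the type is infinite.\<close>

lemma compact_unit_sphere_on:
  assumes "finite V"
  shows "compact {x \<in> vectors_on V. ip V x x = 1 \<and> (\<forall>b\<in>B. ip V x b = 0)}" (is "compact ?K")
proof -
  have "compactin (product_topology (\<lambda>_. euclideanreal) (UNIV::'a set)) (PiE UNIV (\<lambda>_. {-1..1::real}))"
    by (subst compactin_PiE) auto
  then have box: "compact (Pi UNIV (\<lambda>_. {-1..1::real}) :: ('a\<Rightarrow>real) set)"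
    by (simp add: PiE_UNIV_domain euclidean_product_topology)
  have eq: "?K = {x. \<forall>u\<in>-V. x u = 0} \<inter> {x. ip V x x = 1} \<inter> {x. \<forall>b\<in>B. ip V x b = 0}"
    by (auto simp: vectors_on_def)
  have "closed ?K"
    unfolding eq
    by (intro closed_Int closed_Collect_all_fun closed_Collect_eq continuous_ip continuous_on_const)
       (auto simp: ip_def intro!: continuous_intros)
  moreover have "?K \<subseteq> Pi UNIV (\<lambda>_. {-1..1})"
  proof
    fix x assume x: "x \<in> ?K"
    have "x u \<in> {-1..1}" for u
    proof (cases "u \<in> V")
      case True
      have "(x u)^2 \<le> (\<Sum>u\<in>V. (x u)^2)"
        using True assms by (intro member_le_sum) auto
      then have "(x u)^2 \<le> 1" using x by (simp add: ip_def power2_eq_square)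
      then have "\<bar>x u\<bar> \<le> 1" by (simp add: abs_square_le_1)
      then show ?thesis by auto
    qed (use x in \<open>auto simp: vectors_on_def\<close>)
    then show "x \<in> Pi UNIV (\<lambda>_. {-1..1})" by auto
  qed
  ultimately show ?thesis
    using compact_Int_closed[OF box, of ?K] by (simp add: Int_absorb1)
qed

lemma mat_app_in_vectors: "mat_app V M x \<in> vectors_on V"
  by (simp add: mat_app_def vectors_on_def)

definition symmetric_matrix :: "('a \<Rightarrow> 'a \<Rightarrow> real) \<Rightarrow> bool" where
  "symmetric_matrix M \<longleftrightarrow> (\<forall>u v. M u v = M v u)"

lemma ip_mat_app_sym:
  assumes "symmetric_matrix M"
  shows "ip V (mat_app V M x) y = ip V x (mat_app V M y)"
proof -
  have sym: "M u v = M v u" for u v using assms by (simp add: symmetric_matrix_def)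
  have "ip V (mat_app V M x) y = (\<Sum>u\<in>V. \<Sum>v\<in>V. M u v * x v * y u)"
    by (simp add: ip_def mat_app_def sum_distrib_right)
  also have "\<dots> = (\<Sum>v\<in>V. \<Sum>u\<in>V. M u v * x v * y u)" by (rule sum.swap)
  also have "\<dots> = (\<Sum>v\<in>V. \<Sum>u\<in>V. x v * (M v u * y u))"
  proof -
    have "M u v * x v * y u = x v * (M v u * y u)" for u v
      unfolding sym[of u v] by (simp only: mult_ac)
    then show ?thesis by (simp only:)
  qed
  also have "\<dots> = ip V x (mat_app V M y)"
    by (simp add: ip_def mat_app_def sum_distrib_left)
  finally show ?thesis .
qed

lemma mat_app_add_scale:
  "mat_app V M (\<lambda>u. x u + c * y u) = (\<lambda>u. mat_app V M x u + c * mat_app V M y u)"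
  by (auto simp: mat_app_def fun_eq_iff distrib_left sum.distrib sum_distrib_left mult_ac)

text \<open>First-order condition at a maximum: for small positive e the linear term would outweigh
  the quadratic one. The witness in the proof makes e * \<bar>c\<bar> smaller than a.\<close>

lemma no_linear_below_quadratic:
  fixes a c :: real
  assumes "\<And>e. 2 * e * a + e^2 * c \<le> 0" and "0 \<le> a"
  shows "a = 0"
proof (rule ccontr)
  assume "a \<noteq> 0"
  then have a: "a > 0" using assms by simp
  define e where "e = a / (\<bar>c\<bar> + 1)"
  have e: "e > 0" "e * \<bar>c\<bar> < a"
    using a by (auto simp: e_def field_simps)
  have "e * (2 * a + e * c) \<le> 0"
    using assms(1)[of e] by (simp add: algebra_simps power2_eq_square)
  then have "2 * a + e * c \<le> 0" using e by (simp add: mult_le_0_iff)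
  moreover have "- (e * c) \<le> e * \<bar>c\<bar>" using e by (simp add: abs_if)
  ultimately show False using e a by linarith
qed

text \<open>The Rayleigh quotient attains its maximum on the unit sphere of an invariant subspace,
  and a maximiser is an eigenvector.\<close>

lemma exists_eigenvector_orthogonal_to:
  assumes fin: "finite V" and sym: "symmetric_matrix M"
    and B: "\<And>b. b \<in> B \<Longrightarrow> \<exists>\<theta>. b \<in> eigenspace_on V M \<theta>"
    and x0: "x0 \<in> vectors_on V" "x0 \<noteq> (\<lambda>_. 0)" "\<forall>b\<in>B. ip V x0 b = 0"
  shows "\<exists>x \<theta>. x \<in> eigenspace_on V M \<theta> \<and> ip V x x = 1 \<and> (\<forall>b\<in>B. ip V x b = 0)"
proof -
  define K where "K = {x \<in> vectors_on V. ip V x x = 1 \<and> (\<forall>b\<in>B. ip V x b = 0)}"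
  define Q where "Q x = ip V x (mat_app V M x)" for x
  have normalise: "(\<lambda>u. x u / sqrt (ip V x x)) \<in> K"
    if "x \<in> vectors_on V" "ip V x x > 0" "\<forall>b\<in>B. ip V x b = 0" for x
  proof -
    let ?c = "1 / sqrt (ip V x x)"
    have "ip V (\<lambda>u. x u / sqrt (ip V x x)) (\<lambda>u. x u / sqrt (ip V x x))
        = (\<Sum>u\<in>V. x u * x u / ip V x x)"
      using that by (simp add: ip_def[of V "\<lambda>u. x u / _"])
    then have 1: "ip V (\<lambda>u. x u / sqrt (ip V x x)) (\<lambda>u. x u / sqrt (ip V x x)) = 1"
      using that by (simp add: sum_divide_distrib[symmetric] ip_def[of V x x, symmetric])
    have 2: "ip V (\<lambda>u. x u / sqrt (ip V x x)) b = 0" if "b \<in> B" for b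
      using ip_scale[of V ?c x b] that \<open>\<forall>b\<in>B. ip V x b = 0\<close> by simp
    show ?thesis using 1 2 that by (auto simp: K_def vectors_on_def)
  qed
  have pos: "ip V x x > 0" if "x \<in> vectors_on V" "x \<noteq> (\<lambda>_. 0)" for x
    using ip_zero_iff[OF fin that(1)] that(2) ip_nonneg[of V x] by linarith
  have "K \<noteq> {}" using normalise[OF x0(1) pos[OF x0(1,2)] x0(3)] by auto
  moreover have "compact K" unfolding K_def by (rule compact_unit_sphere_on[OF fin])
  moreover have "continuous_on K Q"
  proof -
    have "Q = (\<lambda>x. \<Sum>u\<in>V. x u * (\<Sum>v\<in>V. M u v * x v))"
      by (auto simp: Q_def ip_def mat_app_def)
    then show ?thesis by (auto intro!: continuous_intros intro: continuous_on_subset[OF continuous_on_product_coordinates])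
  qed
  ultimately obtain x where x: "x \<in> K" and mx: "\<And>y. y \<in> K \<Longrightarrow> Q y \<le> Q x"
    using continuous_attains_sup[of K Q] by blast
  \<comment> \<open>The residual of the eigenvalue equation with \<open>Q x\<close> as eigenvalue.
    It is orthogonal to x and to B, so \<open>x + e * r\<close> is an admissible perturbation, and
    maximality of \<open>Q x\<close> forces r = 0.\<close>
  define r where "r = (\<lambda>u. mat_app V M x u + (- Q x) * x u)"
  have xV: "x \<in> vectors_on V" "ip V x x = 1" and xB: "\<And>b. b \<in> B \<Longrightarrow> ip V x b = 0"
    using x by (auto simp: K_def)
  have rV: "r \<in> vectors_on V"
    using xV mat_app_in_vectors[of V M x] by (auto simp: r_def vectors_on_def)
  have rB: "ip V r b = 0" if "b \<in> B" for b
  proof -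
    obtain \<theta> where "b \<in> eigenspace_on V M \<theta>" using B[OF \<open>b \<in> B\<close>] by blast
    then have "mat_app V M b = (\<lambda>u. \<theta> * b u)" by (simp add: eigenspace_on_iff)
    then have "ip V (mat_app V M x) b = \<theta> * ip V x b"
      using ip_mat_app_sym[OF sym, of V x b] ip_scale[of V \<theta> b x] by (simp add: ip_commute)
    then show ?thesis using xB[OF that] unfolding r_def by (simp add: ip_diff ip_scale)
  qed
  have xr: "ip V x r = 0"
    using xV ip_commute[of V x "mat_app V M x"]
    by (subst ip_commute) (simp add: r_def ip_diff ip_scale Q_def)
  have Mxr: "ip V (mat_app V M x) r = ip V r r"
  proof -
    have "ip V r r = ip V (mat_app V M x) r + (- Q x) * ip V x r"
      unfolding r_def by (subst ip_add) (simp only: ip_scale)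
    then show ?thesis using xr by simp
  qed
  have key: "Q y \<le> Q x * ip V y y" if "y \<in> vectors_on V" "\<forall>b\<in>B. ip V y b = 0" for y
  proof (cases "y = (\<lambda>_. 0)")
    case True then show ?thesis by (simp add: Q_def ip_def)
  next
    case False
    note p = pos[OF that(1) False]
    have "Q (\<lambda>u. y u / sqrt (ip V y y)) \<le> Q x"
      by (rule mx[OF normalise[OF that(1) p that(2)]])
    moreover have "Q (\<lambda>u. y u / sqrt (ip V y y)) = Q y / ip V y y"
    proof -
      have 1: "mat_app V M (\<lambda>u. y u / sqrt (ip V y y)) = (\<lambda>u. mat_app V M y u / sqrt (ip V y y))"
        by (auto simp: mat_app_def sum_divide_distrib)
      have "Q (\<lambda>u. y u / sqrt (ip V y y)) = (\<Sum>u\<in>V. y u * mat_app V M y u / ip V y y)"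
        unfolding Q_def 1 using p by (auto simp: ip_def[of V "\<lambda>u. y u / _"] intro!: sum.cong)
      then show ?thesis by (simp add: Q_def ip_def[of V y "mat_app V M y"] sum_divide_distrib)
    qed
    ultimately show ?thesis using p by (simp add: field_simps)
  qed
  have "2 * e * ip V r r + e^2 * (Q r - Q x * ip V r r) \<le> 0" for e
  proof -
    let ?y = "\<lambda>u. x u + e * r u"
    have "?y \<in> vectors_on V" using xV rV by (auto simp: vectors_on_def)
    moreover have "\<forall>b\<in>B. ip V ?y b = 0" using xB rB by (simp add: ip_add ip_scale)
    ultimately have "Q ?y \<le> Q x * ip V ?y ?y" by (rule key)
    moreover have "ip V ?y w = ip V x w + e * ip V r w" "ip V w ?y = ip V w x + e * ip V w r" for w
      by (simp_all add: ip_add ip_scale ip_commute[of V w])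
    then have "ip V ?y ?y = 1 + e^2 * ip V r r"
      using xV xr by (simp add: ip_commute[of V r x] power2_eq_square algebra_simps)
    moreover have "Q ?y = Q x + 2 * e * ip V r r + e^2 * Q r"
    proof -
      have w: "ip V w (\<lambda>u. mat_app V M x u + e * mat_app V M r u)
          = ip V w (mat_app V M x) + e * ip V w (mat_app V M r)" for w
        by (simp add: ip_add ip_scale ip_commute[of V w])
      have "ip V x (mat_app V M r) = ip V r r"
        using ip_mat_app_sym[OF sym, of V x r] Mxr by simp
      moreover have "ip V r (mat_app V M x) = ip V r r"
        using Mxr by (simp add: ip_commute)
      ultimately show ?thesis
        unfolding Q_def mat_app_add_scale w ip_add ip_scale
        by (simp add: power2_eq_square algebra_simps)
    qed
    ultimately show ?thesis by (simp add: algebra_simps)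
  qed
  then have "ip V r r = 0" using no_linear_below_quadratic ip_nonneg by metis
  then have "r = (\<lambda>_. 0)" using ip_zero_iff[OF fin rV] by simp
  then have "mat_app V M x = (\<lambda>u. Q x * x u)"
    by (auto simp: r_def fun_eq_iff)
  then have "x \<in> eigenspace_on V M (Q x)" using xV by (simp add: eigenspace_on_iff)
  then show ?thesis using xV xB by blast
qed

section \<open>Orthonormal bases of eigenvectors\<close>

definition orthonormal_eigenbasis ::
    "'a set \<Rightarrow> ('a \<Rightarrow> 'a \<Rightarrow> real) \<Rightarrow> ('a \<Rightarrow> real) set \<Rightarrow> (('a \<Rightarrow> real) \<Rightarrow> real) \<Rightarrow> bool" where
  "orthonormal_eigenbasis V M B ev \<longleftrightarrow> finite B \<and>
     (\<forall>b\<in>B. b \<in> eigenspace_on V M (ev b)) \<and>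
     (\<forall>b\<in>B. \<forall>c\<in>B. ip V b c = (if b = c then 1 else 0)) \<and>
     (\<forall>x\<in>vectors_on V. x = (\<lambda>u. \<Sum>b\<in>B. ip V x b * b u))"

text \<open>Bessel's inequality for each standard basis vector, summed over V: the left-hand sides
  add up to the number of unit vectors in B. This bounds orthonormal families without a notion of
  dimension.\<close>

lemma card_orthonormal_le:
  assumes fin: "finite V" "finite B"
    and on: "\<forall>b\<in>B. \<forall>c\<in>B. ip V b c = (if b = c then 1 else 0)"
  shows "card B \<le> card V"
proof -
  have bessel: "(\<Sum>b\<in>B. (b u)^2) \<le> 1" if u: "u \<in> V" for u
  proof -
    let ?e = "\<lambda>w. if w = u then 1 else (0::real)"
    let ?s = "\<lambda>w. \<Sum>b\<in>B. b u * b w"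
    have es: "ip V ?e y = y u" for y using ip_delta[OF fin(1) u] .
    have sb: "ip V ?s b = b u" if "b \<in> B" for b
      using on that fin by (simp add: ip_sum ip_scale if_distrib[of "times _"] cong: if_cong)
    have "0 \<le> ip V (\<lambda>w. ?e w - ?s w) (\<lambda>w. ?e w - ?s w)" by (rule ip_nonneg)
    also have "\<dots> = 1 - 2 * ?s u + ip V ?s ?s"
      unfolding ip_diff by (subst (1 2) ip_commute) (simp add: ip_diff es ip_commute[of V ?s ?e])
    also have "ip V ?s ?s = ?s u"
      using sb by (subst ip_sum) (simp add: ip_scale ip_commute[of V _ ?s] cong: sum.cong)
    finally show ?thesis by (simp add: power2_eq_square)
  qed
  have "real (card B) = (\<Sum>b\<in>B. ip V b b)" using on by simp
  also have "\<dots> = (\<Sum>u\<in>V. \<Sum>b\<in>B. (b u)^2)"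
    unfolding ip_def power2_eq_square by (rule sum.swap)
  also have "\<dots> \<le> (\<Sum>u\<in>V. 1)" by (intro sum_mono bessel)
  finally show ?thesis by simp
qed

text \<open>An orthonormal set of eigenvectors of maximal size is complete: otherwise some x differs
  from its expansion, the difference is orthogonal to the set, and
  \<open>exists_eigenvector_orthogonal_to\<close> yields a further eigenvector.\<close>

theorem spectral_theorem_on:
  assumes fin: "finite V" and sym: "symmetric_matrix M"
  obtains B ev where "orthonormal_eigenbasis V M B ev"
proof -
  define P where "P B \<longleftrightarrow> finite B \<and> (\<forall>b\<in>B. \<exists>\<theta>. b \<in> eigenspace_on V M \<theta>) \<and>
     (\<forall>b\<in>B. \<forall>c\<in>B. ip V b c = (if b = c then 1 else 0))" for B
  have "P {}" by (simp add: P_def)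
  moreover have "\<forall>B. P B \<longrightarrow> card B \<le> card V"
    using card_orthonormal_le[OF fin] by (auto simp: P_def)
  ultimately obtain B where B: "P B" and mx: "\<And>C. P C \<Longrightarrow> card C \<le> card B"
    using ex_has_greatest_nat[of P "{}" card "Suc (card V)"] by (auto simp: less_Suc_eq_le)
  define ev where "ev b = (SOME \<theta>. b \<in> eigenspace_on V M \<theta>)" for b
  have ev: "b \<in> eigenspace_on V M (ev b)" if "b \<in> B" for b
    unfolding ev_def using B that by (auto simp: P_def intro: someI_ex)
  have finB: "finite B" and on: "\<And>b c. b \<in> B \<Longrightarrow> c \<in> B \<Longrightarrow> ip V b c = (if b = c then 1 else 0)"
    using B by (auto simp: P_def)
  have "x = (\<lambda>u. \<Sum>b\<in>B. ip V x b * b u)" if x: "x \<in> vectors_on V" for x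
  proof (rule ccontr)
    assume ne: "x \<noteq> (\<lambda>u. \<Sum>b\<in>B. ip V x b * b u)"
    define y where "y = (\<lambda>u. x u - (\<Sum>b\<in>B. ip V x b * b u))"
    have "y \<in> vectors_on V" using x ev
      by (auto simp: y_def vectors_on_def eigenspace_on_def intro!: sum.neutral)
    moreover have "y \<noteq> (\<lambda>_. 0)" using ne by (auto simp: y_def fun_eq_iff)
    moreover have "\<forall>c\<in>B. ip V y c = 0"
      using finB on by (simp add: y_def ip_diff ip_sum ip_scale if_distrib[of "times _"] cong: if_cong)
    moreover have "\<exists>\<theta>. b \<in> eigenspace_on V M \<theta>" if "b \<in> B" for b
      using ev[OF that] by blast
    ultimately have "\<exists>z \<theta>. z \<in> eigenspace_on V M \<theta> \<and> ip V z z = 1 \<and> (\<forall>b\<in>B. ip V z b = 0)"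
      by (intro exists_eigenvector_orthogonal_to[OF fin sym])
    then obtain z \<theta> where z: "z \<in> eigenspace_on V M \<theta>" "ip V z z = 1" "\<forall>b\<in>B. ip V z b = 0"
      by (elim exE conjE)
    have zB: "z \<notin> B" using z by auto
    have "P (insert z B)"
    proof -
      have "ip V b z = 0" if "b \<in> B" for b using z that ip_commute[of V b z] by simp
      then show ?thesis using B z zB by (auto simp: P_def)
    qed
    then have "card (insert z B) \<le> card B" by (rule mx)
    then show False using zB finB by simp
  qed
  then have "orthonormal_eigenbasis V M B ev"
    using finB on ev by (auto simp: orthonormal_eigenbasis_def)
  then show ?thesis by (rule that)
qed

section \<open>Eigenprojections expressed through an eigenbasis\<close>

lemma ip_eigenvectors_eq_0:
  assumes sym: "symmetric_matrix M"
    and "x \<in> eigenspace_on V M \<theta>" "y \<in> eigenspace_on V M \<tau>" "\<theta> \<noteq> \<tau>"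
  shows "ip V x y = 0"
proof -
  have "\<theta> * ip V x y = ip V (mat_app V M x) y"
    using assms(2) by (simp add: eigenspace_on_iff ip_scale)
  also have "\<dots> = ip V (mat_app V M y) x"
    using ip_mat_app_sym[OF sym] by (simp add: ip_commute)
  also have "\<dots> = \<tau> * ip V x y"
    using assms(3) by (simp add: eigenspace_on_iff ip_scale ip_commute)
  finally show ?thesis using \<open>\<theta> \<noteq> \<tau>\<close> by simp
qed

text \<open>Resolves the definite description: if p and q both qualify, p - q lies in the eigenspace
  and is orthogonal to itself.\<close>

lemma orthogonal_projection_on_eigenspace_eqI:
  assumes fin: "finite V" and p: "p \<in> eigenspace_on V M \<theta>"
    and orth: "\<And>s. s \<in> eigenspace_on V M \<theta> \<Longrightarrow> ip V (\<lambda>u. x u - p u) s = 0"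
  shows "orthogonal_projection_on V (eigenspace_on V M \<theta>) x = p"
  unfolding orthogonal_projection_on_def
proof (rule the_equality)
  show "p \<in> eigenspace_on V M \<theta> \<and> (\<forall>s\<in>eigenspace_on V M \<theta>. (\<Sum>u\<in>V. (x u - p u) * s u) = 0)"
    using p orth by (simp add: ip_def)
next
  fix q assume q: "q \<in> eigenspace_on V M \<theta> \<and> (\<forall>s\<in>eigenspace_on V M \<theta>. (\<Sum>u\<in>V. (x u - q u) * s u) = 0)"
  define d where "d = (\<lambda>u. p u - q u)"
  have d: "d \<in> eigenspace_on V M \<theta>"
    using p q unfolding d_def eigenspace_on_def vectors_on_def
    by (auto simp: right_diff_distrib sum_subtractf)
  have "ip V (\<lambda>u. x u - q u) d - ip V (\<lambda>u. x u - p u) d = ip V d d"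
    by (simp add: d_def ip_diff)
  then have "ip V d d = 0" using orth[OF d] q d by (simp add: ip_def)
  then have "d = (\<lambda>_. 0)" using ip_zero_iff[OF fin] d by (simp add: eigenspace_on_iff)
  then show "q = p" by (auto simp: d_def fun_eq_iff)
qed

definition proj_entry :: "'a set \<Rightarrow> ('a \<Rightarrow> 'a \<Rightarrow> real) \<Rightarrow> real \<Rightarrow> 'a \<Rightarrow> 'a \<Rightarrow> real" where
  "proj_entry V M \<theta> u v =
     orthogonal_projection_on V (eigenspace_on V M \<theta>) (\<lambda>w. if w = v then 1 else 0) u"

context
  fixes V :: "'a set" and M :: "'a \<Rightarrow> 'a \<Rightarrow> real"
    and B :: "('a \<Rightarrow> real) set" and ev :: "('a \<Rightarrow> real) \<Rightarrow> real"
  assumes fin: "finite V" and sym: "symmetric_matrix M"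
    and basis: "orthonormal_eigenbasis V M B ev"
begin

lemma finite_basis: "finite B"
  and basis_eigen: "b \<in> B \<Longrightarrow> b \<in> eigenspace_on V M (ev b)"
  and basis_ip: "b \<in> B \<Longrightarrow> c \<in> B \<Longrightarrow> ip V b c = (if b = c then 1 else 0)"
  and basis_expand: "x \<in> vectors_on V \<Longrightarrow> x u = (\<Sum>b\<in>B. ip V x b * b u)"
  using basis unfolding orthonormal_eigenbasis_def by (auto dest: fun_cong)

lemma basis_expand_eigenvector:
  assumes "s \<in> eigenspace_on V M \<theta>"
  shows "s u = (\<Sum>b\<in>{b\<in>B. ev b = \<theta>}. ip V s b * b u)"
proof -
  have "s u = (\<Sum>b\<in>B. ip V s b * b u)"
    using assms by (intro basis_expand) (simp add: eigenspace_on_iff)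
  also have "\<dots> = (\<Sum>b\<in>{b\<in>B. ev b = \<theta>}. ip V s b * b u)"
    using finite_basis ip_eigenvectors_eq_0[OF sym assms basis_eigen]
    by (intro sum.mono_neutral_right) auto
  finally show ?thesis .
qed

lemma eigenvalues_on_basis: "eigenvalues_on V M = ev ` B"
proof
  show "ev ` B \<subseteq> eigenvalues_on V M"
  proof
    fix \<theta> assume "\<theta> \<in> ev ` B"
    then obtain b where b: "b \<in> B" "\<theta> = ev b" by auto
    then have "b \<noteq> (\<lambda>_. 0)" using basis_ip[of b b] by (auto simp: ip_def)
    then show "\<theta> \<in> eigenvalues_on V M"
      unfolding eigenvalues_on_def using basis_eigen b by auto
  qed
  show "eigenvalues_on V M \<subseteq> ev ` B"
  proof
    fix \<theta> assume "\<theta> \<in> eigenvalues_on V M"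
    then obtain s where s: "s \<in> eigenspace_on V M \<theta>" "s \<noteq> (\<lambda>_. 0)"
      by (auto simp: eigenvalues_on_def)
    then have "{b\<in>B. ev b = \<theta>} \<noteq> {}"
      using basis_expand_eigenvector[OF s(1)] by (metis ext sum.empty)
    then show "\<theta> \<in> ev ` B" by auto
  qed
qed

lemma proj_entry_basis:
  assumes v: "v \<in> V"
  shows "proj_entry V M \<theta> u v = (\<Sum>b\<in>{b\<in>B. ev b = \<theta>}. b v * b u)"
proof -
  let ?p = "\<lambda>u. \<Sum>b\<in>{b\<in>B. ev b = \<theta>}. b v * b u"
  have "?p \<in> eigenspace_on V M \<theta>"
    using basis_eigen by (intro eigenspace_on_sum eigenspace_on_scale) auto
  moreover have "ip V (\<lambda>u. (if u = v then 1 else 0) - ?p u) s = 0"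
    if "s \<in> eigenspace_on V M \<theta>" for s
  proof -
    have "s v = (\<Sum>b\<in>{b\<in>B. ev b = \<theta>}. b v * ip V b s)"
      by (subst basis_expand_eigenvector[OF that, of v]) (simp add: ip_commute mult.commute)
    then show ?thesis by (simp add: ip_diff ip_delta[OF fin v] ip_sum ip_scale)
  qed
  ultimately show ?thesis
    unfolding proj_entry_def by (subst orthogonal_projection_on_eigenspace_eqI[OF fin]) auto
qed

lemma sum_over_eigenvalues:
  fixes f :: "('a \<Rightarrow> real) \<Rightarrow> real"
  shows "(\<Sum>\<theta>\<in>eigenvalues_on V M. g \<theta> * (\<Sum>b\<in>{b\<in>B. ev b = \<theta>}. f b)) = (\<Sum>b\<in>B. g (ev b) * f b)"
proof -
  have "(\<Sum>b\<in>B. g (ev b) * f b) = (\<Sum>\<theta>\<in>ev ` B. \<Sum>b\<in>{b\<in>B. ev b = \<theta>}. g (ev b) * f b)"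
    by (rule sum.image_gen[OF finite_basis])
  also have "\<dots> = (\<Sum>\<theta>\<in>ev ` B. g \<theta> * (\<Sum>b\<in>{b\<in>B. ev b = \<theta>}. f b))"
    unfolding sum_distrib_left by (intro sum.cong refl) auto
  finally show ?thesis by (simp add: eigenvalues_on_basis)
qed

lemma basis_delta: "v \<in> V \<Longrightarrow> (\<Sum>b\<in>B. b v * b u) = (if u = v then 1 else 0)"
  using basis_expand[of "\<lambda>w. if w = v then 1 else 0" u] ip_delta[OF fin]
  by (auto simp: vectors_on_def)

lemma basis_matrix:
  assumes "u \<in> V" "v \<in> V"
  shows "(\<Sum>b\<in>B. ev b * (b v * b u)) = M u v"
proof -
  have "(\<Sum>b\<in>B. ev b * (b v * b u)) = (\<Sum>b\<in>B. b v * (\<Sum>w\<in>V. M u w * b w))"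
    using basis_eigen assms by (intro sum.cong) (auto simp: eigenspace_on_def)
  also have "\<dots> = (\<Sum>w\<in>V. M u w * (\<Sum>b\<in>B. b v * b w))"
    unfolding sum_distrib_left by (subst sum.swap) (simp add: mult_ac)
  also have "\<dots> = M u v"
    using assms fin by (simp add: basis_delta if_distrib[of "times _"] cong: if_cong)
  finally show ?thesis .
qed

lemma basis_matrix_square:
  assumes "v \<in> V"
  shows "(\<Sum>b\<in>B. (ev b)^2 * (b v * b v)) = (\<Sum>w\<in>V. (M v w)^2)"
proof -
  have "(\<Sum>b\<in>B. (ev b)^2 * (b v * b v)) = (\<Sum>b\<in>B. ev b * b v * (\<Sum>w\<in>V. M v w * b w))"
    using basis_eigen assms
    by (intro sum.cong) (auto simp: eigenspace_on_def power2_eq_square)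
  also have "\<dots> = (\<Sum>w\<in>V. M v w * (\<Sum>b\<in>B. ev b * (b v * b w)))"
    unfolding sum_distrib_left by (subst sum.swap) (simp add: mult_ac)
  also have "\<dots> = (\<Sum>w\<in>V. M v w * M w v)"
    using assms by (simp add: basis_matrix)
  finally show ?thesis using sym by (simp add: power2_eq_square symmetric_matrix_def)
qed

end

section \<open>Basis-free properties of the eigenprojections\<close>

locale symmetric_on =
  fixes V :: "'a set" and M :: "'a \<Rightarrow> 'a \<Rightarrow> real"
  assumes finite_V: "finite V" and sym_M: "symmetric_matrix M"
begin

abbreviation "E \<equiv> proj_entry V M"
abbreviation "evs \<equiv> eigenvalues_on V M"

lemma E_eigenvector: "v \<in> V \<Longrightarrow> (\<lambda>u. E \<theta> u v) \<in> eigenspace_on V M \<theta>"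
  by (rule spectral_theorem_on[OF finite_V sym_M])
     (auto simp: proj_entry_basis[OF finite_V sym_M] intro!: eigenspace_on_sum eigenspace_on_scale
       intro: basis_eigen[OF finite_V sym_M])

text \<open>A column of the projection is the reproducing kernel of the eigenspace: pairing with it
  evaluates at v. Applied to one explicit eigenvector, this gives most of the exact masses computed
  later.\<close>

lemma E_reproduce:
  assumes "v \<in> V" "s \<in> eigenspace_on V M \<theta>"
  shows "(\<Sum>u\<in>V. E \<theta> u v * s u) = s v"
proof (rule spectral_theorem_on[OF finite_V sym_M])
  fix B ev assume b: "orthonormal_eigenbasis V M B ev"
  have "(\<Sum>u\<in>V. E \<theta> u v * s u) = (\<Sum>b\<in>{b\<in>B. ev b = \<theta>}. b v * ip V b s)"
    using assms(1) by (simp add: proj_entry_basis[OF finite_V sym_M b] ip_def sum_distrib_right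
        sum_distrib_left mult.assoc) (rule sum.swap)
  then show ?thesis
    using basis_expand_eigenvector[OF finite_V sym_M b assms(2), of v]
    by (simp add: ip_commute mult.commute)
qed

lemma E_commute:
  assumes "u \<in> V" "v \<in> V"
  shows "E \<theta> u v = E \<theta> v u"
  by (rule spectral_theorem_on[OF finite_V sym_M])
     (use assms in \<open>auto simp: proj_entry_basis[OF finite_V sym_M] mult.commute\<close>)

lemma E_diag: "v \<in> V \<Longrightarrow> E \<theta> v v = (\<Sum>u\<in>V. (E \<theta> u v)^2)"
  using E_reproduce[OF _ E_eigenvector, of v v \<theta>] by (simp add: power2_eq_square)

lemma E_diag_nonneg: "v \<in> V \<Longrightarrow> 0 \<le> E \<theta> v v"
  using E_diag by (simp add: sum_nonneg)

lemma finite_evs: "finite evs"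
  by (rule spectral_theorem_on[OF finite_V sym_M])
     (auto simp: eigenvalues_on_basis[OF finite_V sym_M] finite_basis[OF finite_V sym_M])

lemma E_not_eigenvalue:
  assumes "v \<in> V" "\<theta> \<notin> evs"
  shows "E \<theta> u v = 0"
proof -
  have "(\<lambda>u. E \<theta> u v) = (\<lambda>_. 0)"
    using E_eigenvector[OF assms(1), of \<theta>] assms(2) unfolding eigenvalues_on_def by blast
  then show ?thesis by (rule fun_cong)
qed

lemma sum_E_diag:
  assumes v: "v \<in> V"
  shows "(\<Sum>\<theta>\<in>evs. E \<theta> v v) = 1"
proof (rule spectral_theorem_on[OF finite_V sym_M])
  fix B ev assume b: "orthonormal_eigenbasis V M B ev"
  show ?thesis
    using sum_over_eigenvalues[OF finite_V sym_M b, of "\<lambda>_. 1" "\<lambda>b. b v * b v"] v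
    by (simp add: proj_entry_basis[OF finite_V sym_M b] basis_delta[OF finite_V sym_M b])
qed

lemma sum_E_diag_moment1:
  assumes v: "v \<in> V"
  shows "(\<Sum>\<theta>\<in>evs. \<theta> * E \<theta> v v) = M v v"
proof (rule spectral_theorem_on[OF finite_V sym_M])
  fix B ev assume b: "orthonormal_eigenbasis V M B ev"
  show ?thesis
    using sum_over_eigenvalues[OF finite_V sym_M b, of "\<lambda>\<theta>. \<theta>" "\<lambda>b. b v * b v"] v
    by (simp add: proj_entry_basis[OF finite_V sym_M b] basis_matrix[OF finite_V sym_M b])
qed

lemma sum_E_diag_moment2:
  assumes v: "v \<in> V"
  shows "(\<Sum>\<theta>\<in>evs. \<theta>^2 * E \<theta> v v) = (\<Sum>w\<in>V. (M v w)^2)"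
proof (rule spectral_theorem_on[OF finite_V sym_M])
  fix B ev assume b: "orthonormal_eigenbasis V M B ev"
  show ?thesis
    using sum_over_eigenvalues[OF finite_V sym_M b, of "\<lambda>\<theta>. \<theta>^2" "\<lambda>b. b v * b v"] v
    by (simp add: proj_entry_basis[OF finite_V sym_M b] basis_matrix_square[OF finite_V sym_M b])
qed

text \<open>Converse of \<open>E_reproduce\<close>: the reproducing property determines the column.
  It serves to transport projections along graph isomorphisms.\<close>

lemma E_eqI:
  assumes "v \<in> V" "p \<in> eigenspace_on V M \<theta>"
    and "\<And>s. s \<in> eigenspace_on V M \<theta> \<Longrightarrow> (\<Sum>u\<in>V. p u * s u) = s v"
  shows "E \<theta> u v = p u"
proof -
  have "ip V (\<lambda>u. (if u = v then 1 else 0) - p u) s = 0" if "s \<in> eigenspace_on V M \<theta>" for s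
    using assms that by (simp add: ip_diff ip_delta[OF finite_V]) (simp add: ip_def)
  then show ?thesis
    unfolding proj_entry_def
    using orthogonal_projection_on_eigenspace_eqI[OF finite_V assms(2)] by metis
qed

end

section \<open>Laziness as a defect of concentration\<close>

lemma sum_power2_le_power2_sum:
  fixes p :: "'i \<Rightarrow> real"
  assumes "finite A" "\<And>i. i \<in> A \<Longrightarrow> 0 \<le> p i"
  shows "(\<Sum>i\<in>A. (p i)^2) \<le> (\<Sum>i\<in>A. p i)^2"
proof -
  have "(\<Sum>i\<in>A. (p i)^2) \<le> (\<Sum>i\<in>A. p i * (\<Sum>j\<in>A. p j))"
    using assms member_le_sum[of _ A p]
    by (intro sum_mono) (auto simp: power2_eq_square intro!: mult_left_mono)
  then show ?thesis by (simp add: sum_distrib_right[symmetric] power2_eq_square)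
qed

text \<open>The masses outside B are merged into a single atom, which can only increase the sum of
  squares.\<close>

lemma sum_power2_le_split:
  fixes p :: "'i \<Rightarrow> real"
  assumes "finite A" "\<And>i. i \<in> A \<Longrightarrow> 0 \<le> p i" "B \<subseteq> A"
  shows "(\<Sum>i\<in>A. (p i)^2) \<le> (\<Sum>i\<in>B. (p i)^2) + ((\<Sum>i\<in>A. p i) - (\<Sum>i\<in>B. p i))^2"
proof -
  have "(\<Sum>i\<in>A. (p i)^2) = (\<Sum>i\<in>A-B. (p i)^2) + (\<Sum>i\<in>B. (p i)^2)"
    "(\<Sum>i\<in>A. p i) = (\<Sum>i\<in>A-B. p i) + (\<Sum>i\<in>B. p i)"
    using assms sum.subset_diff[of B A] by blast+
  then show ?thesis using sum_power2_le_power2_sum[of "A - B" p] assms by auto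
qed

text \<open>The extremal distribution has one atom m and one atom S - m. If some atom p is at least
  S / 2, merging the others gives p^2 + (S - p)^2, which increases on that range; if none is, the
  sum is at most S^2 / 2, the minimum of the same function.\<close>

lemma sum_power2_le_bounded:
  fixes p :: "'i \<Rightarrow> real"
  assumes fin: "finite A" and nn: "\<And>i. i \<in> A \<Longrightarrow> 0 \<le> p i" and le: "\<And>i. i \<in> A \<Longrightarrow> p i \<le> m"
    and S: "(\<Sum>i\<in>A. p i) = S" "S \<le> 2 * m"
  shows "(\<Sum>i\<in>A. (p i)^2) \<le> m^2 + (S - m)^2"
proof (cases "\<exists>i\<in>A. S \<le> 2 * p i")
  case True
  then obtain i where i: "i \<in> A" "S \<le> 2 * p i" by blast
  have "(\<Sum>i\<in>A. (p i)^2) \<le> (p i)^2 + (S - p i)^2"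
    using sum_power2_le_split[of A p "{i}"] fin nn i S by simp
  also have "\<dots> \<le> m^2 + (S - m)^2"
  proof -
    have "0 \<le> (m - p i) * (2 * (m + p i - S))"
      using le[OF i(1)] i(2) S(2) by (intro mult_nonneg_nonneg) auto
    then show ?thesis by (simp add: power2_eq_square algebra_simps)
  qed
  finally show ?thesis .
next
  case False
  have "(\<Sum>i\<in>A. (p i)^2) \<le> (\<Sum>i\<in>A. p i * (S / 2))"
  proof (intro sum_mono)
    fix i assume i: "i \<in> A"
    have "p i * p i \<le> p i * (S / 2)"
      using False i nn[OF i] by (intro mult_left_mono) auto
    then show "(p i)^2 \<le> p i * (S / 2)" by (simp add: power2_eq_square)
  qed
  also have "\<dots> = S * S / 2" unfolding sum_distrib_right[symmetric] S(1) by simp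
  also have "\<dots> \<le> m^2 + (S - m)^2"
    using zero_le_power2[of "2 * m - S"] by (simp add: power2_eq_square algebra_simps)
  finally show ?thesis .
qed

section \<open>The Laplacian of a connected graph\<close>

definition nbrs :: "'a pair_pre_digraph \<Rightarrow> 'a \<Rightarrow> 'a set" where
  "nbrs G u = {v. (u, v) \<in> parcs G}"

locale connected_graph =
  fixes G :: "'a pair_pre_digraph"
  assumes graph: "pair_graph G" and conn: "Digraph_Component.connected (with_proj G)"
begin

abbreviation "V \<equiv> pverts G"
abbreviation "N \<equiv> nbrs G"

lemma finite_verts: "finite V"
  using graph by (simp add: pair_graph_def pair_digraph_def pair_fin_digraph_def
      pair_fin_digraph_axioms_def)

lemma N_sym: "v \<in> N u \<longleftrightarrow> u \<in> N v"
  using pair_sym_digraph.arcs_symmetric[of G] graph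
  by (auto simp: nbrs_def pair_graph_def pair_pseudo_graph_def)

lemma N_subset: "N u \<subseteq> V"
  using pair_wf_digraph.in_arcsD2[of G] graph
  by (auto simp: nbrs_def pair_graph_def pair_pseudo_graph_def pair_sym_digraph_def)

lemma N_in: "v \<in> N u \<Longrightarrow> v \<in> V" "v \<in> N u \<Longrightarrow> u \<in> V"
  using N_subset N_sym by blast+

lemma N_irrefl: "u \<notin> N u"
  using pair_loopfree_digraph.no_loops'[of G u u] graph
  by (auto simp: nbrs_def pair_graph_def pair_digraph_def)

lemma finite_N: "finite (N u)"
  using finite_subset[OF N_subset finite_verts] .

lemma verts_ne: "V \<noteq> {}"
  using conn by (auto simp: connected_def strongly_connected_def mk_symmetric_def)

text \<open>Later proofs read off a whole graph from this: once the neighbourhoods of some listed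
  vertices close up, no other vertices exist.\<close>

lemma closed_eq_verts:
  assumes "S \<subseteq> V" "S \<noteq> {}" "\<And>u. u \<in> S \<Longrightarrow> N u \<subseteq> S"
  shows "S = V"
proof
  show "V \<subseteq> S"
  proof
    fix v assume v: "v \<in> V"
    obtain u where u: "u \<in> S" using assms by auto
    have "u \<rightarrow>\<^sup>*\<^bsub>mk_symmetric (with_proj G)\<^esub> v"
      using conn v u assms(1) by (auto simp: connected_def strongly_connected_def mk_symmetric_def)
    then have "(u, v) \<in> rtrancl_on V (parcs (mk_symmetric G))"
      by (simp add: reachable_def)
    moreover have "parcs (mk_symmetric G) = parcs G"
    proof -
      have "(w, x) \<in> parcs G" if "(x, w) \<in> parcs G" for x w
        using that N_sym[of w x] by (simp add: nbrs_def)
      then show ?thesis by (auto simp: mk_symmetric_def symcl_def)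
    qed
    ultimately have "(u, v) \<in> rtrancl_on V (parcs G)" by simp
    then show "v \<in> S"
      using u assms(3) by (induction rule: rtrancl_on_induct) (auto simp: nbrs_def)
  qed
qed (use assms in auto)

lemma symmetric_laplacian: "symmetric_matrix (laplacian G)"
  using N_sym
  by (auto simp: symmetric_matrix_def laplacian_def degree_matrix_def adjacency_matrix_def nbrs_def)

sublocale symmetric_on V "laplacian G"
  by unfold_locales (fact finite_verts, fact symmetric_laplacian)

lemma out_degree_eq: "out_degree (with_proj G) u = card (N u)"
proof -
  have "out_arcs (with_proj G) u = Pair u ` N u"
    by (auto simp: out_arcs_def nbrs_def)
  then show ?thesis by (simp add: out_degree_def card_image inj_on_def)
qed

lemma laplacian_apply:
  fixes x :: "'a \<Rightarrow> real"
  assumes "u \<in> V"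
  shows "(\<Sum>v\<in>V. laplacian G u v * x v) = real (card (N u)) * x u - (\<Sum>v\<in>N u. x v)"
proof -
  have "(\<Sum>v\<in>V. laplacian G u v * x v)
      = (\<Sum>v\<in>V. (if u = v then real (card (N u)) * x v else 0)) - (\<Sum>v\<in>V. if v \<in> N u then x v else 0)"
    unfolding sum_subtractf[symmetric]
    using N_irrefl by (intro sum.cong)
       (auto simp: laplacian_def degree_matrix_def adjacency_matrix_def out_degree_eq nbrs_def)
  moreover have "(\<Sum>v\<in>V. if v \<in> N u then x v else 0) = (\<Sum>v\<in>N u. x v)"
    using N_subset by (simp add: sum.If_cases[OF finite_verts] Int_absorb1 Int_absorb2)
  ultimately show ?thesis using assms finite_verts by simp
qed

lemma eigen_iff:
  "x \<in> eigenspace_on V (laplacian G) \<theta> \<longleftrightarrow>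
     (\<forall>u. u \<notin> V \<longrightarrow> x u = 0) \<and> (\<forall>u\<in>V. (\<Sum>v\<in>N u. x v) = (real (card (N u)) - \<theta>) * x u)"
proof -
  have "(\<Sum>v\<in>V. laplacian G u v * x v) = \<theta> * x u \<longleftrightarrow>
      (\<Sum>v\<in>N u. x v) = (real (card (N u)) - \<theta>) * x u" if "u \<in> V" for u
    unfolding laplacian_apply[OF that] left_diff_distrib by linarith
  then show ?thesis by (auto simp: eigenspace_on_def vectors_on_def)
qed

abbreviation "eig \<equiv> eigenspace_on V (laplacian G)"

lemma eigen_eq:
  assumes "x \<in> eig \<theta>" "u \<in> V"
  shows "(\<Sum>v\<in>N u. x v) = (real (card (N u)) - \<theta>) * x u"
  using assms by (simp add: eigen_iff)

lemma E_column: "v \<in> V \<Longrightarrow> (\<lambda>u. E \<theta> u v) \<in> eig \<theta>"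
  by (rule E_eigenvector)

lemma E_diag_ge:
  assumes "v \<in> V" "A \<subseteq> V"
  shows "(\<Sum>u\<in>A. (E \<theta> u v)^2) \<le> E \<theta> v v"
  unfolding E_diag[OF assms(1), of \<theta>] using assms finite_verts by (intro sum_mono2) auto

abbreviation n :: real where "n \<equiv> real (card V)"

lemma n_pos: "n > 0" "n \<ge> 1"
  using verts_ne finite_verts by (simp_all add: card_gt_0_iff Suc_le_eq)

text \<open>Maximum principle: at a vertex where x is maximal the kernel equation says that x is the
  average of its neighbours, so all of them are maximal too, and connectedness spreads this to every
  vertex.\<close>

lemma kernel_constant:
  assumes x: "x \<in> eig 0" and uv: "u \<in> V" "v \<in> V"
  shows "x u = x v"
proof -
  define m where "m = Max (x ` V)"
  have le: "x w \<le> m" if "w \<in> V" for w using that finite_verts by (simp add: m_def)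
  define A where "A = {w \<in> V. x w = m}"
  have "A \<noteq> {}" using Max_in[of "x ` V"] finite_verts verts_ne by (fastforce simp: A_def m_def)
  moreover have "N w \<subseteq> A" if w: "w \<in> A" for w
  proof -
    have "(\<Sum>y\<in>N w. m - x y) = 0"
      using eigen_eq[OF x, of w] w by (simp add: A_def sum_subtractf)
    then have "\<forall>y\<in>N w. m - x y = 0"
      using le N_subset finite_N by (subst (asm) sum_nonneg_eq_0_iff) (auto simp: subset_iff)
    then show ?thesis using N_subset by (auto simp: A_def)
  qed
  ultimately have "A = V" by (intro closed_eq_verts) (auto simp: A_def)
  then have "u \<in> A" "v \<in> A" using uv by simp_all
  then show ?thesis by (simp add: A_def)
qed

lemma E_zero:
  assumes v: "v \<in> V"
  shows "E 0 v v = 1 / n"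
proof -
  have "(\<Sum>w\<in>N u. if w \<in> V then 1 else (0::real)) = card (N u)" for u
    using N_subset by (simp add: sum.If_cases[OF finite_N] Int_absorb2 flip: Collect_mem_eq)
  then have "(\<lambda>u. if u \<in> V then 1 else 0) \<in> eig 0"
    unfolding eigen_iff by auto
  then have 1: "(\<Sum>u\<in>V. E 0 u v * (if u \<in> V then 1 else 0)) = 1"
    using E_reproduce[OF v, of "\<lambda>u. if u \<in> V then 1 else 0" 0] v by simp
  have "E 0 u v = E 0 v v" if "u \<in> V" for u
    using kernel_constant[OF E_column[OF v] that v] .
  then have "(\<Sum>u\<in>V. E 0 v v) = 1" using 1 by simp
  then show ?thesis using n_pos by (simp add: field_simps)
qed

lemma zero_in_evs: "0 \<in> evs"
proof -
  obtain v where "v \<in> V" using verts_ne by auto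
  then show ?thesis using E_zero[of v] E_not_eigenvalue[of v 0 v] n_pos by fastforce
qed

section \<open>Excess of a vertex and its lower bounds\<close>

abbreviation "S \<equiv> 1 - 1 / n"

lemma S_bounds: "0 \<le> S" "S \<le> 1"
  using n_pos by auto

text \<open>At a vertex, S is the total mass of the nonzero eigenvalues (\<open>sum_E_pos\<close>).
  So this is the sum of the products of masses over ordered pairs of distinct nonzero eigenvalues,
  and it vanishes exactly when one of them carries all of S.\<close>

definition excess :: "'a \<Rightarrow> real" where
  "excess u = S^2 - (\<Sum>\<theta>\<in>evs - {0}. (E \<theta> u u)^2)"

abbreviation "total_excess \<equiv> \<Sum>u\<in>V. excess u"

text \<open>Local description of \<open>double_star (card F) 1\<close>: q, b, a and F are closed
  under neighbours and hence, by connectedness, all the vertices. F = {} would be the path on three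
  vertices, a star.\<close>

abbreviation "double_star_shaped \<equiv> \<exists>q b a F. N q = {b} \<and> N b = {q, a} \<and> a \<noteq> q \<and> N a = insert b F \<and> b \<notin> F \<and>
      (\<forall>y\<in>F. N y = {a}) \<and> F \<noteq> {}"

lemma sum_E_pos: "v \<in> V \<Longrightarrow> (\<Sum>\<theta>\<in>evs - {0}. E \<theta> v v) = S"
  using sum_E_diag[of v] zero_in_evs finite_evs E_zero[of v] by (simp add: sum_diff1)

text \<open>Since n and S depend only on the number of vertices, comparing the laziness of two
  connected graphs of equal order means comparing their total excess in reverse.\<close>

lemma laziness_eq: "laziness G = n - 2 * S - total_excess"
proof -
  have "(\<Sum>\<theta>\<in>evs. (E \<theta> u u)^2) = (1 / n)^2 + S^2 - excess u" if "u \<in> V" for u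
    using sum.remove[OF finite_evs zero_in_evs, of "\<lambda>\<theta>. (E \<theta> u u)^2"] E_zero[OF that]
    by (simp add: excess_def)
  moreover have "eigenprojection G \<theta> u v = E \<theta> u v" for \<theta> u v
    by (simp add: eigenprojection_def proj_entry_def)
  ultimately have "laziness G = (\<Sum>u\<in>V. (1 / n)^2 + S^2 - excess u)"
    by (simp add: laziness_def average_mixing_matrix_def power2_eq_square)
  also have "\<dots> = n * ((1 / n)^2 + S^2) - total_excess"
    by (simp add: sum_subtractf)
  also have "n * ((1 / n)^2 + S^2) = n - 2 * S"
    using n_pos by (simp add: power2_eq_square field_simps)
  finally show ?thesis by simp
qed

text \<open>All nonzero eigenvalues outside B count as one atom, which can only lower the excess. B
  may contain numbers that are not eigenvalues, because their mass is 0.\<close>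

lemma excess_split:
  assumes v: "v \<in> V" and B: "finite B" "0 \<notin> B"
  shows "S^2 - (\<Sum>\<theta>\<in>B. (E \<theta> v v)^2) - (S - (\<Sum>\<theta>\<in>B. E \<theta> v v))^2 \<le> excess v"
proof -
  have 1: "(\<Sum>\<theta>\<in>B \<inter> evs. f (E \<theta> v v)) = (\<Sum>\<theta>\<in>B. f (E \<theta> v v))" if "f 0 = (0::real)" for f
    using B that E_not_eigenvalue[OF v] by (intro sum.mono_neutral_left) auto
  have "B \<inter> evs \<subseteq> evs - {0}" using B by auto
  then show ?thesis
    using sum_power2_le_split[of "evs - {0}" "\<lambda>\<theta>. E \<theta> v v" "B \<inter> evs"] B finite_evs
      E_diag_nonneg[OF v] sum_E_pos[OF v] 1[of "\<lambda>x. x"] 1[of "\<lambda>x. x^2"]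
    by (auto simp: excess_def)
qed

lemma excess_nonneg: "v \<in> V \<Longrightarrow> 0 \<le> excess v"
  using excess_split[of v "{}"] by simp

lemma excess_atom:
  assumes "v \<in> V" "\<theta> \<noteq> 0"
  shows "2 * E \<theta> v v * (S - E \<theta> v v) \<le> excess v"
  using excess_split[of v "{\<theta>}"] assms by (simp add: power2_eq_square algebra_simps)

lemma excess_bounded_atoms:
  assumes v: "v \<in> V" and m: "\<And>\<theta>. E \<theta> v v \<le> m" "1 / 2 \<le> m"
  shows "2 * m * (S - m) \<le> excess v"
  using sum_power2_le_bounded[of "evs - {0}" "\<lambda>\<theta>. E \<theta> v v" m S] finite_evs m
    E_diag_nonneg[OF v] sum_E_pos[OF v] S_bounds
  by (simp add: excess_def power2_eq_square algebra_simps)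

lemma sum_excess_ge:
  assumes "A \<subseteq> V"
  shows "(\<Sum>u\<in>A. excess u) \<le> total_excess"
  using assms finite_verts excess_nonneg by (intro sum_mono2) auto

section \<open>Leaves and pendant paths\<close>

lemma leaf_value:
  assumes x: "x \<in> eig \<theta>" and q: "N q = {b}"
  shows "x b = (1 - \<theta>) * x q"
proof -
  have "q \<in> V" using q N_in(2)[of b q] by auto
  then show ?thesis using eigen_eq[OF x, of q] q by simp
qed

text \<open>Two eigenvalue equations carry the value at the leaf along the path. In terms of t =
  \<theta> - 1 the coordinates at q, b, a are in the ratio 1 : - t : t^2 - t - 1, which is why
  eigenvalues are shifted by 1 throughout. The last polynomial vanishes at the golden ratio and its
  conjugate.\<close>

lemma pendant_value:
  assumes x: "x \<in> eig \<theta>" and q: "N q = {b}" and b: "N b = {q, a}" "a \<noteq> q"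
  shows "x a = ((\<theta> - 1)^2 - (\<theta> - 1) - 1) * x q"
proof -
  have "b \<in> V" using q N_in(1)[of b q] by auto
  then have "x q + x a = (2 - \<theta>) * x b" using eigen_eq[OF x, of b] b by simp
  then show ?thesis unfolding leaf_value[OF x q] by (simp add: power2_eq_square algebra_simps)
qed

text \<open>The leaf equation is applied once in each index of the symmetric matrix, hence the
  square.\<close>

lemma E_diag_leaf_nbr:
  assumes q: "N q = {b}"
  shows "E \<theta> b b = (\<theta> - 1)^2 * E \<theta> q q"
proof -
  have V: "q \<in> V" "b \<in> V" using q N_in[of b q] by auto
  have "E \<theta> b b = (1 - \<theta>) * E \<theta> q b" using leaf_value[OF E_column[OF V(2)] q] .
  also have "E \<theta> q b = E \<theta> b q" by (rule E_commute[OF V])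
  also have "E \<theta> b q = (1 - \<theta>) * E \<theta> q q" using leaf_value[OF E_column[OF V(1)] q] .
  finally show ?thesis by (simp add: power2_eq_square algebra_simps)
qed

lemma E_diag_pendant_root:
  assumes q: "N q = {b}" and b: "N b = {q, a}" "a \<noteq> q"
  shows "E \<theta> a a = ((\<theta> - 1)^2 - (\<theta> - 1) - 1)^2 * E \<theta> q q"
proof -
  have V: "q \<in> V" "a \<in> V" using b N_in[of _ b] by auto
  have "E \<theta> a a = ((\<theta> - 1)^2 - (\<theta> - 1) - 1) * E \<theta> q a"
    using pendant_value[OF E_column[OF V(2)] q b] .
  also have "E \<theta> q a = E \<theta> a q" by (rule E_commute[OF V])
  also have "\<dots> = ((\<theta> - 1)^2 - (\<theta> - 1) - 1) * E \<theta> q q"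
    using pendant_value[OF E_column[OF V(1)] q b] .
  finally show ?thesis by (simp add: power2_eq_square)
qed

end

section \<open>Pendant paths of length two\<close>

text \<open>The parenthesis is the squared norm on q, b, a of an eigenvector with value 1 at q, and
  the left-hand sides are its squared coordinates at q and b; so 77/100 and 37/50 bound the atoms at
  q and b. Each inequality is certified by an explicit sum of squares, whose constant term is the
  remaining slack.\<close>

lemma pendant_poly:
  fixes t :: real
  shows
"1 \<le> 77/100 * (1 + t^2 + (t^2 - t - 1)^2)"
    and "t^2 \<le> 37/50 * (1 + t^2 + (t^2 - t - 1)^2)"
proof -
  have "77/100 * (1 + t^2 + (t^2 - t - 1)^2) - 1 =
      77/100 * ((-60/77) + (-1) * t + 1 * t ^ 2)^2 + 43/100 * (17/43 + 1 * t)^2 + 1741/331100 * (1)^2"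
    by (simp add: power2_eq_square power3_eq_cube field_simps)
  also have "\<dots> \<ge> 0" by simp
  finally show "1 \<le> 77/100 * (1 + t^2 + (t^2 - t - 1)^2)" by simp
  have "37/50 * (1 + t^2 + (t^2 - t - 1)^2) - t^2 =
      37/50 * ((-275/222) + (-1) * t + 1 * t ^ 2)^2 + 7/75 * ((-53/28) + 1 * t)^2 + 9403/932400 * (1)^2"
    by (simp add: power2_eq_square power3_eq_cube field_simps)
  also have "\<dots> \<ge> 0" by simp
  finally show "t^2 \<le> 37/50 * (1 + t^2 + (t^2 - t - 1)^2)" by simp
qed

text \<open>As in \<open>pendant_poly\<close>, with the squared coordinate at the one further
  neighbour of a added to the norm, and with a bound for the atoms at a as well.\<close>

lemma pendant_poly_deg2:
  fixes t :: real
  shows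
"1 \<le> 61/100 * (1 + t^2 + (t^2 - t - 1)^2 + ((1 - t) * (t^2 - t - 1) + t)^2)"
    and "t^2 \<le> 59/100 * (1 + t^2 + (t^2 - t - 1)^2 + ((1 - t) * (t^2 - t - 1) + t)^2)"
    and "(t^2 - t - 1)^2 \<le> 14/25 * (1 + t^2 + (t^2 - t - 1)^2 + ((1 - t) * (t^2 - t - 1) + t)^2)"
proof -
  have "61/100 * (1 + t^2 + (t^2 - t - 1)^2 + ((1 - t) * (t^2 - t - 1) + t)^2) - 1 =
      61/100 * (50/61 + (-50/61) * t + (-2) * t ^ 2 + 1 * t ^ 3)^2 + 39/100 * ((-100/117)
        + (-28/39) * t + 1 * t ^ 2)^2 + 53719/237900 * (121700/161157 + 1 * t)^2
        + 941779/145041300 * (1)^2"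
    by (simp add: power2_eq_square power3_eq_cube field_simps)
  also have "\<dots> \<ge> 0" by simp
  finally show "1 \<le> 61/100 * (1 + t^2 + (t^2 - t - 1)^2 + ((1 - t) * (t^2 - t - 1) + t)^2)" by simp
  have "59/100 * (1 + t^2 + (t^2 - t - 1)^2 + ((1 - t) * (t^2 - t - 1) + t)^2) - t^2 =
      59/100 * (475/354 + (-50/59) * t + (-2) * t ^ 2 + 1 * t ^ 3)^2 + 41/100 * ((-50/41)
        + (-367/246) * t + 1 * t ^ 2)^2 + 526081/8708400 * ((-653400/526081) + 1 * t)^2
        + 9071257/1893891600 * (1)^2"
    by (simp add: power2_eq_square power3_eq_cube field_simps)
  also have "\<dots> \<ge> 0" by simp
  finally show "t^2 \<le> 59/100 * (1 + t^2 + (t^2 - t - 1)^2 + ((1 - t) * (t^2 - t - 1) + t)^2)" by simp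
  have "14/25 * (1 + t^2 + (t^2 - t - 1)^2 + ((1 - t) * (t^2 - t - 1) + t)^2) - (t^2 - t - 1)^2 =
      14/25 * (25/24 + (-125/84) * t + (-2) * t ^ 2 + 1 * t ^ 3)^2 + 8/75 * ((-39/32) * t
        + 1 * t ^ 2)^2 + 51371/201600 * ((-26600/51371) + 1 * t)^2 + 498097/123290400 * (1)^2"
    by (simp add: power2_eq_square power3_eq_cube field_simps)
  also have "\<dots> \<ge> 0" by simp
  finally show "(t^2 - t - 1)^2 \<le> 14/25 * (1 + t^2 + (t^2 - t - 1)^2 + ((1 - t) * (t^2 - t - 1) + t)^2)" by simp
qed

text \<open>Here a has two further neighbours. Only the sum of their coordinates is known, and
  Cauchy-Schwarz gives half of its square.\<close>

lemma pendant_poly_deg3: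
  fixes t :: real
  shows
"1 \<le> 33/50 * (1 + t^2 + (t^2 - t - 1)^2 + ((2 - t) * (t^2 - t - 1) + t)^2 / 2)"
    and "t^2 \<le> 27/50 * (1 + t^2 + (t^2 - t - 1)^2 + ((2 - t) * (t^2 - t - 1) + t)^2 / 2)"
    and "(t^2 - t - 1)^2 \<le> 17/25 * (1 + t^2 + (t^2 - t - 1)^2 + ((2 - t) * (t^2 - t - 1) + t)^2 / 2)"
proof -
  have "33/50 * (1 + t^2 + (t^2 - t - 1)^2 + ((2 - t) * (t^2 - t - 1) + t)^2 / 2) - 1 =
      33/100 * (125/66 + 25/66 * t + (-3) * t ^ 2 + 1 * t ^ 3)^2 + 41/100 * ((-75/82) + (-25/41) * t
        + 1 * t ^ 2)^2 + 184123/541200 * (105317/184123 + 1 * t)^2 + 5865/2945968 * (1)^2"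
    by (simp add: power2_eq_square power3_eq_cube field_simps)
  also have "\<dots> \<ge> 0" by simp
  finally show "1 \<le> 33/50 * (1 + t^2 + (t^2 - t - 1)^2 + ((2 - t) * (t^2 - t - 1) + t)^2 / 2)" by simp
  have "27/50 * (1 + t^2 + (t^2 - t - 1)^2 + ((2 - t) * (t^2 - t - 1) + t)^2 / 2) - t^2 =
      27/100 * (25/9 + 50/81 * t + (-3) * t ^ 2 + 1 * t ^ 3)^2 + 31/150 * ((-25/62) + (-75/62) * t
        + 1 * t ^ 2)^2 + 32191/1506600 * ((-35811/32191) + 1 * t)^2 + 6421/386292 * (1)^2"
    by (simp add: power2_eq_square power3_eq_cube field_simps)
  also have "\<dots> \<ge> 0" by simp
  finally show "t^2 \<le> 27/50 * (1 + t^2 + (t^2 - t - 1)^2 + ((2 - t) * (t^2 - t - 1) + t)^2 / 2)" by simp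
  have "17/25 * (1 + t^2 + (t^2 - t - 1)^2 + ((2 - t) * (t^2 - t - 1) + t)^2 / 2) - (t^2 - t - 1)^2 =
      17/50 * (115/68 + (-10/17) * t + (-3) * t ^ 2 + 1 * t ^ 3)^2 + 2/25 * ((-5/4) + (-35/16) * t
        + 1 * t ^ 2)^2 + 3783/54400 * ((-3636/1261) + 1 * t)^2 + 8959/201760 * (1)^2"
    by (simp add: power2_eq_square power3_eq_cube field_simps)
  also have "\<dots> \<ge> 0" by simp
  finally show "(t^2 - t - 1)^2 \<le> 17/25 * (1 + t^2 + (t^2 - t - 1)^2 + ((2 - t) * (t^2 - t - 1) + t)^2 / 2)" by simp
qed

lemma mult_le_of_le:
  fixes p w m K :: real
  assumes "w \<le> m * K" "p * K \<le> 1" "0 \<le> p" "0 \<le> m"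
  shows "w * p \<le> m"
proof -
  have "w * p \<le> (m * K) * p" using assms by (intro mult_right_mono) auto
  also have "\<dots> = m * (p * K)" by simp
  also have "\<dots> \<le> m * 1" using assms by (intro mult_left_mono)
  finally show ?thesis by simp
qed

context connected_graph
begin

text \<open>A column of the projection, restricted to \<open>q\<close>, \<open>b\<close>, \<open>a\<close> and the remaining neighbours of
  \<open>a\<close>, has squared norm at most its entry at \<open>q\<close>; the eigenvalue equations express all these
  coordinates, except those of the neighbours of \<open>a\<close>, of which they determine the sum.\<close>

lemma pendant_column_bound:
  assumes q: "N q = {b}" and b: "N b = {q, a}" "a \<noteq> q" and D: "card (N a) = Suc k" "0 < k"
  defines "t \<equiv> \<lambda>\<theta>. \<theta> - (1::real)"
  shows "E \<theta> q q * (1 + (t \<theta>)^2 + ((t \<theta>)^2 - t \<theta> - 1)^2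
    + ((real k - t \<theta>) * ((t \<theta>)^2 - t \<theta> - 1) + t \<theta>)^2 / real k) \<le> 1"
proof -
  define s where "s = \<theta> - 1"
  define P where "P = s^2 - s - 1"
  define z where "z = (\<lambda>u. E \<theta> u q)"
  define C where "C = N a - {b}"
  have V: "q \<in> V" "b \<in> V" "a \<in> V" using b(1) N_in[of _ b] by auto
  have z: "z \<in> eig \<theta>" unfolding z_def by (rule E_column[OF V(1)])
  have zb: "z b = - s * z q" using leaf_value[OF z q] by (simp add: s_def algebra_simps)
  have za: "z a = P * z q" using pendant_value[OF z q b] by (simp add: P_def s_def)
  have ba: "b \<in> N a" "a \<noteq> b" "q \<noteq> b" using b N_sym N_irrefl[of b] by auto
  have qC: "q \<notin> C" using q N_sym[of q a] ba by (auto simp: C_def)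
  have sumC: "(\<Sum>v\<in>C. z v) = ((real k - s) * P + s) * z q"
  proof -
    have "(\<Sum>v\<in>N a. z v) = z b + (\<Sum>v\<in>C. z v)"
      unfolding C_def using ba finite_N by (simp add: sum.remove)
    then show ?thesis using eigen_eq[OF z V(3)] D
      by (simp add: zb za s_def algebra_simps)
  qed
  have cardC: "card C = k" using D ba finite_N by (simp add: C_def)
  have "(\<Sum>v\<in>C. z v)^2 \<le> (\<Sum>v\<in>C. (z v)^2) * real k"
    using sum_squared_le_sum_of_squares[of z C] cardC by simp
  then have 1: "((real k - s) * P + s)^2 / k * (z q)^2 \<le> (\<Sum>v\<in>C. (z v)^2)"
    using D unfolding sumC power_mult_distrib by (simp add: divide_simps)
  have "(\<Sum>v\<in>{q, b, a} \<union> C. (z v)^2) \<le> z q"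
    unfolding z_def using V N_subset by (intro E_diag_ge) (auto simp: C_def)
  also have "(\<Sum>v\<in>{q, b, a} \<union> C. (z v)^2) = (\<Sum>v\<in>{q, b, a}. (z v)^2) + (\<Sum>v\<in>C. (z v)^2)"
    using finite_N qC N_irrefl[of a] by (intro sum.union_disjoint) (auto simp: C_def)
  also have "(\<Sum>v\<in>{q, b, a}. (z v)^2) = (1 + s^2 + P^2) * (z q)^2"
    using ba b by (simp add: zb za power_mult_distrib algebra_simps)
  finally have "(1 + s^2 + P^2 + ((real k - s) * P + s)^2 / k) * (z q)^2 \<le> z q"
    using 1 by (simp add: algebra_simps)
  then have "z q * (z q * (1 + s^2 + P^2 + ((real k - s) * P + s)^2 / k) - 1) \<le> 0"
    by (simp add: power2_eq_square algebra_simps)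
  moreover have "0 \<le> z q" unfolding z_def by (rule E_diag_nonneg[OF V(1)])
  ultimately have "z q * (1 + s^2 + P^2 + ((real k - s) * P + s)^2 / k) \<le> 1"
    by (cases "z q = 0") (auto simp: mult_le_0_iff)
  then show ?thesis by (simp add: z_def t_def s_def P_def)
qed

text \<open>The bound is the sum of 2 * m * (S - m) for m = 77/100 at q and m = 37/50 at b, with S =
  1 - 1 / n. The next two lemmas obtain their constants in the same way from three atom bounds,
  rounded down.\<close>

lemma excess_pendant:
  assumes q: "N q = {b}" and b: "N b = {q, a}" "a \<noteq> q"
  shows "739 / 1000 - 302 / 100 / n \<le> excess q + excess b"
proof -
  have V: "q \<in> V" "b \<in> V" "a \<in> V" using b(1) N_in[of _ b] by auto
  have "b \<in> N a" using b N_sym by auto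
  have K: "E \<theta> q q * (1 + (\<theta> - 1)^2 + ((\<theta> - 1)^2 - (\<theta> - 1) - 1)^2) \<le> 1" for \<theta>
  proof -
    let ?t = "\<theta> - 1"
    have A: "{q, b, a} \<subseteq> V" "q \<noteq> b" "b \<noteq> a" using V b N_irrefl[of b] by auto
    note z = E_column[OF V(1), of \<theta>]
    have "(\<Sum>u\<in>{q, b, a}. (E \<theta> u q)^2) \<le> E \<theta> q q" by (rule E_diag_ge[OF V(1) A(1)])
    then have "(E \<theta> q q)^2 + (E \<theta> b q)^2 + (E \<theta> a q)^2 \<le> E \<theta> q q"
      using A b by simp
    then have "(1 + ?t^2 + (?t^2 - ?t - 1)^2) * (E \<theta> q q)^2 \<le> E \<theta> q q"
      unfolding leaf_value[OF z q] pendant_value[OF z q b] power_mult_distrib power2_commute[of 1]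
      by (simp only: distrib_right mult_1)
    then have "E \<theta> q q * (E \<theta> q q * (1 + ?t^2 + (?t^2 - ?t - 1)^2) - 1) \<le> 0"
      by (simp add: power2_eq_square algebra_simps)
    then show ?thesis using E_diag_nonneg[OF V(1), of \<theta>]
      by (cases "E \<theta> q q = 0") (auto simp: mult_le_0_iff)
  qed
  have "E \<theta> q q \<le> 77 / 100" for \<theta>
    using mult_le_of_le[OF pendant_poly(1) K E_diag_nonneg[OF V(1)]] by simp
  then have 1: "2 * (77 / 100) * (S - 77 / 100) \<le> excess q"
    by (intro excess_bounded_atoms V) auto
  have "E \<theta> b b \<le> 37 / 50" for \<theta>
    using mult_le_of_le[OF pendant_poly(2) K E_diag_nonneg[OF V(1)]]
    by (simp add: E_diag_leaf_nbr[OF q])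
  then have 2: "2 * (37 / 50) * (S - 37 / 50) \<le> excess b"
    by (intro excess_bounded_atoms V) auto
  show ?thesis using 1 2 by (simp add: field_simps)
qed

lemma excess_pendant_deg2:
  assumes q: "N q = {b}" and b: "N b = {q, a}" "a \<noteq> q" and D: "card (N a) = 2"
  shows "1452 / 1000 - 352 / 100 / n \<le> excess q + excess b + excess a"
proof -
  have V: "q \<in> V" "b \<in> V" "a \<in> V" using b(1) N_in[of _ b] by auto
  have "E \<theta> q q * (1 + (\<theta> - 1)^2 + ((\<theta> - 1)^2 - (\<theta> - 1) - 1)^2 +
      ((1 - (\<theta> - 1)) * ((\<theta> - 1)^2 - (\<theta> - 1) - 1)
        + (\<theta> - 1))^2) \<le> 1" for \<theta>
    using pendant_column_bound[OF q b, of 1 \<theta>] D by simp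
  note atom = mult_le_of_le[OF _ this E_diag_nonneg[OF V(1)]]
  have "E \<theta> q q \<le> 61 / 100" for \<theta> using atom[OF pendant_poly_deg2(1)] by simp
  then have 1: "2 * (61 / 100) * (S - 61 / 100) \<le> excess q"
    by (intro excess_bounded_atoms V) auto
  have "E \<theta> b b \<le> 59 / 100" for \<theta>
    unfolding E_diag_leaf_nbr[OF q] using atom[OF pendant_poly_deg2(2)] by simp
  then have 2: "2 * (59 / 100) * (S - 59 / 100) \<le> excess b"
    by (intro excess_bounded_atoms V) auto
  have "E \<theta> a a \<le> 14 / 25" for \<theta>
    unfolding E_diag_pendant_root[OF q b] using atom[OF pendant_poly_deg2(3)] by simp
  then have 3: "2 * (14 / 25) * (S - 14 / 25) \<le> excess a"
    by (intro excess_bounded_atoms V) auto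
  show ?thesis using 1 2 3 by (simp add: field_simps)
qed

lemma excess_pendant_deg3:
  assumes q: "N q = {b}" and b: "N b = {q, a}" "a \<noteq> q" and D: "card (N a) = 3"
  shows "138 / 100 - 376 / 100 / n \<le> excess q + excess b + excess a"
proof -
  have V: "q \<in> V" "b \<in> V" "a \<in> V" using b(1) N_in[of _ b] by auto
  have "E \<theta> q q * (1 + (\<theta> - 1)^2 + ((\<theta> - 1)^2 - (\<theta> - 1) - 1)^2 +
      ((2 - (\<theta> - 1)) * ((\<theta> - 1)^2 - (\<theta> - 1) - 1)
        + (\<theta> - 1))^2 / 2) \<le> 1" for \<theta>
    using pendant_column_bound[OF q b, of 2 \<theta>] D by simp
  note atom = mult_le_of_le[OF _ this E_diag_nonneg[OF V(1)]]
  have "E \<theta> q q \<le> 33 / 50" for \<theta> using atom[OF pendant_poly_deg3(1)] by simp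
  then have 1: "2 * (33 / 50) * (S - 33 / 50) \<le> excess q"
    by (intro excess_bounded_atoms V) auto
  have "E \<theta> b b \<le> 27 / 50" for \<theta>
    unfolding E_diag_leaf_nbr[OF q] using atom[OF pendant_poly_deg3(2)] by simp
  then have 2: "2 * (27 / 50) * (S - 27 / 50) \<le> excess b"
    by (intro excess_bounded_atoms V) auto
  have "E \<theta> a a \<le> 17 / 25" for \<theta>
    unfolding E_diag_pendant_root[OF q b] using atom[OF pendant_poly_deg3(3)] by simp
  then have 3: "2 * (17 / 25) * (S - 17 / 25) \<le> excess a"
    by (intro excess_bounded_atoms V) auto
  show ?thesis using 1 2 3 by (simp add: field_simps)
qed

lemma excess_pendant_deg_le3:
  assumes q: "N q = {b}" and b: "N b = {q, a}" "a \<noteq> q" and D: "card (N a) = 2 \<or> card (N a) = 3"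
  shows "138 / 100 - 376 / 100 / n \<le> excess q + excess b + excess a"
  using D
proof
  assume "card (N a) = 2"
  then have "1452 / 1000 - 352 / 100 / n \<le> excess q + excess b + excess a"
    by (rule excess_pendant_deg2[OF q b])
  moreover have "138 / 100 - 376 / 100 / n \<le> 1452 / 1000 - 352 / 100 / n"
    using n_pos by (simp add: field_simps)
  ultimately show ?thesis by linarith
qed (rule excess_pendant_deg3[OF q b])

end

section \<open>Families of leaves\<close>

text \<open>The right-hand side is a concave quadratic in x, hence at least the chord between the
  end points; the proof adds the exact gap k * (x - x0) * (x1 - x) * (x1 - x0).\<close>

lemma concave_three_points:
  fixes x :: real
  assumes x: "x0 \<le> x" "x \<le> x1" "x0 < x1" and k: "0 \<le> k"
    and T: "T \<le> k * (1 - x0) * (x0 - z)" "T \<le> k * (1 - x1) * (x1 - z)"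
  shows "T \<le> k * (1 - x) * (x - z)"
proof -
  have "(x1 - x0) * T = (x1 - x) * T + (x - x0) * T" by (simp add: algebra_simps)
  also have "\<dots> \<le> (x1 - x) * (k * (1 - x0) * (x0 - z)) + (x - x0) * (k * (1 - x1) * (x1 - z))"
    using x T by (intro add_mono mult_left_mono) auto
  also have "\<dots> \<le> \<dots> + k * (x - x0) * (x1 - x) * (x1 - x0)"
    using x k by simp
  also have "\<dots> = (x1 - x0) * (k * (1 - x) * (x - z))" by algebra
  finally show ?thesis using x(3) by simp
qed

text \<open>For a leaf, x is 1 minus its mass at the eigenvalue 1, and z is 1 / n. At x = 1 / k the
  mass comes from twin differences only; x = 2 / (2 * k + 1) is the largest deviation that
  \<open>excess_leaves_ge\<close> has to allow. By concavity the two end points suffice, and k + 1 /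
  2 is the reciprocal of the left one.\<close>

lemma leaf_excess_numeric:
  fixes x k z :: real
  assumes k: "2 \<le> k" and z: "0 \<le> z" "(k + 1 / 2) * z \<le> 1"
    and x: "2 / (2 * k + 1) \<le> x" "x \<le> 1 / k"
  shows "96 / 100 * (1 - (k + 1 / 2) * z) \<le> 2 * k * (1 - x) * (x - z)"
proof (rule concave_three_points[OF x])
  define w where "w = 1 - (k + 1 / 2) * z"
  have w: "0 \<le> w" using z by (simp add: w_def)
  show "2 / (2 * k + 1) < 1 / k" using k by (simp add: field_simps)
  show "0 \<le> 2 * k" using k by simp
  \<comment> \<open>The origin of 96/100: the right-hand side equals 24 / 25 at k = 2 and is no
    smaller for larger k.\<close>
  have "96 / 100 \<le> 4 * k * (2 * k - 1) / (2 * k + 1)^2"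
  proof -
    have "0 \<le> (k - 2) * (416 * k + 48)" using k by (intro mult_nonneg_nonneg) auto
    then have "96 * (2 * k + 1)^2 \<le> 100 * (4 * k * (2 * k - 1))"
      by (simp add: power2_eq_square algebra_simps)
    then show ?thesis using k by (subst pos_le_divide_eq) auto
  qed
  then have "96 / 100 * w \<le> 4 * k * (2 * k - 1) / (2 * k + 1)^2 * w"
    using w by (rule mult_right_mono)
  also have "\<dots> = 2 * k * (1 - 2 / (2 * k + 1)) * (2 / (2 * k + 1) - z)"
    using k by (simp add: w_def divide_simps) (simp add: power2_eq_square algebra_simps)
  finally show "96 / 100 * w \<le> 2 * k * (1 - 2 / (2 * k + 1)) * (2 / (2 * k + 1) - z)" .
  have "96 / 100 * w \<le> w + z / 2" using w z(1) by linarith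
  also have "\<dots> = 1 * (1 - k * z)" by (simp add: w_def algebra_simps)
  finally have "96 / 100 * w \<le> 1 * (1 - k * z)" .
  also have "\<dots> \<le> (2 * (1 - 1 / k)) * (1 - k * z)"
    using k z by (intro mult_right_mono) (auto simp: field_simps)
  also have "\<dots> = 2 * k * (1 - 1 / k) * (1 / k - z)"
    using k by (simp add: field_simps)
  finally show "96 / 100 * w \<le> 2 * k * (1 - 1 / k) * (1 / k - z)" .
qed

context connected_graph
begin

definition leaves_at :: "'a \<Rightarrow> 'a set" where
  "leaves_at s = {q. N q = {s}}"

lemma leaves_at_subset: "leaves_at s \<subseteq> N s"
  using N_sym by (auto simp: leaves_at_def)

lemma finite_leaves_at: "finite (leaves_at s)"
  using finite_subset[OF leaves_at_subset finite_N] .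

lemma leaves_at_verts: "q \<in> leaves_at s \<Longrightarrow> q \<in> V"
  using leaves_at_subset N_subset by blast

lemma leaves_at_disjoint: "s \<noteq> s' \<Longrightarrow> leaves_at s \<inter> leaves_at s' = {}"
  by (auto simp: leaves_at_def)

lemma eigen_one_support:
  assumes "x \<in> eig 1" "leaves_at w \<noteq> {}"
  shows "x w = 0"
  using assms leaf_value[of x 1] by (auto simp: leaves_at_def)

lemma twin_difference_eigen:
  assumes q: "q \<in> leaves_at s" and q': "q' \<in> leaves_at s"
  shows "(\<lambda>u. (if u = q then 1 else 0) - (if u = q' then 1 else 0)) \<in> eig 1"
proof -
  have "(\<Sum>v\<in>N u. (if v = q then 1 else 0) - (if v = q' then 1 else 0)) = (0::real)" for u
  proof -
    have "q \<in> N u \<longleftrightarrow> u = s" "q' \<in> N u \<longleftrightarrow> u = s"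
      using q q' N_sym by (auto simp: leaves_at_def)
    then show ?thesis by (simp add: sum_subtractf finite_N)
  qed
  then show ?thesis
    using q q' leaves_at_verts by (auto simp: eigen_iff leaves_at_def)
qed

text \<open>Reproducing the difference of two twin leaves fixes the entries at the twins of q. The
  column vanishes at s, so its values on all neighbours of s sum to 0, and what the leaves do not
  account for lies on the other neighbours.\<close>

lemma eigen_one_leaf_column:
  assumes q: "q \<in> leaves_at s" and k: "card (leaves_at s) = k"
  shows "q' \<in> leaves_at s \<Longrightarrow> q' \<noteq> q \<Longrightarrow> E 1 q' q = E 1 q q - 1"
    and "(\<Sum>v\<in>N s - leaves_at s. E 1 v q) = (real k - 1) - k * E 1 q q"
proof -
  have qV: "q \<in> V" and sV: "s \<in> V" using q leaves_at_verts N_in(2)[of q s] leaves_at_subset by auto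
  show twin: "E 1 q' q = E 1 q q - 1" if "q' \<in> leaves_at s" "q' \<noteq> q" for q'
    using E_reproduce[OF qV twin_difference_eigen[OF q that(1)]] that qV leaves_at_verts[OF that(1)]
      finite_verts
    by (simp add: right_diff_distrib sum_subtractf if_distrib[of "times _"] cong: if_cong)
  have "(\<Sum>v\<in>leaves_at s. E 1 v q) = E 1 q q + (\<Sum>v\<in>leaves_at s - {q}. E 1 v q)"
    using q finite_leaves_at by (simp add: sum.remove)
  also have "(\<Sum>v\<in>leaves_at s - {q}. E 1 v q) = (\<Sum>v\<in>leaves_at s - {q}. E 1 q q - 1)"
    by (intro sum.cong) (auto simp: twin)
  also have "\<dots> = (real k - 1) * (E 1 q q - 1)"
    using q k finite_leaves_at card_gt_0_iff[of "leaves_at s"]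
    by (auto simp: of_nat_diff Suc_le_eq)
  finally have 1: "(\<Sum>v\<in>leaves_at s. E 1 v q) = k * E 1 q q - (real k - 1)"
    by (simp add: algebra_simps)
  have "E 1 s q = 0" using eigen_one_support[OF E_column[OF qV]] q by auto
  then have "(\<Sum>v\<in>N s. E 1 v q) = 0" using eigen_eq[OF E_column[OF qV] sV] by simp
  then show "(\<Sum>v\<in>N s - leaves_at s. E 1 v q) = (real k - 1) - k * E 1 q q"
    using 1 sum.subset_diff[OF leaves_at_subset finite_N, of "\<lambda>v. E 1 v q" s] by simp
qed

text \<open>Under the hypothesis \<open>zero\<close> the column at q sums to 0 over the leaves
  alone, so twin differences account for the entire mass 1 - 1 / k at the eigenvalue 1. A single
  leaf then has no mass there.\<close>

lemma excess_leaves_exact: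
  assumes zero: "\<And>x w. x \<in> eig 1 \<Longrightarrow> w \<in> N s - leaves_at s \<Longrightarrow> x w = 0"
    and ne: "leaves_at s \<noteq> {}"
  defines "k \<equiv> real (card (leaves_at s))"
  shows "q \<in> leaves_at s \<Longrightarrow> E 1 q q = 1 - 1 / k"
    and "2 * (1 - 1 / k) * (1 - k / n) \<le> (\<Sum>q\<in>leaves_at s. excess q)"
proof -
  have k: "k \<ge> 1" using ne finite_leaves_at by (simp add: k_def Suc_le_eq card_gt_0_iff)
  show E1: "E 1 q q = 1 - 1 / k" if q: "q \<in> leaves_at s" for q
  proof -
    have "(\<Sum>v\<in>N s - leaves_at s. E 1 v q) = 0"
      using zero[OF E_column[OF leaves_at_verts[OF q]]] by (intro sum.neutral) auto
    then show ?thesis using eigen_one_leaf_column(2)[OF q refl] k by (simp add: k_def field_simps)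
  qed
  have "2 * (1 - 1 / k) * (1 / k - 1 / n) \<le> excess q" if "q \<in> leaves_at s" for q
    using excess_atom[OF leaves_at_verts[OF that], of 1] by (simp add: E1[OF that])
  then have "(\<Sum>q\<in>leaves_at s. 2 * (1 - 1 / k) * (1 / k - 1 / n)) \<le> (\<Sum>q\<in>leaves_at s. excess q)"
    by (rule sum_mono)
  also have "(\<Sum>q\<in>leaves_at s. 2 * (1 - 1 / k) * (1 / k - 1 / n)) = 2 * (1 - 1 / k) * (1 - k / n)"
    using k by (simp add: k_def[symmetric] field_simps)
  finally show "2 * (1 - 1 / k) * (1 - k / n) \<le> (\<Sum>q\<in>leaves_at s. excess q)" .
qed

text \<open>Here the eigenvalue \<open>1\<close> may carry more than the differences of twin leaves, but the extra
  component must be visible at \<open>c\<close> and at the other neighbours of \<open>c\<close>, which limits its size.\<close>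

lemma excess_leaves_ge:
  assumes c: "c \<in> N s" "2 \<le> card (N c)"
    and supp: "\<And>w. w \<in> N s - leaves_at s - {c} \<Longrightarrow> leaves_at w \<noteq> {}"
    and k2: "2 \<le> card (leaves_at s)"
  defines "k \<equiv> real (card (leaves_at s))"
  shows "96 / 100 * (1 - (k + 1 / 2) / n) \<le> (\<Sum>q\<in>leaves_at s. excess q)"
proof (cases "(k + 1 / 2) / n \<le> 1")
  case False
  have "0 \<le> (\<Sum>q\<in>leaves_at s. excess q)"
    using excess_nonneg leaves_at_verts by (intro sum_nonneg) auto
  moreover have "96 / 100 * (1 - (k + 1 / 2) / n) \<le> 0"
    using False by (intro mult_nonneg_nonpos) auto
  ultimately show ?thesis by linarith
next
  case True
  have k: "2 \<le> k" using k2 by (simp add: k_def)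
  have cF: "c \<notin> leaves_at s" using c by (auto simp: leaves_at_def)
  have each: "96 / 100 * (1 - (k + 1 / 2) / n) / k \<le> excess q" if q: "q \<in> leaves_at s" for q
  proof -
    define z where "z = (\<lambda>u. E 1 u q)"
    define x where "x = 1 - z q"
    define C where "C = N c - {s}"
    have qV: "q \<in> V" by (rule leaves_at_verts[OF q])
    have z: "z \<in> eig 1" unfolding z_def by (rule E_column[OF qV])
    have zs: "z s = 0" using eigen_one_support[OF z] q by auto
    \<comment> \<open>The other non-leaf neighbours of s carry leaves of their own, where the
      eigenvalue 1 forces the value 0; so c alone balances the sum over the leaves.\<close>
    have zc: "z c = k * x - 1"
    proof -
      have "(\<Sum>v\<in>N s - leaves_at s. z v) = z c + (\<Sum>v\<in>N s - leaves_at s - {c}. z v)"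
        using c cF finite_N by (simp add: sum.remove)
      also have "(\<Sum>v\<in>N s - leaves_at s - {c}. z v) = 0"
        using supp eigen_one_support[OF z] by (intro sum.neutral) auto
      finally show ?thesis
        using eigen_one_leaf_column(2)[OF q refl]
        by (simp add: z_def x_def k_def algebra_simps)
    qed
    have sc: "s \<in> N c" using c N_sym by auto
    have cV: "c \<in> V" using c N_in by auto
    have "(\<Sum>v\<in>N c. z v) = (\<Sum>v\<in>C. z v)"
      unfolding C_def using sc finite_N zs by (simp add: sum.remove)
    then have sumC: "(\<Sum>v\<in>C. z v) = real (card C) * z c"
      using eigen_eq[OF z cV] sc finite_N c by (simp add: C_def of_nat_diff)
    have cardC: "1 \<le> real (card C)" using c sc finite_N by (simp add: C_def)
    have "(real (card C) * z c)^2 \<le> (\<Sum>v\<in>C. (z v)^2) * card C"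
      using sum_squared_le_sum_of_squares[of z C] by (simp add: sumC)
    then have "real (card C) * (real (card C) * (z c)^2) \<le> real (card C) * (\<Sum>v\<in>C. (z v)^2)"
      by (simp add: power2_eq_square algebra_simps)
    then have "real (card C) * (z c)^2 \<le> (\<Sum>v\<in>C. (z v)^2)"
      using cardC by simp
    moreover have "1 * (z c)^2 \<le> real (card C) * (z c)^2"
      using cardC by (intro mult_right_mono) auto
    ultimately have C_ge: "(z c)^2 \<le> (\<Sum>v\<in>C. (z v)^2)" by simp
    have F: "(\<Sum>v\<in>leaves_at s. (z v)^2) = (1 - x)^2 + (k - 1) * x^2"
    proof -
      have "(\<Sum>v\<in>leaves_at s. (z v)^2) = (z q)^2 + (\<Sum>v\<in>leaves_at s - {q}. (z v)^2)"
        using q finite_leaves_at by (simp add: sum.remove)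
      also have "(\<Sum>v\<in>leaves_at s - {q}. (z v)^2) = (\<Sum>v\<in>leaves_at s - {q}. x^2)"
        using eigen_one_leaf_column(1)[OF q refl]
        by (intro sum.cong) (auto simp: z_def x_def power2_commute)
      also have "\<dots> = (k - 1) * x^2"
        using q finite_leaves_at k2 by (simp add: k_def of_nat_diff)
      finally show ?thesis by (simp add: x_def)
    qed
    have "q' \<notin> N c" if "q' \<in> leaves_at s" for q'
      using that c N_sym[of q' c] N_irrefl by (auto simp: leaves_at_def)
    then have disj: "leaves_at s \<inter> C = {}" "c \<notin> C"
      using N_irrefl by (auto simp: C_def)
    have "(\<Sum>v\<in>leaves_at s \<union> insert c C. (z v)^2) \<le> z q"
      unfolding z_def using leaves_at_verts N_subset cV
      by (intro E_diag_ge[OF qV]) (auto simp: C_def)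
    also have "(\<Sum>v\<in>leaves_at s \<union> insert c C. (z v)^2)
        = (\<Sum>v\<in>leaves_at s. (z v)^2) + ((z c)^2 + (\<Sum>v\<in>C. (z v)^2))"
      using disj cF finite_N finite_leaves_at
      by (subst sum.union_disjoint) (auto simp: C_def)
    \<comment> \<open>The factor 2 counts c and its remaining neighbours, whose squares sum to at
      least (z c)^2 since c has degree at least 2. The inequality factors and confines x to the
      interval between 2 / (2 * k + 1) and 1 / k.\<close>
    finally have "(1 - x)^2 + (k - 1) * x^2 + 2 * (k * x - 1)^2 \<le> 1 - x"
      using C_ge F by (simp add: zc) (simp add: x_def)
    then have prod: "(1 - k * x) * (2 - (2 * k + 1) * x) \<le> 0"
      by (simp add: power2_eq_square algebra_simps)
    have xb: "2 / (2 * k + 1) \<le> x" "x \<le> 1 / k"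
    proof -
      have x0: "0 \<le> x"
      proof (rule ccontr)
        assume "\<not> 0 \<le> x"
        then have "k * x < 0" "(2 * k + 1) * x < 0" using k by (auto intro: mult_pos_neg)
        then have "0 < (1 - k * x) * (2 - (2 * k + 1) * x)" by (intro mult_pos_pos) linarith+
        then show False using prod by linarith
      qed
      have lin: "(2 * k + 1) * x = 2 * (k * x) + x" by (simp add: algebra_simps)
      have "\<not> (2 * k + 1) * x < 2"
      proof
        assume a: "(2 * k + 1) * x < 2"
        then have "k * x < 1" using lin x0 by linarith
        then have "0 < (1 - k * x) * (2 - (2 * k + 1) * x)" using a by (intro mult_pos_pos) linarith+
        then show False using prod by linarith
      qed
      moreover have "\<not> 1 < k * x"
      proof
        assume a: "1 < k * x"
        then have "2 < (2 * k + 1) * x" using lin x0 by linarith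
        then have "0 < (1 - k * x) * (2 - (2 * k + 1) * x)" using a by (intro mult_neg_neg) linarith+
        then show False using prod by linarith
      qed
      ultimately have "2 \<le> (2 * k + 1) * x" "k * x \<le> 1" by linarith+
      then show "2 / (2 * k + 1) \<le> x" "x \<le> 1 / k" using k by (simp_all add: field_simps)
    qed
    have "96 / 100 * (1 - (k + 1 / 2) / n) = 96 / 100 * (1 - (k + 1 / 2) * (1 / n))" by simp
    also have "\<dots> \<le> 2 * k * (1 - x) * (x - 1 / n)"
      using True n_pos by (intro leaf_excess_numeric[OF k _ _ xb]) auto
    also have "\<dots> = k * (2 * (1 - x) * (x - 1 / n))" by (simp only: mult_ac)
    also have "\<dots> \<le> k * excess q"
    proof (rule mult_left_mono)
      show "2 * (1 - x) * (x - 1 / n) \<le> excess q"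
        using excess_atom[OF qV, of 1] by (simp add: x_def z_def algebra_simps)
    qed (use k in simp)
    finally have "96 / 100 * (1 - (k + 1 / 2) / n) \<le> k * excess q" .
    then show ?thesis using k by (simp add: field_simps)
  qed
  have "(\<Sum>q\<in>leaves_at s. 96 / 100 * (1 - (k + 1 / 2) / n) / k) \<le> (\<Sum>q\<in>leaves_at s. excess q)"
    by (rule sum_mono[OF each])
  then show ?thesis using k by (simp add: k_def[symmetric])
qed

end

section \<open>Several pendant paths at one vertex\<close>

lemma golden_roots:
  obtains r s :: real where "r^2 = r + 1" "s^2 = s + 1" "r + s = 1" "r * s = -1" "s < 0" "0 < r"
proof -
  define x where "x = sqrt (5::real)"
  have x: "x * x = 5" "1 < x" by (simp_all add: x_def)
  show ?thesis
  proof (rule that[of "1 / 2 + x / 2" "1 / 2 - x / 2"])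
    have sq: "x / 2 * (x / 2) = 5 / 4" using x(1) by simp
    show "(1 / 2 + x / 2)^2 = 1 / 2 + x / 2 + 1" "(1 / 2 - x / 2)^2 = 1 / 2 - x / 2 + 1"
      "(1 / 2 + x / 2) * (1 / 2 - x / 2) = - 1"
      using x(1) by (simp_all add: power2_eq_square algebra_simps)
  qed (use x(2) in linarith)+
qed

text \<open>The left-hand side is the value of the right-hand side at e = 2, so two pendant paths
  are the worst case; after multiplication by e the difference is a nonnegative multiple of e -
  2.\<close>

lemma excess_pendant_pair_numeric:
  fixes e S :: real
  assumes "2 \<le> e" "4 / 5 \<le> S"
  shows "4 * S - 8 / 5 \<le> 2 * e * (2 * S * (1 - 1 / e) - 8 / 5 * (1 - 1 / e)^2)"
proof -
  have "e * (4 * S - 8 / 5) \<le> e * (2 * e * (2 * S * (1 - 1 / e) - 8 / 5 * (1 - 1 / e)^2))"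
  proof -
    have eq: "e * (2 * e * (2 * S * (1 - 1 / e) - 8 / 5 * (1 - 1 / e)^2))
        = 4 * S * e * (e - 1) - 16 / 5 * (e - 1)^2"
      using assms by (simp add: power2_eq_square field_simps)
    have "0 \<le> 4 * ((S - 4 / 5) * (e * (e - 2))) + 8 / 5 * (e - 2)" using assms by simp
    also have "\<dots> = 4 * S * e * (e - 1) - 16 / 5 * (e - 1)^2 - e * (4 * S - 8 / 5)"
      by (simp add: power2_eq_square field_simps)
    finally show ?thesis unfolding eq by (simp only: diff_ge_0_iff_ge)
  qed
  then show ?thesis using assms by simp
qed

context connected_graph
begin

text \<open>For t^2 = t + 1 the eigenvector pattern 1, - t along a pendant path continues with 0 at
  a. Two paths at the same a with opposite signs therefore satisfy the equation at a as
  well.\<close>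

lemma pendant_difference_eigen:
  assumes 1: "N q1 = {b1}" "N b1 = {q1, a}" "q1 \<noteq> a"
    and 2: "N q2 = {b2}" "N b2 = {q2, a}" "q2 \<noteq> a" and ne: "b1 \<noteq> b2" and t: "t^2 = t + 1"
  defines "w \<equiv> \<lambda>u. if u = q1 then 1 else if u = b1 then - t else if u = q2 then - 1
    else if u = b2 then t else (0::real)"
  shows "w \<in> eig (t + 1)"
    and "distinct [q1, b1, q2, b2]"
proof -
  have ab: "a \<noteq> b1" "a \<noteq> b2" using 1 2 N_irrefl[of b1] N_irrefl[of b2] by auto
  have "q1 \<noteq> q2" using 1 2 ne by auto
  moreover have "q1 \<noteq> b1" "q2 \<noteq> b2" using 1 2 N_irrefl[of q1] N_irrefl[of q2] by auto
  moreover have "q1 \<noteq> b2" "q2 \<noteq> b1" using 1 2 ab by auto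
  ultimately have dist: "q1 \<noteq> b1" "q1 \<noteq> q2" "q1 \<noteq> b2" "b1 \<noteq> q2" "q2 \<noteq> b2" by auto
  then show "distinct [q1, b1, q2, b2]" using ne by auto
  have aw: "w a = 0" using ab 1 2 by (simp add: w_def)
  have V: "q1 \<in> V" "q2 \<in> V" "b1 \<in> V" "b2 \<in> V" using 1 2 N_in(2)[of a] N_in(1)[of _ b1] N_in(1)[of _ b2] by auto
  show "w \<in> eig (t + 1)"
    unfolding eigen_iff
  proof (intro conjI allI impI ballI)
    fix u assume "u \<notin> V" then show "w u = 0" using V by (auto simp: w_def)
  next
    fix u assume "u \<in> V"
    consider "u = q1" | "u = b1" | "u = q2" | "u = b2" | "u = a"
      | "u \<notin> {q1, b1, q2, b2, a}" by blast
    then show "(\<Sum>v\<in>N u. w v) = (real (card (N u)) - (t + 1)) * w u"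
    proof cases
      case 5
      have Na: "q1 \<notin> N a" "q2 \<notin> N a" using N_sym[of q1 a] N_sym[of q2 a] 1 2 ab by auto
      have "(\<Sum>v\<in>N a. w v) = (\<Sum>v\<in>{b1, b2}. w v)"
        using finite_N 1 2 N_sym Na by (intro sum.mono_neutral_right) (auto simp: w_def)
      then show ?thesis using 5 dist ne aw by (simp add: w_def)
    next
      case 6
      have "w v = 0" if "v \<in> N u" for v
        using that 6 N_sym[of v u] 1 2 by (auto simp: w_def)
      then show ?thesis using 6 by (simp add: w_def)
    qed (use 1 2 dist ne aw t in \<open>auto simp: w_def power2_eq_square algebra_simps\<close>)
  qed
qed

text \<open>With no neighbour besides leaves, pendant paths and brooms, the eigenvectors for the two golden
  eigenvalues are supported on the pendant paths, so these eigenvalues carry exactly the mass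
  \<open>1 - 1 / e\<close> at the vertices of the \<open>e\<close> pendant paths.\<close>

lemma excess_pendant_star:
  assumes A: "A = {b \<in> N a. \<exists>q. N q = {b} \<and> N b = {q, a} \<and> q \<noteq> a}" "2 \<le> card A"
    and rest: "\<And>w. w \<in> N a - A \<Longrightarrow>
      N w = {a} \<or> (\<exists>F. N w = insert a F \<and> a \<notin> F \<and> 2 \<le> card F \<and> (\<forall>q\<in>F. N q = {w}))"
  shows "12 / 5 - 4 / n \<le> total_excess"
proof -
  define e where "e = real (card A)"
  have finA: "finite A" using A finite_N by simp
  have e: "2 \<le> e" using A by (simp add: e_def)
  have "\<forall>b\<in>A. \<exists>q. N q = {b} \<and> N b = {q, a} \<and> q \<noteq> a" using A by auto
  then obtain qf where qf: "\<And>b. b \<in> A \<Longrightarrow> N (qf b) = {b} \<and> N b = {qf b, a} \<and> qf b \<noteq> a" by metis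
  have "A \<noteq> {}" using A(2) by auto
  then obtain b0 where b0: "b0 \<in> A" by blast
  then have aV: "a \<in> V" using A(1) N_in(2)[of b0 a] by simp
  have bV: "b \<in> V" "qf b \<in> V" if "b \<in> A" for b proof -
    have "qf b \<in> N b" using qf[OF that] by simp
    then show "b \<in> V" "qf b \<in> V" using N_in by blast+
  qed
  have inj: "inj_on qf A"
  proof (rule inj_onI)
    fix x y assume xy: "x \<in> A" "y \<in> A" and eq: "qf x = qf y"
    have "N (qf x) = {x}" "N (qf y) = {y}" using qf xy by blast+
    then show "x = y" unfolding eq by simp
  qed
  have Aq: "A \<inter> qf ` A = {}"
  proof -
    have False if "b \<in> A" "qf b \<in> A" for b
    proof -
      have "a \<in> N (qf b)" using qf[OF that(2)] by simp
      moreover have "N (qf b) = {b}" using qf[OF that(1)] by simp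
      ultimately have "a = b" by (simp only: singleton_iff)
      then show False using that(1) A(1) N_irrefl[of a] by blast
    qed
    then show ?thesis by auto
  qed
  \<comment> \<open>At a golden eigenvalue \<open>pendant_value\<close> gives x a = 0. A leaf at a
    then gets 0 because t is nonzero; at a broom with \<open>card F\<close> leaves the equations
    combine to (1 - card F) * (t + 1) * x w = 0, which is where at least two leaves are
    required.\<close>
  have vanish: "x a = 0" "\<And>w. w \<in> N a - A \<Longrightarrow> x w = 0"
    if x: "x \<in> eig (t + 1)" and t: "t^2 = t + 1" for x t
  proof -
    have "a \<noteq> qf b0" using qf[OF b0] by blast
    then show xa: "x a = 0"
      using pendant_value[OF x, of "qf b0" b0 a] qf[OF b0] t by simp
    have t0: "t \<noteq> 0" "t \<noteq> - 1" using t by auto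
    fix w assume w: "w \<in> N a - A"
    from rest[OF w] show "x w = 0"
    proof
      assume "N w = {a}"
      then show ?thesis using leaf_value[OF x, of w a] xa t0 by simp
    next
      assume "\<exists>F. N w = insert a F \<and> a \<notin> F \<and> 2 \<le> card F \<and> (\<forall>q\<in>F. N q = {w})"
      then obtain F where F: "N w = insert a F" "a \<notin> F" "2 \<le> card F" "\<forall>q\<in>F. N q = {w}" by blast
      have finF: "finite F" using F(3) by (auto intro: card_ge_0_finite)
      have "x q = - x w / t" if "q \<in> F" for q
        using leaf_value[OF x, of q w] F(4) that t0 by (simp add: field_simps)
      then have "(\<Sum>v\<in>N w. x v) = real (card F) * (- x w / t)"
        using F(1,2) finF xa by simp
      moreover have "(\<Sum>v\<in>N w. x v) = (real (card F) - t) * x w"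
        using eigen_eq[OF x, of w] w N_subset F(1,2) finF by auto
      ultimately have "(t^2 - card F * t - card F) * x w = 0"
        using t0 by (simp add: field_simps power2_eq_square)
      then have "(1 - real (card F)) * (t + 1) * x w = 0" using t by (simp add: algebra_simps)
      then show ?thesis using F(3) t0 by (auto simp: add_eq_0_iff2)
    qed
  qed
  \<comment> \<open>Each path vector has squared norm 1 + t^2 = t + 2. Since the values at the e
    path ends must sum to 0, only the fraction 1 - 1 / e of 1 / (t + 2) remains.\<close>
  have mass: "E (t + 1) (qf b) (qf b) = (1 - 1 / e) / (t + 2)"
    if b: "b \<in> A" and t: "t^2 = t + 1" for b t
  proof -
    define z where "z = (\<lambda>u. E (t + 1) u (qf b))"
    have z: "z \<in> eig (t + 1)" unfolding z_def by (rule E_column[OF bV(2)[OF b]])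
    have t0: "t \<noteq> 0" "t \<noteq> - 2" using t by auto
    have leaf: "z b' = - t * z (qf b')" if "b' \<in> A" for b'
      using leaf_value[OF z, of "qf b'" b'] qf[OF that] by simp
    have "(\<Sum>v\<in>N a. z v) = (\<Sum>v\<in>A. z v)"
      using vanish(2)[OF z t] A finite_N by (intro sum.mono_neutral_right) auto
    then have "(\<Sum>v\<in>A. z v) = 0" using eigen_eq[OF z aV] vanish(1)[OF z t] by simp
    moreover have "(\<Sum>v\<in>A. z v) = - t * (\<Sum>v\<in>A. z (qf v))"
      unfolding sum_distrib_left by (intro sum.cong refl leaf)
    ultimately have "(\<Sum>v\<in>A. z (qf v)) = 0" using t0 by simp
    then have 1: "(\<Sum>v\<in>A - {b}. z (qf v)) = - z (qf b)"
      using b finA by (simp add: sum.remove)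
    have "z (qf b') = z (qf b) - 1 / (t + 2)" if b': "b' \<in> A - {b}" for b'
    proof -
      have b'A: "b' \<in> A" "b \<noteq> b'" using b' by auto
      have qb: "N (qf b) = {b}" "N b = {qf b, a}" "qf b \<noteq> a" using qf[OF b] by simp_all
      have qb': "N (qf b') = {b'}" "N b' = {qf b', a}" "qf b' \<noteq> a"
        using qf[OF b'A(1)] by simp_all
      define w where "w = (\<lambda>u. if u = qf b then 1 else if u = b then - t else
        if u = qf b' then - 1 else if u = b' then t else (0::real))"
      have w: "w \<in> eig (t + 1)" and d: "distinct [qf b, b, qf b', b']"
        unfolding w_def by (fact pendant_difference_eigen[OF qb qb' b'A(2) t])+
      have "(\<Sum>u\<in>V. z u * w u) = (\<Sum>u\<in>{qf b, b, qf b', b'}. z u * w u)"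
        using finite_verts bV[OF b] bV[OF b'A(1)]
        by (intro sum.mono_neutral_right) (auto simp: w_def)
      also have "\<dots> = z (qf b) - t * z b - z (qf b') + t * z b'"
        using d by (auto simp: w_def)
      also have "(\<Sum>u\<in>V. z u * w u) = 1"
        unfolding z_def using E_reproduce[OF bV(2)[OF b] w] by (simp add: w_def)
      finally have "1 = (1 + t^2) * (z (qf b) - z (qf b'))"
        by (simp add: leaf[OF b] leaf[OF b'A(1)] power2_eq_square algebra_simps)
      then show ?thesis using t t0 by (simp add: field_simps)
    qed
    then have "(\<Sum>v\<in>A - {b}. z (qf v)) = (e - 1) * (z (qf b) - 1 / (t + 2))"
      using b finA e by (simp add: e_def of_nat_diff)
    then have ez: "e * z (qf b) = (e - 1) / (t + 2)" using 1 by (simp add: algebra_simps)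
    have "z (qf b) = e * z (qf b) / e" using e by simp
    also have "\<dots> = (e - 1) / (t + 2) / e" by (simp only: ez)
    also have "\<dots> = (1 - 1 / e) / (t + 2)" using e t0 by (simp add: field_simps)
    finally show ?thesis by (simp add: z_def)
  qed
  obtain r s :: real where rs: "r^2 = r + 1" "s^2 = s + 1" "r + s = 1" "r * s = -1" "s < 0" "0 < r"
    by (rule golden_roots)
  \<comment> \<open>g and 1 - g are 1 / (r + 2) and 1 / (s + 2), the shares of the two golden
    eigenvalues in the total golden mass 1 - 1 / e at a path end.\<close>
  define g where "g = (s + 2) / 5"
  have g': "1 - g = (r + 2) / 5"
    using rs(3) unfolding g_def by (simp add: field_simps)
  have prods: "(r + 2) * (s + 2) = 5" "(r + 1) * (s + 2) = r + 2" "(s + 1) * (r + 2) = s + 2"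
  proof -
    have "(r + 2) * (s + 2) = r * s + 2 * (r + s) + 4" "(r + 1) * (s + 2) = r * s + (r + s) + r + 2"
      "(s + 1) * (r + 2) = r * s + (r + s) + s + 2" by (simp_all add: algebra_simps)
    then show "(r + 2) * (s + 2) = 5" "(r + 1) * (s + 2) = r + 2" "(s + 1) * (r + 2) = s + 2"
      unfolding rs(3,4) by simp_all
  qed
  have inv: "1 / (r + 2) = g" "1 / (s + 2) = 1 - g"
  proof -
    have "r + 2 \<noteq> 0" "s + 2 \<noteq> 0" using prods(1) by auto
    then show "1 / (r + 2) = g" "1 / (s + 2) = 1 - g"
      unfolding g' unfolding g_def using prods(1) by (simp_all add: field_simps)
  qed
  have gg: "g^2 + (1 - g)^2 = 3 / 5"
  proof -
    have "g * (1 - g) = 1 / 5" unfolding g' unfolding g_def using prods(1) by (simp add: mult.commute)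
    moreover have "g^2 + (1 - g)^2 = 1 - 2 * (g * (1 - g))"
      by (simp add: power2_eq_square algebra_simps)
    ultimately show ?thesis by simp
  qed
  define l where "l = 1 - 1 / e"
  have theta: "finite {r + 1, s + 1}" "0 \<notin> {r + 1, s + 1}" "r + 1 \<noteq> s + 1"
    proof -
    have "r \<noteq> - 1" "s \<noteq> - 1" using rs(1,2) by auto
    then show "finite {r + 1, s + 1}" "0 \<notin> {r + 1, s + 1}" "r + 1 \<noteq> s + 1"
      using rs(5,6) by (auto simp: add_eq_0_iff2)
  qed
  have ex: "2 * S * l - 8 / 5 * l^2 \<le> excess v"
    if v: "v \<in> V" and E: "E (r + 1) v v = l * h" "E (s + 1) v v = l * (1 - h)" "h^2 + (1 - h)^2 = 3 / 5"
    for v h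
  proof -
    have 1: "(\<Sum>\<theta>\<in>{r + 1, s + 1}. (E \<theta> v v)^2) = l^2 * (3 / 5)"
      using theta(3) unfolding E(3)[symmetric] by (simp add: E(1,2) power_mult_distrib distrib_left)
    have 2: "(\<Sum>\<theta>\<in>{r + 1, s + 1}. E \<theta> v v) = l"
      using theta(3) by (simp add: E(1,2) right_diff_distrib)
    have "S^2 - l^2 * (3 / 5) - (S - l)^2 = 2 * S * l - 8 / 5 * l^2"
      by (simp add: power2_diff)
    then show ?thesis using excess_split[OF v theta(1,2)] unfolding 1 2 by simp
  qed
  have Er: "E (r + 1) (qf b) (qf b) = l * g" "E (s + 1) (qf b) (qf b) = l * (1 - g)" if "b \<in> A" for b
    using mass[OF that rs(1)] mass[OF that rs(2)] inv[symmetric] by (simp_all add: l_def)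
  have exq: "2 * S * l - 8 / 5 * l^2 \<le> excess (qf b)" if "b \<in> A" for b
    using ex[OF bV(2)[OF that] Er[OF that] gg] .
  \<comment> \<open>Passing from the leaf to its neighbour multiplies the masses by t^2 = t + 1,
    which exchanges the shares g and 1 - g.\<close>
  have exb: "2 * S * l - 8 / 5 * l^2 \<le> excess b" if b: "b \<in> A" for b
  proof (rule ex[OF bV(1)[OF b]])
    have "(r + 1) * g = 1 - g" unfolding g' unfolding g_def using prods(2) by simp
    then show "E (r + 1) b b = l * (1 - g)"
      using E_diag_leaf_nbr[of "qf b" b "r + 1"] qf[OF b] Er[OF b] rs(1)
      by (simp add: mult.left_commute)
    have "(s + 1) * (1 - g) = g" unfolding g' unfolding g_def using prods(3) by simp
    then show "E (s + 1) b b = l * (1 - (1 - g))"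
      using E_diag_leaf_nbr[of "qf b" b "s + 1"] qf[OF b] Er[OF b] rs(2)
      by (simp add: mult.left_commute)
    show "(1 - g)^2 + (1 - (1 - g))^2 = 3 / 5" using gg by simp
  qed
  have "2 * e * (2 * S * l - 8 / 5 * l^2)
      = (\<Sum>b\<in>A. 2 * S * l - 8 / 5 * l^2) + (\<Sum>b\<in>A. 2 * S * l - 8 / 5 * l^2)"
    by (simp add: e_def)
  also have "\<dots> \<le> (\<Sum>b\<in>A. excess b) + (\<Sum>b\<in>A. excess (qf b))"
    by (intro add_mono sum_mono exb exq)
  also have "\<dots> = (\<Sum>u\<in>A \<union> qf ` A. excess u)"
    using finA Aq inj by (simp add: sum.union_disjoint sum.reindex)
  also have "\<dots> \<le> total_excess" using bV by (intro sum_excess_ge) auto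
  finally have fin: "2 * e * (2 * S * l - 8 / 5 * l^2) \<le> total_excess" .
  have "5 \<le> card V"
  proof -
    have "a \<notin> A" using A(1) N_irrefl by blast
    moreover have "a \<notin> qf ` A" using qf by blast
    ultimately have "a \<notin> A \<union> qf ` A" by blast
    moreover have "card (A \<union> qf ` A) = 2 * card A"
      using finA Aq inj by (simp add: card_Un_disjoint card_image)
    ultimately have "card (insert a (A \<union> qf ` A)) = Suc (2 * card A)" using finA by simp
    moreover have "card (insert a (A \<union> qf ` A)) \<le> card V"
      using aV bV finite_verts by (intro card_mono) auto
    ultimately show ?thesis using A(2) by linarith
  qed
  then have "4 / 5 \<le> S" by (simp add: field_simps)
  then have "4 * S - 8 / 5 \<le> 2 * e * (2 * S * l - 8 / 5 * l^2)"
    unfolding l_def by (rule excess_pendant_pair_numeric[OF e])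
  then show ?thesis using fin by simp
qed

end

section \<open>The double star with a pendant path\<close>

lemma cubic_vieta:
  fixes r1 r2 r3 e1 e2 e3 :: real
  assumes roots: "\<And>r. r \<in> {r1, r2, r3} \<Longrightarrow> r ^ 3 - e1 * r^2 + e2 * r - e3 = 0"
    and dist: "r1 \<noteq> r2" "r1 \<noteq> r3" "r2 \<noteq> r3"
  shows "r1 + r2 + r3 = e1" "r1 * r2 + r1 * r3 + r2 * r3 = e2" "r1 * r2 * r3 = e3"
proof -
  have c: "r1 ^ 3 - e1 * r1^2 + e2 * r1 - e3 = 0" "r2 ^ 3 - e1 * r2^2 + e2 * r2 - e3 = 0"
    "r3 ^ 3 - e1 * r3^2 + e2 * r3 - e3 = 0" using roots by auto
  have "(r1 - r2) * (r1^2 + r1 * r2 + r2^2 - e1 * (r1 + r2) + e2) = 0" using c(1,2) by algebra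
  then have q12: "r1^2 + r1 * r2 + r2^2 - e1 * (r1 + r2) + e2 = 0" using dist by simp
  have "(r1 - r3) * (r1^2 + r1 * r3 + r3^2 - e1 * (r1 + r3) + e2) = 0" using c(1,3) by algebra
  then have q13: "r1^2 + r1 * r3 + r3^2 - e1 * (r1 + r3) + e2 = 0" using dist by simp
  have "(r2 - r3) * (r1 + r2 + r3 - e1) = 0" using q12 q13 by algebra
  then show s: "r1 + r2 + r3 = e1" using dist by simp
  show p: "r1 * r2 + r1 * r3 + r2 * r3 = e2" using q12 s by algebra
  show "r1 * r2 * r3 = e3" using c(1) s p by algebra
qed

text \<open>The cubic changes sign between -1 and 0, between 0 and 2 and between 2 and l + 3, so it
  has three distinct real roots.\<close>

lemma double_star_cubic_roots:
  fixes l :: real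
  assumes l: "0 < l"
  obtains r1 r2 r3 where "\<And>t. t ^ 3 - (l + 2) * t^2 + l * t + l = 0 \<Longrightarrow> t \<in> {r1, r2, r3}"
    "r1 + r2 + r3 = l + 2" "r1 * r2 + r1 * r3 + r2 * r3 = l" "r1 * r2 * r3 = - l"
    "r1 \<noteq> r2" "r1 \<noteq> r3" "r2 \<noteq> r3"
proof -
  define C where "C t = t ^ 3 - (l + 2) * t^2 + l * t + l" for t
  have cont: "isCont C t" for t unfolding C_def by (intro continuous_intros)
  have v: "C (-1) < 0" "C 0 > 0" "C 2 < 0" using l by (simp_all add: C_def)
  have v4: "C (l + 3) > 0"
  proof -
    have "C (l + 3) = (l + 3)^2 + l * (l + 3) + l" unfolding C_def by algebra
    then show ?thesis using l by (simp add: add_pos_pos)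
  qed
  obtain r1 where r1: "-1 \<le> r1" "r1 \<le> 0" "C r1 = 0" using IVT[of C "-1" 0 0] v cont by auto
  obtain r2 where r2: "0 \<le> r2" "r2 \<le> 2" "C r2 = 0" using IVT2[of C 2 0 0] v cont by auto
  obtain r3 where r3: "2 \<le> r3" "C r3 = 0" using IVT[of C 2 0 "l + 3"] v v4 cont l by auto
  have ne: "r1 \<noteq> 0" "r2 \<noteq> 0" "r2 \<noteq> 2" "r3 \<noteq> 2" using r1 r2 r3 v by auto
  have dist: "r1 \<noteq> r2" "r1 \<noteq> r3" "r2 \<noteq> r3" using r1 r2 r3 ne by auto
  have vieta: "r1 + r2 + r3 = l + 2" "r1 * r2 + r1 * r3 + r2 * r3 = l" "r1 * r2 * r3 = - l"
    using cubic_vieta[of r1 r2 r3 "l + 2" l "- l"] r1 r2 r3 dist by (auto simp: C_def)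
  have "t \<in> {r1, r2, r3}" if "t ^ 3 - (l + 2) * t^2 + l * t + l = 0" for t
  proof -
    have "t ^ 3 - (l + 2) * t^2 + l * t + l = (t - r1) * ((t - r2) * (t - r3))"
      using vieta by algebra
    then show ?thesis using that by auto
  qed
  then show ?thesis using vieta dist by (rule that)
qed

text \<open>The normal equations make \<open>\<alpha> + \<beta> t + \<gamma> t\<^sup>2\<close> the orthogonal projection of \<open>p\<close> on the quadratic
  functions on three points, so no information is lost when the three points are all attained.\<close>

lemma sum_power2_ge_quadratic_moments:
  fixes p :: "real \<Rightarrow> real"
  assumes fin: "finite R" and R: "(\<lambda>\<theta>. \<theta> - 1) ` R \<subseteq> {r1, r2, r3}"
    and dist: "r1 \<noteq> r2" "r1 \<noteq> r3" "r2 \<noteq> r3"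
    and m: "(\<Sum>\<theta>\<in>R. p \<theta>) = m0" "(\<Sum>\<theta>\<in>R. (\<theta> - 1) * p \<theta>) = m1" "(\<Sum>\<theta>\<in>R. (\<theta> - 1)^2 * p \<theta>) = m2"
    and s: "s1 = r1 + r2 + r3" "s2 = r1^2 + r2^2 + r3^2" "s3 = r1 ^ 3 + r2 ^ 3 + r3 ^ 3"
      "s4 = r1 ^ 4 + r2 ^ 4 + r3 ^ 4"
    and normal: "3 * \<alpha> + s1 * \<beta> + s2 * \<gamma> = m0" "s1 * \<alpha> + s2 * \<beta> + s3 * \<gamma> = m1"
      "s2 * \<alpha> + s3 * \<beta> + s4 * \<gamma> = m2"
  shows "\<alpha> * m0 + \<beta> * m1 + \<gamma> * m2 \<le> (\<Sum>\<theta>\<in>R. (p \<theta>)^2)"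
proof -
  define f where "f t = \<alpha> + \<beta> * t + \<gamma> * t^2" for t
  have "(\<Sum>\<theta>\<in>R. (f (\<theta> - 1))^2) = (\<Sum>t\<in>(\<lambda>\<theta>. \<theta> - 1) ` R. (f t)^2)"
    by (subst sum.reindex) (auto simp: inj_on_def)
  also have "\<dots> \<le> (\<Sum>t\<in>{r1, r2, r3}. (f t)^2)" using R by (intro sum_mono2) auto
  also have "\<dots> = (f r1)^2 + (f r2)^2 + (f r3)^2" using dist by simp
  also have "\<dots> = \<alpha> * (3 * \<alpha> + s1 * \<beta> + s2 * \<gamma>) + \<beta> * (s1 * \<alpha> + s2 * \<beta> + s3 * \<gamma>)
      + \<gamma> * (s2 * \<alpha> + s3 * \<beta> + s4 * \<gamma>)"
    unfolding s f_def by algebra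
  finally have F: "(\<Sum>\<theta>\<in>R. (f (\<theta> - 1))^2) \<le> \<alpha> * m0 + \<beta> * m1 + \<gamma> * m2"
    unfolding normal .
  have "(\<Sum>\<theta>\<in>R. p \<theta> * f (\<theta> - 1))
      = (\<Sum>\<theta>\<in>R. \<alpha> * p \<theta> + \<beta> * ((\<theta> - 1) * p \<theta>)
        + \<gamma> * ((\<theta> - 1)^2 * p \<theta>))"
    unfolding f_def by (intro sum.cong) (auto simp: algebra_simps)
  also have "\<dots> = \<alpha> * m0 + \<beta> * m1 + \<gamma> * m2"
    unfolding m[symmetric] by (simp add: sum.distrib sum_distrib_left)
  finally have P: "(\<Sum>\<theta>\<in>R. p \<theta> * f (\<theta> - 1)) = \<alpha> * m0 + \<beta> * m1 + \<gamma> * m2" .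
  have "0 \<le> (\<Sum>\<theta>\<in>R. (p \<theta> - f (\<theta> - 1))^2)" by (rule sum_nonneg) simp
  also have "\<dots> = (\<Sum>\<theta>\<in>R. (p \<theta>)^2) - 2 * (\<Sum>\<theta>\<in>R. p \<theta> * f (\<theta> - 1)) + (\<Sum>\<theta>\<in>R. (f (\<theta> - 1))^2)"
    by (simp add: power2_diff sum.distrib sum_subtractf sum_distrib_left mult.assoc)
  finally show ?thesis using F P by linarith
qed

lemma double_star_power_sums:
  fixes r1 r2 r3 l :: real
  assumes "r1 + r2 + r3 = l + 2" "r1 * r2 + r1 * r3 + r2 * r3 = l" "r1 * r2 * r3 = - l"
  shows "l^2 + 2 * l + 4 = r1^2 + r2^2 + r3^2"
    and "l ^ 3 + 3 * l^2 + 3 * l + 8 = r1 ^ 3 + r2 ^ 3 + r3 ^ 3"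
    and "l ^ 4 + 4 * l ^ 3 + 6 * l^2 + 8 * l + 16 = r1 ^ 4 + r2 ^ 4 + r3 ^ 4"
  using assms by algebra+

section \<open>Moments of the diagonal masses\<close>

context connected_graph
begin

lemma sum_laplacian_power2:
  assumes u: "u \<in> V"
  shows "(\<Sum>v\<in>V. (laplacian G u v)^2) = (real (card (N u)))^2 + card (N u)"
proof -
  have L: "laplacian G u u = card (N u)" "\<And>v. v \<in> N u \<Longrightarrow> laplacian G u v = - 1"
    using N_irrefl by (auto simp: laplacian_def degree_matrix_def adjacency_matrix_def
        out_degree_eq nbrs_def)
  have "(\<Sum>v\<in>V. (laplacian G u v)^2) = card (N u) * laplacian G u u - (\<Sum>v\<in>N u. laplacian G u v)"
    using laplacian_apply[OF u, of "laplacian G u"] by (simp add: power2_eq_square)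
  also have "(\<Sum>v\<in>N u. laplacian G u v) = - card (N u)" using L(2) by simp
  finally show ?thesis using L(1) by (simp add: power2_eq_square)
qed

text \<open>These are the diagonal entries of the first powers of L - I, less the contribution of
  the eigenvalue 0, which is 1 / n times 1, -1 and 1. The eigenvalue 1 drops out of the sums by
  \<open>E1\<close>, also in the moment of order 0.\<close>

lemma centred_moments:
  assumes u: "u \<in> V" and E1: "E 1 u u = 0"
  defines "d \<equiv> real (card (N u))"
  shows "(\<Sum>\<theta>\<in>evs - {0, 1}. E \<theta> u u) = 1 - 1 / n"
    and "(\<Sum>\<theta>\<in>evs - {0, 1}. (\<theta> - 1) * E \<theta> u u) = d - 1 + 1 / n"
    and "(\<Sum>\<theta>\<in>evs - {0, 1}. (\<theta> - 1)^2 * E \<theta> u u) = d^2 - d + 1 - 1 / n"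
proof -
  have del: "(\<Sum>\<theta>\<in>evs - {0, 1}. g \<theta> * E \<theta> u u) = (\<Sum>\<theta>\<in>evs. g \<theta> * E \<theta> u u) - g 0 / n" for g
  proof -
    have "(\<Sum>\<theta>\<in>evs - {0, 1}. g \<theta> * E \<theta> u u) = (\<Sum>\<theta>\<in>evs - {0}. g \<theta> * E \<theta> u u)"
      using finite_evs E1 by (intro sum.mono_neutral_left) auto
    then show ?thesis using finite_evs zero_in_evs E_zero[OF u] by (simp add: sum_diff1)
  qed
  have Luu: "laplacian G u u = d"
    using N_irrefl[of u] by (simp add: laplacian_def degree_matrix_def adjacency_matrix_def
        out_degree_eq nbrs_def d_def)
  have 1: "(\<Sum>\<theta>\<in>evs. (\<theta> - 1) * E \<theta> u u) = d - 1"
    using sum_E_diag[OF u] sum_E_diag_moment1[OF u] Luu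
    by (simp add: left_diff_distrib sum_subtractf)
  have "(\<Sum>\<theta>\<in>evs. (\<theta> - 1)^2 * E \<theta> u u)
      
        = (\<Sum>\<theta>\<in>evs. \<theta>^2 * E \<theta> u u) - 2 * (\<Sum>\<theta>\<in>evs. \<theta> * E \<theta> u u)
        + (\<Sum>\<theta>\<in>evs. E \<theta> u u)"
    by (simp add: power2_diff left_diff_distrib distrib_right sum_subtractf sum.distrib
        sum_distrib_left mult.assoc)
  then have 2: "(\<Sum>\<theta>\<in>evs. (\<theta> - 1)^2 * E \<theta> u u) = d^2 - d + 1"
    using sum_E_diag[OF u] sum_E_diag_moment1[OF u] sum_E_diag_moment2[OF u] Luu
      sum_laplacian_power2[OF u] by (simp add: d_def)
  show "(\<Sum>\<theta>\<in>evs - {0, 1}. E \<theta> u u) = 1 - 1 / n"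
    using del[of "\<lambda>_. 1"] sum_E_diag[OF u] by simp
  show "(\<Sum>\<theta>\<in>evs - {0, 1}. (\<theta> - 1) * E \<theta> u u) = d - 1 + 1 / n"
    using del[of "\<lambda>\<theta>. \<theta> - 1"] 1 by simp
  show "(\<Sum>\<theta>\<in>evs - {0, 1}. (\<theta> - 1)^2 * E \<theta> u u) = d^2 - d + 1 - 1 / n"
    using del[of "\<lambda>\<theta>. (\<theta> - 1)^2"] 2 by simp
qed

lemma excess_remove_one:
  "excess u = S^2 - (E 1 u u)^2 - (\<Sum>\<theta>\<in>evs - {0, 1}. (E \<theta> u u)^2)" if "u \<in> V"
proof -
  have "(\<Sum>\<theta>\<in>evs - {0}. (E \<theta> u u)^2) = (E 1 u u)^2 + (\<Sum>\<theta>\<in>evs - {0} - {1}. (E \<theta> u u)^2)"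
    using finite_evs E_not_eigenvalue[OF that, of 1]
      sum.remove[of "evs - {0}" 1 "\<lambda>\<theta>. (E \<theta> u u)^2"] by (cases "1 \<in> evs") auto
  moreover have "evs - {0} - {1} = evs - {0, 1}" by auto
  ultimately show ?thesis by (simp add: excess_def)
qed

end

text \<open>The final inequality of \<open>excess_double_star\<close>: the terms are the upper
  bounds for the excess of the l leaves and of q, b, a. Over a common denominator it becomes a
  polynomial inequality, whose only negative coefficient in k = l - 2 is absorbed by completing a
  square.\<close>

lemma double_star_numeric:
  fixes l :: real
  assumes l: "2 \<le> l"
  defines "m \<equiv> l + 3" and "D \<equiv> 5 * l ^ 3 + 6 * l^2 - 11 * l + 32"
  shows "l * ((1 - 1 / m)^2 - (1 - 1 / l)^2 - 3 / (l^2 * m^2)) + 3 * (1 - 1 / m)^2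
    - (44 + 44 * l + 8 * l^2 + 15 * l ^ 3 + 14 * l ^ 4 + 3 * l ^ 5) / (m^2 * D)
    - (128 - 12 * l - 32 * l^2 + 23 * l ^ 3 + 18 * l ^ 4 + 3 * l ^ 5) / (m^2 * D)
    - (44 + 50 * l - 20 * l^2 + 23 * l ^ 3 + 26 * l ^ 4 + 5 * l ^ 5) / (m^2 * D)
    < 4 / 5 + 22 / 5 / m - 2 / m^2" (is "?X < ?h")
proof -
  have m: "m > 0" "l > 0" using l by (simp_all add: m_def)
  define k where "k = l - 2"
  have k: "0 \<le> k" "l = k + 2" using l by (simp_all add: k_def)
  have D: "D > 0"
  proof -
    have "D = 5 * k ^ 3 + 36 * k^2 + 73 * k + 74" unfolding D_def k(2) by algebra
    then show ?thesis using k(1) by (simp add: add_nonneg_pos)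
  qed
  have "(?h - ?X) * (5 * (l * m^2 * D))
      = 4 * l ^ 5 + 22 * l ^ 4 + 44 * l ^ 3 - 330 * l^2 - 476 * l + 1920"
    using m D by (simp add: divide_simps) (simp add: m_def D_def, algebra)
  also have "\<dots> = 4 * k ^ 5 + 62 * k ^ 4 + 380 * k ^ 3 + 782 * k^2 - 244 * k + 480"
    unfolding k(2) by algebra
  also have "\<dots> > 0"
  proof -
    have "782 * k^2 - 244 * k + 480 = 782 * (k - 122 / 782)^2 + (480 - 122 * 122 / 782)"
      by (simp add: power2_eq_square field_simps)
    then have "782 * k^2 - 244 * k + 480 > 0" by (simp add: add_nonneg_pos)
    moreover have "4 * k ^ 5 + 62 * k ^ 4 + 380 * k ^ 3 \<ge> 0" using k by simp
    ultimately show ?thesis by linarith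
  qed
  finally have "0 < (?h - ?X) * (5 * (l * m^2 * D))" .
  moreover have "0 < 5 * (l * m^2 * D)" using m D by simp
  ultimately have "0 < ?h - ?X" by (rule zero_less_mult_pos2)
  then show ?thesis by (simp only: diff_gt_0_iff_gt)
qed

context connected_graph
begin

text \<open>All coordinates are multiples of x q, which thus cannot vanish; the equation at a then
  reads (t + 1) times the cubic equals 0, the factor t + 1 belonging to the eigenvalue 0.\<close>

lemma double_star_eigenvalue:
  assumes q: "N q = {b}" and b: "N b = {q, a}" "a \<noteq> q" and a: "N a = insert b F" "b \<notin> F"
    and F: "\<And>y. y \<in> F \<Longrightarrow> N y = {a}" and V: "V = {q, b, a} \<union> F"
    and \<theta>: "\<theta> \<in> evs" "\<theta> \<noteq> 0" "\<theta> \<noteq> 1"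
  defines "l \<equiv> real (card F)" and "t \<equiv> \<theta> - 1"
  shows "t ^ 3 - (l + 2) * t^2 + l * t + l = 0"
proof -
  obtain x where x: "x \<in> eig \<theta>" "x \<noteq> (\<lambda>_. 0)" using \<theta>(1) by (auto simp: eigenvalues_on_def)
  have finF: "finite F" using a(1) finite_N[of a] by simp
  have t0: "t \<noteq> 0" "t \<noteq> - 1" using \<theta> by (auto simp: t_def)
  define P where "P = t^2 - t - 1"
  have xb: "x b = - t * x q" using leaf_value[OF x(1) q] by (simp add: t_def)
  have xa: "x a = P * x q" using pendant_value[OF x(1) q b] by (simp add: P_def t_def)
  have xy: "x y = - x a / t" if "y \<in> F" for y
    using leaf_value[OF x(1) F[OF that]] t0 by (simp add: t_def field_simps)
  have "x q \<noteq> 0"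
  proof
    assume "x q = 0"
    then have "x u = 0" if "u \<in> V" for u using that xa xb xy V by auto
    then show False using x by (auto simp: eigen_iff fun_eq_iff)
  qed
  have "(\<Sum>v\<in>N a. x v) = x b + l * (- x a / t)"
    using a finF xy by (simp add: l_def)
  moreover have "(\<Sum>v\<in>N a. x v) = (l - t) * x a"
    using eigen_eq[OF x(1), of a] V a finF by (simp add: l_def t_def)
  ultimately have "t * ((l - t) * x a) = t * x b - l * x a"
    using t0 by (simp add: field_simps)
  then have "x q * ((t + 1) * (t ^ 3 - (l + 2) * t^2 + l * t + l)) = 0"
    unfolding xa xb P_def by algebra
  then show ?thesis using \<open>x q \<noteq> 0\<close> t0 by auto
qed

text \<open>At q, b and a the eigenvalue 1 has no mass, and the three moments determine the masses
  on the at most three remaining nonzero eigenvalues. At a leaf in F the mass at 1 is known exactly,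
  and Cauchy-Schwarz handles the small remainder. The strictness makes non-strict bounds for other
  trees sufficient.\<close>

lemma excess_double_star:
  assumes q: "N q = {b}" and b: "N b = {q, a}" "a \<noteq> q" and a: "N a = insert b F" "b \<notin> F"
    and F: "\<And>y. y \<in> F \<Longrightarrow> N y = {a}" "2 \<le> card F"
  shows "total_excess < 4 / 5 + 22 / 5 / n - 2 / n^2"
proof -
  define l where "l = real (card F)"
  have l: "2 \<le> l" using F(2) by (simp add: l_def)
  have finF: "finite F" using a(1) finite_N[of a] by simp
  have mem: "q \<in> V" "b \<in> V" "a \<in> V" using b(1) N_in[of _ b] by auto
  have Fne: "F \<noteq> {}" using F(2) by auto
  have FV: "F \<subseteq> V" using a(1) N_subset by blast
  have V: "V = {q, b, a} \<union> F"
    using q b a F mem FV by (intro closed_eq_verts[symmetric]) auto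
  have ba: "b \<noteq> a" "q \<noteq> b" using b N_irrefl[of b] by auto
  have notF: "q \<notin> F" "a \<notin> F" using F(1)[of q] F(1)[of a] q a ba by auto
  have cardV: "n = l + 3"
    using V finF notF a(2) ba b(2) by (simp add: l_def)
  have lv: "leaves_at a = F"
    using F(1) leaves_at_subset[of a] a b ba by (auto simp: leaves_at_def)
  obtain r1 r2 r3 where root: "\<And>t. t ^ 3 - (l + 2) * t^2 + l * t + l = 0 \<Longrightarrow> t \<in> {r1, r2, r3}"
    and vieta: "r1 + r2 + r3 = l + 2" "r1 * r2 + r1 * r3 + r2 * r3 = l" "r1 * r2 * r3 = - l"
    and dist: "r1 \<noteq> r2" "r1 \<noteq> r3" "r2 \<noteq> r3"
    using double_star_cubic_roots[of l] l by auto
  define R where "R = evs - {0, 1}"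
  have R: "finite R" "(\<lambda>\<theta>. \<theta> - 1) ` R \<subseteq> {r1, r2, r3}"
    using finite_evs double_star_eigenvalue[OF q b a F(1) V] root
    unfolding R_def l_def by blast+
  have cardR: "card R \<le> 3"
  proof -
    have "card R = card ((\<lambda>\<theta>. \<theta> - 1) ` R)" by (rule card_image[symmetric]) (auto simp: inj_on_def)
    also have "\<dots> \<le> card {r1, r2, r3}" using R(2) by (intro card_mono) auto
    finally show ?thesis using dist by simp
  qed
  \<comment> \<open>D is the discriminant of the cubic divided by l. The Gram matrix of the normal
    equations has that discriminant as its determinant, so D appears in the denominators of their
    solution.\<close>
  define D where "D = 5 * l ^ 3 + 6 * l^2 - 11 * l + 32"
  have D: "D > 0"
  proof -
    have "D = l * (5 * l^2 - 11) + 6 * l^2 + 32" by (simp add: D_def power2_eq_square power3_eq_cube algebra_simps)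
    moreover have "4 \<le> l^2" using l mult_mono[of 2 l 2 l] by (simp add: power2_eq_square)
    ultimately show ?thesis using l by (simp add: add_pos_pos)
  qed
  have m: "l + 3 > 0" using l by simp
  \<comment> \<open>At \<theta> = 1 the value at a is minus the value at q, and a carries leaves, so
    it has value 0.\<close>
  have E1q: "E 1 q q = 0"
  proof -
    have "E 1 a q = 0"
      using eigen_one_support[OF E_column[OF mem(1)], of a] lv Fne by simp
    then show ?thesis using pendant_value[OF E_column[OF mem(1)] q b, of 1] by simp
  qed
  have E1: "E 1 b b = 0" "E 1 a a = 0"
    using E_diag_leaf_nbr[OF q, of 1] E_diag_pendant_root[OF q b, of 1] E1q by auto
  have deg: "card (N q) = 1" "card (N b) = 2" "real (card (N a)) = l + 1"
    using q b a finF by (auto simp: l_def)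
  note mom = centred_moments[folded R_def]
  note sq = sum_power2_ge_quadratic_moments[OF R dist _ _ _ vieta(1)[symmetric]
      double_star_power_sums[OF vieta]]
  let ?z = "1 / (l + 3)" and ?K = "(l + 3) * D"
  have Sq: "(44 + 44 * l + 8 * l^2 + 15 * l ^ 3 + 14 * l ^ 4 + 3 * l ^ 5) / ((l + 3)^2 * D)
      \<le> (\<Sum>\<theta>\<in>R. (E \<theta> q q)^2)"
  proof -
    \<comment> \<open>The coefficients solve the normal equations of
      \<open>sum_power2_ge_quadratic_moments\<close> for the moments at q; likewise for b and a
      below.\<close>
    let ?a = "(24 + 12 * l + l^2 + 8 * l ^ 3 + 3 * l ^ 4) / ?K"
      and ?b = "(- 18 + 3 * l + 3 * l^2 - 3 * l ^ 3 - l ^ 4) / ?K"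
      and ?c = "(7 - 7 * l - l^2 + l ^ 3) / ?K"
    have mm: "(\<Sum>\<theta>\<in>R. E \<theta> q q) = 1 - ?z" "(\<Sum>\<theta>\<in>R. (\<theta> - 1) * E \<theta> q q) = ?z"
      "(\<Sum>\<theta>\<in>R. (\<theta> - 1)^2 * E \<theta> q q) = 1 - ?z"
      using mom[OF mem(1) E1q] by (simp_all add: deg cardV)
    have "?a * (1 - ?z) + ?b * ?z + ?c * (1 - ?z) \<le> (\<Sum>\<theta>\<in>R. (E \<theta> q q)^2)"
      by (rule sq[OF mm]; use m D in \<open>simp add: divide_simps\<close>; simp add: D_def; algebra)
    moreover have "?a * (1 - ?z) + ?b * ?z + ?c * (1 - ?z)
        = (44 + 44 * l + 8 * l^2 + 15 * l ^ 3 + 14 * l ^ 4 + 3 * l ^ 5) / ((l + 3)^2 * D)"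
      using m D by (simp add: divide_simps) algebra
    ultimately show ?thesis by (simp only:)
  qed
  have Sb: "(128 - 12 * l - 32 * l^2 + 23 * l ^ 3 + 18 * l ^ 4 + 3 * l ^ 5) / ((l + 3)^2 * D)
      \<le> (\<Sum>\<theta>\<in>R. (E \<theta> b b)^2)"
  proof -
    let ?a = "(4 * l + 4 * l^2 + 6 * l ^ 3 + 2 * l ^ 4) / ?K"
      and ?b = "(- 3 * l + 11 * l^2 + 7 * l ^ 3 + l ^ 4) / ?K"
      and ?c = "(16 - 7 * l - 8 * l^2 - l ^ 3) / ?K"
    have mm: "(\<Sum>\<theta>\<in>R. E \<theta> b b) = 1 - ?z" "(\<Sum>\<theta>\<in>R. (\<theta> - 1) * E \<theta> b b) = 1 + ?z"
      "(\<Sum>\<theta>\<in>R. (\<theta> - 1)^2 * E \<theta> b b) = 3 - ?z"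
      using mom[OF mem(2) E1(1)] by (simp_all add: deg cardV)
    have "?a * (1 - ?z) + ?b * (1 + ?z) + ?c * (3 - ?z) \<le> (\<Sum>\<theta>\<in>R. (E \<theta> b b)^2)"
      by (rule sq[OF mm]; use m D in \<open>simp add: divide_simps\<close>; simp add: D_def; algebra)
    moreover have "?a * (1 - ?z) + ?b * (1 + ?z) + ?c * (3 - ?z)
        = (128 - 12 * l - 32 * l^2 + 23 * l ^ 3 + 18 * l ^ 4 + 3 * l ^ 5) / ((l + 3)^2 * D)"
      using m D by (simp add: divide_simps) algebra
    ultimately show ?thesis by (simp only:)
  qed
  have Sa: "(44 + 50 * l - 20 * l^2 + 23 * l ^ 3 + 26 * l ^ 4 + 5 * l ^ 5) / ((l + 3)^2 * D)
      \<le> (\<Sum>\<theta>\<in>R. (E \<theta> a a)^2)"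
  proof -
    let ?a = "(24 - 6 * l - 2 * l^2) / ?K"
      and ?b = "(30 - 8 * l - 6 * l^2) / ?K"
      and ?c = "(- 17 + 12 * l + 5 * l^2) / ?K"
    have mm: "(\<Sum>\<theta>\<in>R. E \<theta> a a) = 1 - ?z" "(\<Sum>\<theta>\<in>R. (\<theta> - 1) * E \<theta> a a) = l + ?z"
      "(\<Sum>\<theta>\<in>R. (\<theta> - 1)^2 * E \<theta> a a) = l^2 + l + 1 - ?z"
      using mom[OF mem(3) E1(2)] by (simp_all add: deg cardV power2_eq_square algebra_simps)
    have "?a * (1 - ?z) + ?b * (l + ?z) + ?c * (l^2 + l + 1 - ?z) \<le> (\<Sum>\<theta>\<in>R. (E \<theta> a a)^2)"
      by (rule sq[OF mm]; use m D in \<open>simp add: divide_simps\<close>; simp add: D_def; algebra)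
    moreover have "?a * (1 - ?z) + ?b * (l + ?z) + ?c * (l^2 + l + 1 - ?z)
        = (44 + 50 * l - 20 * l^2 + 23 * l ^ 3 + 26 * l ^ 4 + 5 * l ^ 5) / ((l + 3)^2 * D)"
      using m D by (simp add: divide_simps) algebra
    ultimately show ?thesis by (simp only:)
  qed
  have Sy: "excess y \<le> (1 - ?z)^2 - (1 - 1 / l)^2 - 3 / (l^2 * (l + 3)^2)" if y: "y \<in> F" for y
  proof -
    have yV: "y \<in> V" using y FV by auto
    have ne: "leaves_at b \<noteq> {}" using q by (auto simp: leaves_at_def)
    have E1y: "E 1 y y = 1 - 1 / l"
    proof -
      have "x w = 0" if "x \<in> eig 1" "w \<in> N a - leaves_at a" for x w
        using that lv a eigen_one_support[OF that(1) ne] by auto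
      then show ?thesis
        using excess_leaves_exact(1)[of a y] lv Fne y by (auto simp: l_def)
    qed
    have "(\<Sum>\<theta>\<in>R. E \<theta> y y) = (\<Sum>\<theta>\<in>evs - {0}. E \<theta> y y) - E 1 y y"
    proof -
      have "R = evs - {0} - {1}" by (auto simp: R_def)
      then show ?thesis using finite_evs E_not_eigenvalue[OF yV, of 1]
        by (cases "1 \<in> evs") (auto simp: sum_diff1)
    qed
    then have mass: "(\<Sum>\<theta>\<in>R. E \<theta> y y) = 3 / (l * (l + 3))"
      using sum_E_pos[OF yV] E1y cardV l by (simp add: field_simps)
    \<comment> \<open>The remaining mass 3 / (l * (l + 3)) is spread over at most three eigenvalues,
      so its squares sum to at least a third of its square.\<close>
    have "(\<Sum>\<theta>\<in>R. E \<theta> y y)^2 \<le> (\<Sum>\<theta>\<in>R. (E \<theta> y y)^2) * card R"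
      by (rule sum_squared_le_sum_of_squares)
    also have "\<dots> \<le> (\<Sum>\<theta>\<in>R. (E \<theta> y y)^2) * 3"
      using cardR by (intro mult_left_mono sum_nonneg) auto
    finally have "3 / (l^2 * (l + 3)^2) \<le> (\<Sum>\<theta>\<in>R. (E \<theta> y y)^2)"
      unfolding mass by (simp add: power_divide power_mult_distrib)
    then show ?thesis
      using excess_remove_one[OF yV] by (simp add: R_def[symmetric] E1y cardV)
  qed
  have "total_excess = excess q + excess b + excess a + (\<Sum>y\<in>F. excess y)"
    unfolding V using finF notF a(2) ba b(2) by simp
  also have "(\<Sum>y\<in>F. excess y) \<le> (\<Sum>y\<in>F. (1 - ?z)^2 - (1 - 1 / l)^2 - 3 / (l^2 * (l + 3)^2))"
    by (intro sum_mono Sy)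
  also have "\<dots> = l * ((1 - ?z)^2 - (1 - 1 / l)^2 - 3 / (l^2 * (l + 3)^2))"
    by (simp add: l_def)
  finally have "total_excess \<le> excess q + excess b + excess a
      + l * ((1 - ?z)^2 - (1 - 1 / l)^2 - 3 / (l^2 * (l + 3)^2))" by simp
  moreover have "excess q = (1 - ?z)^2 - (\<Sum>\<theta>\<in>R. (E \<theta> q q)^2)"
    "excess b = (1 - ?z)^2 - (\<Sum>\<theta>\<in>R. (E \<theta> b b)^2)"
    "excess a = (1 - ?z)^2 - (\<Sum>\<theta>\<in>R. (E \<theta> a a)^2)"
    using excess_remove_one mem by (simp_all add: R_def[symmetric] E1q E1 cardV)
  ultimately show ?thesis
    using Sq Sb Sa double_star_numeric[OF l] unfolding cardV D_def by linarith
qed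

end

section \<open>Longest paths in a tree\<close>

definition vertex_path :: "'a pair_pre_digraph \<Rightarrow> 'a list \<Rightarrow> bool" where
  "vertex_path G xs \<longleftrightarrow> xs \<noteq> [] \<and> distinct xs \<and> set xs \<subseteq> pverts G \<and> successively (\<lambda>u v. v \<in> nbrs G u) xs"

definition longest_path :: "'a pair_pre_digraph \<Rightarrow> 'a list \<Rightarrow> bool" where
  "longest_path G xs \<longleftrightarrow> vertex_path G xs \<and> (\<forall>ys. vertex_path G ys \<longrightarrow> length ys \<le> length xs)"

text \<open>Paths are treated below as vertex lists, whereas \<open>cycle\<close> speaks of arc
  lists: \<open>zip xs (tl xs)\<close> lists the arcs of xs, and one more arc leads from its end to
  w.\<close>

lemma closing_walk:
  assumes "xs \<noteq> []"
  shows "pcas (hd xs) (zip xs (tl xs) @ [(last xs, w)]) w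
    \<and> pawalk_verts (hd xs) (zip xs (tl xs) @ [(last xs, w)]) = xs @ [w]"
  using assms
proof (induction xs)
  case (Cons x xs)
  then show ?case by (cases xs) auto
qed simp

lemma successively_zip:
  assumes "successively P xs" "(u, v) \<in> set (zip xs (tl xs))"
  shows "P u v"
  using assms by (induction P xs rule: successively.induct) auto

locale tree_graph = connected_graph +
  assumes acyclic: "\<not> (\<exists>p. pre_digraph.cycle (with_proj G) p \<and> 3 \<le> length p)"
begin

text \<open>The arcs of the path together with the closing arc would form a cycle of length at least
  3. Acyclicity enters the proof here.\<close>

lemma vertex_path_ends_not_adjacent:
  assumes xs: "vertex_path G xs" "3 \<le> length xs"
  shows "hd xs \<notin> N (last xs)"
proof
  assume adj: "hd xs \<in> N (last xs)"
  define p where "p = zip xs (tl xs) @ [(last xs, hd xs)]"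
  have ne: "xs \<noteq> []" using xs by (simp add: vertex_path_def)
  have "set p \<subseteq> parcs G"
    using successively_zip xs adj by (fastforce simp: p_def vertex_path_def nbrs_def)
  moreover have "hd xs \<in> V" using xs ne by (auto simp: vertex_path_def)
  moreover have "distinct (tl (xs @ [hd xs]))"
    using xs ne by (cases xs) (auto simp: vertex_path_def)
  ultimately have "pre_digraph.cycle (with_proj G) p"
    using closing_walk[OF ne, of "hd xs"]
    by (auto simp: pre_digraph.cycle_def pre_digraph.awalk_def cas_with_proj_eq
        awalk_verts_with_proj_eq p_def intro!: exI[of _ "hd xs"])
  moreover have "3 \<le> length p" using xs by (simp add: p_def)
  ultimately show False using acyclic by blast
qed

lemma vertex_path_ConsD: "vertex_path G (x # y # r) \<Longrightarrow> vertex_path G (y # r)"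
  by (auto simp: vertex_path_def)

lemma vertex_path_adjacent: "vertex_path G (x # y # r) \<Longrightarrow> y \<in> N x"
  by (auto simp: vertex_path_def)

lemma vertex_path_Cons:
  assumes "vertex_path G (x # xs)" "w \<in> N x" "w \<notin> set (x # xs)"
  shows "vertex_path G (w # x # xs)"
  using assms N_sym N_in by (auto simp: vertex_path_def)

lemma vertex_path_rev: "vertex_path G xs \<Longrightarrow> vertex_path G (rev xs)"
  using N_sym by (auto simp: vertex_path_def successively_rev)

text \<open>The piece of the path from x to w has adjacent ends, so by
  \<open>vertex_path_ends_not_adjacent\<close> it has only two vertices, and w comes directly after
  x.\<close>

lemma vertex_path_no_chord:
  assumes p: "vertex_path G (x # xs)" and w: "w \<in> N x" "w \<in> set (x # xs)"
  shows "\<exists>ys. xs = w # ys"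
proof -
  have "w \<in> set xs" using w N_irrefl by auto
  then obtain ys zs where xs: "xs = ys @ w # zs" by (auto simp: in_set_conv_decomp)
  have "ys = []"
  proof (rule ccontr)
    assume ne: "ys \<noteq> []"
    have "successively (\<lambda>u v. v \<in> N u) ((x # ys @ [w]) @ zs)"
      using p xs by (simp add: vertex_path_def)
    then have "successively (\<lambda>u v. v \<in> N u) (x # ys @ [w])"
      unfolding successively_append_iff by blast
    then have "vertex_path G (x # ys @ [w])" using p xs by (auto simp: vertex_path_def)
    then show False using vertex_path_ends_not_adjacent[of "x # ys @ [w]"] ne w N_sym
      by (cases ys) auto
  qed
  then show ?thesis using xs by simp
qed

lemma longest_path_exists: obtains p where "longest_path G p"
proof -
  obtain v where "v \<in> V" using verts_ne by auto
  then have "vertex_path G [v]" by (simp add: vertex_path_def)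
  moreover have "length p \<le> card V" if "vertex_path G p" for p
    using that finite_verts distinct_card[of p] card_mono[of V "set p"] by (auto simp: vertex_path_def)
  ultimately obtain p where "vertex_path G p" "\<forall>q. vertex_path G q \<longrightarrow> length q \<le> length p"
    using ex_has_greatest_nat[of "vertex_path G" "[v]" length "Suc (card V)"] by (auto simp: less_Suc_eq_le)
  then show ?thesis using that by (auto simp: longest_path_def)
qed

lemma longest_path_rev: "longest_path G p \<Longrightarrow> longest_path G (rev p)"
  by (simp add: longest_path_def vertex_path_rev)

lemma longest_path_hd:
  assumes p: "longest_path G (x # xs)" and w: "w \<in> N x"
  shows "\<exists>ys. xs = w # ys"
proof (rule vertex_path_no_chord)
  show p': "vertex_path G (x # xs)" using p by (simp add: longest_path_def)
  show "w \<in> set (x # xs)"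
  proof (rule ccontr)
    assume "w \<notin> set (x # xs)"
    then have "vertex_path G (w # x # xs)" by (rule vertex_path_Cons[OF p' w])
    then have "length (w # x # xs) \<le> length (x # xs)" using p unfolding longest_path_def by blast
    then show False by simp
  qed
qed (fact w)

lemma longest_path_leaf:
  assumes p: "longest_path G (x # y # r)"
  shows "N x = {y}"
proof -
  have "y \<in> N x" using p vertex_path_adjacent unfolding longest_path_def by blast
  moreover have "w = y" if "w \<in> N x" for w using longest_path_hd[OF p that] by simp
  ultimately show ?thesis by blast
qed

text \<open>Replacing the first vertex by w gives a path of the same length, hence again a longest
  one, whose first vertex is a leaf. The condition on r says that w is not the next vertex of the
  path, including the case that there is none.\<close>

lemma longest_path_second:
  assumes p: "longest_path G (x # y # r)" and w: "w \<in> N y" "\<forall>s. r \<noteq> w # s"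
  shows "N w = {y}"
proof -
  have y: "vertex_path G (y # r)" using p vertex_path_ConsD by (auto simp: longest_path_def)
  have "w \<notin> set (y # r)" using vertex_path_no_chord[OF y w(1)] w(2) by blast
  then have "vertex_path G (w # y # r)" by (rule vertex_path_Cons[OF y w(1)])
  then have "longest_path G (w # y # r)" using p by (simp add: longest_path_def)
  then show ?thesis by (rule longest_path_leaf)
qed

text \<open>The same exchange with the first two vertices replaced by v and w: everything hanging
  from a off the path has depth at most 2.\<close>

lemma longest_path_third:
  assumes p: "longest_path G (x # y # a # r)" and w: "w \<in> N a" "\<forall>s. r \<noteq> w # s"
    and v: "v \<in> N w" "v \<noteq> a"
  shows "N v = {w}"
proof -
  have "vertex_path G (x # y # a # r)" using p by (simp add: longest_path_def)
  then have a: "vertex_path G (a # r)" using vertex_path_ConsD by blast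
  have "w \<notin> set (a # r)" using vertex_path_no_chord[OF a w(1)] w(2) by blast
  then have wp: "vertex_path G (w # a # r)" by (rule vertex_path_Cons[OF a w(1)])
  have "v \<notin> set (w # a # r)" using vertex_path_no_chord[OF wp v(1)] v(2) by auto
  then have "vertex_path G (v # w # a # r)" by (rule vertex_path_Cons[OF wp v(1)])
  then have "longest_path G (v # w # a # r)" using p by (simp add: longest_path_def)
  then show ?thesis by (rule longest_path_leaf)
qed

end

section \<open>The excess of the other trees\<close>

text \<open>A lower bound for the total excess of the trees that are neither stars nor \<open>DS(n - 3, 1)\<close>, above the
  total excess of \<open>DS(n - 3, 1)\<close>. The coefficients are chosen by hand: as \<open>n\<close> grows the latter is
  about \<open>4 / 5 + 4.24 / n\<close>, and the estimates below for the path on five vertices and for trees of diameter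
  five on eight vertices leave almost no room at small \<open>n\<close>.\<close>

definition threshold :: "real \<Rightarrow> real" where
  "threshold z = 4 / 5 + 22 / 5 * z - 2 * z^2"

text \<open>\<open>threshold\<close> is concave, so it lies below its tangent at c. This leaves
  inequalities linear in z; c is taken as the reciprocal of the order at which the estimate is
  tight, or 0 if there is room.\<close>

lemma threshold_le_tangent: "threshold z \<le> 4 / 5 + 22 / 5 * z - 4 * c * z + 2 * c^2"
proof -
  have "4 / 5 + 22 / 5 * z - 4 * c * z + 2 * c^2 - threshold z = 2 * (z - c)^2"
    unfolding threshold_def by algebra
  moreover have "0 \<le> 2 * (z - c)^2" by simp
  ultimately show ?thesis by linarith
qed

section \<open>The ends of a longest path and the branches behind them\<close>

context connected_graph
begin

text \<open>The shape of the second vertex b of a longest path whose third vertex is a: apart from a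
  it has only leaves, and at least one.\<close>

definition end_at :: "'a \<Rightarrow> 'a \<Rightarrow> bool" where
  "end_at b a \<longleftrightarrow> a \<in> N b \<and> N b \<noteq> {a} \<and> (\<forall>v\<in>N b - {a}. N v = {b})"

lemma end_at_leaves:
  assumes b: "end_at b a" and a: "2 \<le> card (N a)"
  shows "N b = insert a (leaves_at b)" "a \<notin> leaves_at b" "1 \<le> card (leaves_at b)"
    "leaves_at b \<noteq> {}" "2 \<le> card (N b)"
proof -
  show na: "a \<notin> leaves_at b" using a by (auto simp: leaves_at_def)
  show Nb: "N b = insert a (leaves_at b)"
  proof
    show "N b \<subseteq> insert a (leaves_at b)"
    proof
      fix v assume "v \<in> N b"
      then show "v \<in> insert a (leaves_at b)" using b unfolding end_at_def leaves_at_def by blast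
    qed
    show "insert a (leaves_at b) \<subseteq> N b"
      using b leaves_at_subset[of b] unfolding end_at_def by blast
  qed
  show ne: "leaves_at b \<noteq> {}" using b Nb unfolding end_at_def by blast
  then show "1 \<le> card (leaves_at b)" using finite_leaves_at by (simp add: Suc_le_eq card_gt_0_iff)
  then show "2 \<le> card (N b)" using na finite_leaves_at by (simp add: Nb)
qed

lemma end_at_pendant:
  assumes b: "end_at b a" and a: "2 \<le> card (N a)" and k: "card (leaves_at b) = 1"
  obtains q where "leaves_at b = {q}" "N q = {b}" "N b = {q, a}" "a \<noteq> q"
proof -
  obtain q where q: "leaves_at b = {q}" using k card_1_singletonE by blast
  have "N q = {b}" using q by (auto simp: leaves_at_def)
  then show ?thesis using that q end_at_leaves[OF b a] by auto
qed

lemma excess_broom: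
  assumes b: "end_at b a" and a: "2 \<le> card (N a)" and k: "2 \<le> card (leaves_at b)"
  shows "96 / 100 * (1 - (card (leaves_at b) + 1 / 2) / n) \<le> (\<Sum>q\<in>leaves_at b. excess q)"
  using end_at_leaves[OF b a] a k by (intro excess_leaves_ge[of a]) auto

lemma leaf_not_internal: "2 \<le> card (N u) \<Longrightarrow> u \<notin> leaves_at s"
  by (auto simp: leaves_at_def)

text \<open>If \<open>pre_end a c\<close> holds, this is the part of the graph on the side of a when
  the edge from a to c is cut.\<close>

definition branch :: "'a \<Rightarrow> 'a \<Rightarrow> 'a set" where
  "branch a c = insert a (\<Union>w\<in>N a - {c}. insert w (leaves_at w))"

text \<open>The shape of the third vertex a of a longest path on at least five vertices, c being the
  fourth.\<close>

definition pre_end :: "'a \<Rightarrow> 'a \<Rightarrow> bool" where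
  "pre_end a c \<longleftrightarrow> c \<in> N a \<and> 2 \<le> card (N c) \<and> (\<forall>w\<in>N a - {c}. \<forall>v\<in>N w - {a}. N v = {w}) \<and>
     (\<exists>b\<in>N a - {c}. end_at b a)"

lemma pre_end_degree:
  assumes "pre_end a c"
  shows "2 \<le> card (N a)"
proof -
  obtain b where "b \<in> N a" "b \<noteq> c" "c \<in> N a" using assms unfolding pre_end_def by blast
  then have "card {b, c} \<le> card (N a)" using finite_N by (intro card_mono) auto
  then show ?thesis using \<open>b \<noteq> c\<close> by simp
qed

lemma pre_end_nbr:
  assumes "pre_end a c" "w \<in> N a - {c}"
  shows "N w = {a} \<or> end_at w a"
proof -
  have "a \<in> N w" using assms(2) N_sym by blast
  then show ?thesis using assms unfolding pre_end_def end_at_def by blast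
qed

text \<open>If some end at a has two leaves or more, they form a family. Otherwise all ends are
  pendant paths: two of them give twice the bound of \<open>excess_pendant\<close>; a single one is
  evaluated together with a if a has degree at most 3; for larger degree at least two leaves hang at
  a and form a family. The size of U is recorded because the vertices used by one branch are lost to
  the other.\<close>

lemma branch_excess:
  assumes ac: "pre_end a c"
  obtains U where "U \<subseteq> branch a c"
    "(\<exists>k. 2 \<le> k \<and> k + 2 \<le> card U \<and> 96 / 100 * (1 - (real k + 1 / 2) / n) \<le> (\<Sum>u\<in>U. excess u))
     \<or> 3 \<le> card U \<and> 138 / 100 - 376 / 100 / n \<le> (\<Sum>u\<in>U. excess u)
     \<or> 5 \<le> card U \<and> 1478 / 1000 - 604 / 100 / n \<le> (\<Sum>u\<in>U. excess u)"
proof -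
  have D: "2 \<le> card (N a)" by (rule pre_end_degree[OF ac])
  have aV: "a \<in> V" using ac N_in(2) unfolding pre_end_def by blast
  have ea: "0 \<le> excess a" by (rule excess_nonneg[OF aV])
  have aleaf: "a \<notin> leaves_at s" for s by (rule leaf_not_internal[OF D])
  have end_facts: "0 \<le> excess b" "b \<notin> leaves_at s" "a \<noteq> b" if "end_at b a" for b s
  proof -
    have aN: "a \<in> N b" using that unfolding end_at_def by blast
    show "0 \<le> excess b" by (rule excess_nonneg[OF N_in(2)[OF aN]])
    show "a \<noteq> b"
    proof
      assume "a = b"
      then show False using aN N_irrefl[of b] by simp
    qed
    show "b \<notin> leaves_at s" by (rule leaf_not_internal[OF end_at_leaves(5)[OF that D]])
  qed
  have inbr: "insert a (insert b (leaves_at b)) \<subseteq> branch a c" if "b \<in> N a - {c}" for b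
    using that by (auto simp: branch_def)
  have card1: "card (insert a (insert b (leaves_at s))) = card (leaves_at s) + 2"
    and sum1: "(\<Sum>u\<in>insert a (insert b (leaves_at s)). excess u)
      = excess a + (excess b + (\<Sum>u\<in>leaves_at s. excess u))" if "end_at b a" for b s
    using end_facts[OF that] aleaf finite_leaves_at by auto
  show thesis
  proof (cases "\<exists>b\<in>N a - {c}. end_at b a \<and> 2 \<le> card (leaves_at b)")
    case True
    then obtain b where b: "b \<in> N a - {c}" "end_at b a" "2 \<le> card (leaves_at b)" by blast
    show thesis
      using inbr[OF b(1)] card1[OF b(2), of b] sum1[OF b(2), of b] excess_broom[OF b(2) D b(3)]
        end_facts(1)[OF b(2)] ea b(3)
      by (intro that[of "insert a (insert b (leaves_at b))"] disjI1 exI[of _ "card (leaves_at b)"]) auto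
  next
    case False
    then have one: "card (leaves_at b) = 1" if "b \<in> N a - {c}" "end_at b a" for b
      using that end_at_leaves(3)[OF that(2) D] by force
    obtain b where b: "b \<in> N a - {c}" "end_at b a" using ac unfolding pre_end_def by blast
    obtain q where q: "leaves_at b = {q}" "N q = {b}" "N b = {q, a}" "a \<noteq> q"
      using end_at_pendant[OF b(2) D one[OF b]] by blast
    show thesis
    proof (cases "\<exists>b'\<in>N a - {c, b}. end_at b' a")
      case True
      then obtain b' where b': "b' \<in> N a - {c}" "end_at b' a" "b' \<noteq> b" by blast
      obtain q' where q': "leaves_at b' = {q'}" "N q' = {b'}" "N b' = {q', a}" "a \<noteq> q'"
        using end_at_pendant[OF b'(2) D one[OF b'(1,2)]] by blast
      have dist: "distinct [a, b, q, b', q']"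
        using end_facts[OF b(2)] end_facts[OF b'(2)] q q' b'(3) by auto
      have U: "{a, b, q, b', q'} \<subseteq> branch a c"
        using inbr[OF b(1)] inbr[OF b'(1)] q q' by auto
      have "739 / 1000 - 302 / 100 / n \<le> excess q + excess b"
        "739 / 1000 - 302 / 100 / n \<le> excess q' + excess b'"
        using excess_pendant q q' by blast+
      then show thesis
        using dist ea by (intro that[OF U] disjI2 conjI) auto
    next
      case noother: False
      have nb: "N a - {c, b} \<subseteq> leaves_at a"
        using noother pre_end_nbr[OF ac] by (auto simp: leaves_at_def)
      show thesis
      proof (cases "card (N a) = 2 \<or> card (N a) = 3")
        case True
        have U: "{a, b, q} \<subseteq> branch a c" using inbr[OF b(1)] q by auto
        have dist: "distinct [a, b, q]" using end_facts[OF b(2)] q by auto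
        show thesis
          using excess_pendant_deg_le3[OF q(2,3,4) True] dist
          by (intro that[OF U] disjI2 disjI1) auto
      next
        case False
        have cb: "{c, b} \<subseteq> N a" "c \<noteq> b" using ac b unfolding pre_end_def by blast+
        then have "card (N a - {c, b}) = card (N a) - 2" using finite_N by (simp add: card_Diff_subset)
        then have "2 \<le> card (N a - {c, b})" using False D by linarith
        also have "\<dots> \<le> card (leaves_at a)" using nb finite_leaves_at by (rule card_mono[rotated])
        finally have j: "2 \<le> card (leaves_at a)" .
        have cdeg: "2 \<le> card (N c)" using ac unfolding pre_end_def by blast
        then have "c \<notin> leaves_at a" by (rule leaf_not_internal)
        then have U: "insert a (insert b (leaves_at a)) \<subseteq> branch a c"
          using b leaves_at_subset[of a] by (auto simp: branch_def)
        have "96 / 100 * (1 - (card (leaves_at a) + 1 / 2) / n) \<le> (\<Sum>q\<in>leaves_at a. excess q)"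
        proof (rule excess_leaves_ge[of c])
          show "c \<in> N a" using cb by simp
          show "leaves_at w \<noteq> {}" if "w \<in> N a - leaves_at a - {c}" for w
            using that nb q by auto
        qed (use cdeg j in auto)
        then show thesis
          using card1[OF b(2), of a] sum1[OF b(2), of a] end_facts(1)[OF b(2)] ea j
          by (intro that[OF U] disjI1 exI[of _ "card (leaves_at a)"]) auto
      qed
    qed
  qed
qed

end

section \<open>Combining two disjoint branches\<close>

definition branch_weight :: "real \<Rightarrow> nat \<Rightarrow> real \<Rightarrow> bool" where
  "branch_weight z c w \<longleftrightarrow>
     (\<exists>k. 2 \<le> k \<and> k + 2 \<le> c \<and> 96 / 100 * (1 - (real k + 1 / 2) * z) \<le> w)
     \<or> 3 \<le> c \<and> 138 / 100 - 376 / 100 * z \<le> w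
     \<or> 5 \<le> c \<and> 1478 / 1000 - 604 / 100 * z \<le> w"

text \<open>\<open>branch_weight\<close> is the disjunction of \<open>branch_excess\<close>, with z
  for 1 / n, c for the number of vertices and w for their excess. A family loses weight as k / n
  grows, but then few vertices are left for the other branch, so the sum of both weights stays above
  the threshold.\<close>

lemma two_branches_numeric:
  assumes z: "0 < z" and c: "real (c + c') * z \<le> 1"
    and w: "branch_weight z c w" and w': "branch_weight z c' w'"
  shows "threshold z \<le> w + w'"
proof -
  have t0: "threshold z \<le> 4 / 5 + 22 / 5 * z" using threshold_le_tangent[of z 0] by simp
  \<comment> \<open>Two families of two leaves, each with two more vertices, need n = 8; there the
    weights sum to 1.32 against a threshold of 1.31875, hence the tangent at 1/8. Two branches of
    three vertices need n = 6, hence the tangent at 1/6.\<close>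
  have t8: "threshold z \<le> 4 / 5 + 22 / 5 * z - 1 / 2 * z + 1 / 32"
    using threshold_le_tangent[of z "1/8"] by (simp add: power2_eq_square)
  have t6: "threshold z \<le> 4 / 5 + 22 / 5 * z - 2 / 3 * z + 1 / 18"
    using threshold_le_tangent[of z "1/6"] by (simp add: power2_eq_square)
  have mono: "real i * z + real j * z \<le> 1" if "i \<le> c" "j \<le> c'" for i j
  proof -
    have "real (i + j) * z \<le> real (c + c') * z" using that z by (intro mult_right_mono) auto
    then show ?thesis using c by (simp add: algebra_simps)
  qed
  \<comment> \<open>x stands for k / n; treating it as a real unknown makes all remaining
    inequalities linear in x and z.\<close>
  have fam: "\<exists>x\<ge>2 * z. 96 / 100 * (1 - x - z / 2) \<le> w \<and> (\<forall>j\<le>c'. x + 2 * z + real j * z \<le> 1)"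
    if k: "2 \<le> k" "k + 2 \<le> c" "96 / 100 * (1 - (real k + 1 / 2) * z) \<le> w" for k
    using k z mono[OF k(2)] by (intro exI[of _ "real k * z"]) (auto simp: algebra_simps)
  have fam': "\<exists>x\<ge>2 * z. 96 / 100 * (1 - x - z / 2) \<le> w' \<and> (\<forall>j\<le>c. x + 2 * z + real j * z \<le> 1)"
    if k: "2 \<le> k" "k + 2 \<le> c'" "96 / 100 * (1 - (real k + 1 / 2) * z) \<le> w'" for k
    using k z mono[OF _ k(2)] by (intro exI[of _ "real k * z"]) (auto simp: algebra_simps)
  have FX: "threshold z \<le> w + w'"
    if k: "2 \<le> k" "k + 2 \<le> c" "96 / 100 * (1 - (real k + 1 / 2) * z) \<le> w" for k
  proof -
    obtain x where x: "2 * z \<le> x" "96 / 100 * (1 - x - z / 2) \<le> w"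
      "\<And>j. j \<le> c' \<Longrightarrow> x + 2 * z + real j * z \<le> 1" using fam[OF k] by blast
    from w' show ?thesis unfolding branch_weight_def
    proof (elim disjE exE conjE)
      fix k' assume k': "2 \<le> k'" "k' + 2 \<le> c'" "96 / 100 * (1 - (real k' + 1 / 2) * z) \<le> w'"
      define y where "y = real k' * z"
      have "x + 2 * z + (y + 2 * z) \<le> 1" using x(3)[OF k'(2)] by (simp add: y_def algebra_simps)
      moreover have "2 * z \<le> y" using k'(1) z by (simp add: y_def)
      moreover have "96 / 100 * (1 - y - z / 2) \<le> w'" using k'(3) by (simp add: y_def algebra_simps)
      ultimately show ?thesis using x(1,2) t8 by argo
    next
      assume "3 \<le> c'" "138 / 100 - 376 / 100 * z \<le> w'"
      then show ?thesis using x(1,2) x(3)[of 3] t0 by simp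
    next
      assume "5 \<le> c'" "1478 / 1000 - 604 / 100 * z \<le> w'"
      then show ?thesis using x(1,2) x(3)[of 5] t0 by simp
    qed
  qed
  have XF: "threshold z \<le> w + w'"
    if k: "2 \<le> k" "k + 2 \<le> c'" "96 / 100 * (1 - (real k + 1 / 2) * z) \<le> w'" for k
  proof -
    obtain x where x: "2 * z \<le> x" "96 / 100 * (1 - x - z / 2) \<le> w'"
      "\<And>j. j \<le> c \<Longrightarrow> x + 2 * z + real j * z \<le> 1" using fam'[OF k] by blast
    from w show ?thesis unfolding branch_weight_def
    proof (elim disjE exE conjE)
      fix k' assume "2 \<le> k'" "k' + 2 \<le> c" "96 / 100 * (1 - (real k' + 1 / 2) * z) \<le> w"
      then show ?thesis by (rule FX)
    next
      assume "3 \<le> c" "138 / 100 - 376 / 100 * z \<le> w"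
      then show ?thesis using x(1,2) x(3)[of 3] t0 by simp
    next
      assume "5 \<le> c" "1478 / 1000 - 604 / 100 * z \<le> w"
      then show ?thesis using x(1,2) x(3)[of 5] t0 by simp
    qed
  qed
  from w w' show ?thesis
    unfolding branch_weight_def
    using FX XF mono[of 3 3] mono[of 3 5] mono[of 5 3] mono[of 5 5] t0 t6 by (elim disjE exE conjE) auto
qed

context connected_graph
begin

lemma not_in_branch:
  assumes ac: "pre_end a c" and a': "a' \<noteq> a" "2 \<le> card (N a')"
    and b': "b' \<in> N a'" "b' \<noteq> a" "N b' \<noteq> {a'}"
  shows "a' \<notin> branch a c"
proof
  assume "a' \<in> branch a c"
  then consider "a' \<in> N a - {c}" | w where "a' \<in> leaves_at w" using a'(1) unfolding branch_def by blast
  then show False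
  proof cases
    case 1
    then show False using ac b' unfolding pre_end_def by blast
  next
    case 2
    then show False using leaf_not_internal[OF a'(2)] by blast
  qed
qed

text \<open>Behind the neighbours of a other than c there are only leaves, whereas a' has degree at
  least 2 and a non-leaf neighbour other than a. So neither root lies in the branch of the other,
  and an overlap further out would put one there or turn one into a leaf.\<close>

lemma branch_disjoint:
  assumes ac: "pre_end a c" and ac': "pre_end a' c'" and ne: "a \<noteq> a'"
    and b: "b \<in> N a" "end_at b a" "b \<noteq> a'" and b': "b' \<in> N a'" "end_at b' a'" "b' \<noteq> a"
  shows "branch a c \<inter> branch a' c' = {}"
proof -
  note D = pre_end_degree[OF ac] pre_end_degree[OF ac']
  have nl: "N b \<noteq> {a}" "N b' \<noteq> {a'}" using b(2) b'(2) unfolding end_at_def by blast+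
  have 1: "a' \<notin> branch a c" by (rule not_in_branch[OF ac ne[symmetric] D(2) b'(1,3) nl(2)])
  have 2: "a \<notin> branch a' c'" by (rule not_in_branch[OF ac' ne D(1) b(1,3) nl(1)])
  have sub: "w \<in> N a - {c} \<Longrightarrow> w \<in> branch a c" "w \<in> N a' - {c'} \<Longrightarrow> w \<in> branch a' c'" for w
    unfolding branch_def by blast+
  have ww: "w \<noteq> w'" if w: "w \<in> N a - {c}" "w' \<in> N a' - {c'}" for w w'
  proof
    assume "w = w'"
    then have "a' \<in> N w - {a}" using w ne N_sym by blast
    then have "N a' = {w}" using ac w unfolding pre_end_def by blast
    then show False using D(2) by simp
  qed
  have wl: "w \<notin> leaves_at w'" if w: "w \<in> N a - {c}" "w' \<in> N a' - {c'}" for w w'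
  proof
    assume l: "w \<in> leaves_at w'"
    have "a \<in> N w" using w N_sym by blast
    then have "a = w'" using l unfolding leaves_at_def by blast
    then show False using 2 sub(2)[OF w(2)] by blast
  qed
  have lw: "w' \<notin> leaves_at w" if w: "w \<in> N a - {c}" "w' \<in> N a' - {c'}" for w w'
  proof
    assume l: "w' \<in> leaves_at w"
    have "a' \<in> N w'" using w N_sym by blast
    then have "a' = w" using l unfolding leaves_at_def by blast
    then show False using 1 sub(1)[OF w(1)] by blast
  qed
  show ?thesis
  proof (rule equals0I)
    fix y assume y: "y \<in> branch a c \<inter> branch a' c'"
    then have "y \<noteq> a" "y \<noteq> a'" using 1 2 by auto
    then obtain w w' where w: "w \<in> N a - {c}" "y \<in> insert w (leaves_at w)"
      and w': "w' \<in> N a' - {c'}" "y \<in> insert w' (leaves_at w')"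
      using y unfolding branch_def by blast
    show False
      using w(2) w'(2) ww[OF w(1) w'(1)] wl[OF w(1) w'(1)] lw[OF w(1) w'(1)]
        leaves_at_disjoint[of w w'] by blast
  qed
qed

lemma branch_subset:
  assumes "pre_end a c"
  shows "branch a c \<subseteq> V"
proof -
  have "a \<in> V" using assms N_in(2) unfolding pre_end_def by blast
  then show ?thesis unfolding branch_def using N_subset leaves_at_verts by blast
qed

lemma excess_two_branches:
  assumes ac: "pre_end a c" and ac': "pre_end a' c'" and disj: "branch a c \<inter> branch a' c' = {}"
  shows "threshold (1 / n) \<le> total_excess"
proof -
  obtain U where U: "U \<subseteq> branch a c" "branch_weight (1 / n) (card U) (\<Sum>u\<in>U. excess u)"
    by (rule branch_excess[OF ac]) (auto simp: branch_weight_def)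
  obtain U' where U': "U' \<subseteq> branch a' c'" "branch_weight (1 / n) (card U') (\<Sum>u\<in>U'. excess u)"
    by (rule branch_excess[OF ac']) (auto simp: branch_weight_def)
  have sub: "U \<subseteq> V" "U' \<subseteq> V" using U U' branch_subset ac ac' by blast+
  then have fin: "finite U" "finite U'" using finite_verts finite_subset by blast+
  have dj: "U \<inter> U' = {}" using U U' disj by blast
  have "card U + card U' \<le> card V"
    using card_mono[OF finite_verts, of "U \<union> U'"] sub fin dj by (simp add: card_Un_disjoint)
  then have c: "real (card U + card U') * (1 / n) \<le> 1" using n_pos by simp
  have "threshold (1 / n) \<le> (\<Sum>u\<in>U. excess u) + (\<Sum>u\<in>U'. excess u)"
    using n_pos by (intro two_branches_numeric[OF _ c U(2) U'(2)]) simp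
  also have "\<dots> = (\<Sum>u\<in>U \<union> U'. excess u)" using fin dj by (simp add: sum.union_disjoint)
  also have "\<dots> \<le> total_excess" using sub by (intro sum_excess_ge) auto
  finally show ?thesis .
qed

section \<open>Two families of leaves with exactly known mass at the eigenvalue 1\<close>

lemma excess_family:
  assumes zero: "\<forall>x\<in>eig 1. \<forall>w\<in>N s - leaves_at s. x w = 0" and k: "2 \<le> card (leaves_at s)"
  shows "1 - card (leaves_at s) / n \<le> (\<Sum>q\<in>leaves_at s. excess q)"
    and "3 \<le> card (leaves_at s) \<Longrightarrow>
      4 / 3 * (1 - card (leaves_at s) / n) \<le> (\<Sum>q\<in>leaves_at s. excess q)"
proof -
  define m where "m = real (card (leaves_at s))"
  have ne: "leaves_at s \<noteq> {}" using k by auto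
  have m: "2 \<le> m" using k by (simp add: m_def)
  have "card (leaves_at s) \<le> card V"
    using leaves_at_verts finite_verts by (intro card_mono) auto
  then have n: "0 \<le> 1 - m / n" using n_pos by (simp add: m_def)
  have *: "2 * (1 - 1 / m) * (1 - m / n) \<le> (\<Sum>q\<in>leaves_at s. excess q)"
    unfolding m_def by (rule excess_leaves_exact(2)[OF _ ne]) (use zero in blast)
  have "1 * (1 - m / n) \<le> 2 * (1 - 1 / m) * (1 - m / n)"
    using m n by (intro mult_right_mono) (auto simp: field_simps)
  then show "1 - card (leaves_at s) / n \<le> (\<Sum>q\<in>leaves_at s. excess q)"
    using * by (simp add: m_def)
  assume "3 \<le> card (leaves_at s)"
  then have "4 / 3 * (1 - m / n) \<le> 2 * (1 - 1 / m) * (1 - m / n)"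
    using n by (intro mult_right_mono) (auto simp: m_def field_simps)
  then show "4 / 3 * (1 - card (leaves_at s) / n) \<le> (\<Sum>q\<in>leaves_at s. excess q)"
    using * by (simp add: m_def)
qed

lemma two_families_count:
  assumes ss: "s \<noteq> s'" and I: "I \<subseteq> V" "\<And>u. u \<in> I \<Longrightarrow> 2 \<le> card (N u)"
  shows "card (leaves_at s) + card (leaves_at s') + card I \<le> card V"
    and "(\<Sum>q\<in>leaves_at s. excess q) + (\<Sum>q\<in>leaves_at s'. excess q) + (\<Sum>u\<in>I. excess u)
      \<le> total_excess"
proof -
  let ?L = "leaves_at s \<union> leaves_at s'"
  have fin: "finite ?L" "finite I" using finite_leaves_at I finite_verts finite_subset by auto
  have dj: "leaves_at s \<inter> leaves_at s' = {}" "?L \<inter> I = {}"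
    using leaves_at_disjoint[OF ss] I(2) leaf_not_internal by blast+
  have sub: "?L \<union> I \<subseteq> V" using leaves_at_verts I by blast
  have "card (?L \<union> I) = card (leaves_at s) + card (leaves_at s') + card I"
    using fin dj finite_leaves_at by (simp add: card_Un_disjoint)
  then show "card (leaves_at s) + card (leaves_at s') + card I \<le> card V"
    using card_mono[OF finite_verts sub] by simp
  have "(\<Sum>u\<in>?L \<union> I. excess u) = (\<Sum>q\<in>leaves_at s. excess q) + (\<Sum>q\<in>leaves_at s'. excess q)
      + (\<Sum>u\<in>I. excess u)"
    using fin dj finite_leaves_at by (simp add: sum.union_disjoint)
  then show "(\<Sum>q\<in>leaves_at s. excess q) + (\<Sum>q\<in>leaves_at s'. excess q) + (\<Sum>u\<in>I. excess u)
      \<le> total_excess"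
    using sum_excess_ge[OF sub] by simp
qed

text \<open>The families and three further vertices fit into V, so the excess is at least 2 minus (n
  - 3) / n, that is 1 + 3 / n. This reaches 4 / 5 + 22 / 5 / n exactly from n = 7 on, the least
  order with two such families and three more vertices.\<close>

lemma excess_two_families:
  assumes ss: "s \<noteq> s'" and I: "I \<subseteq> V" "\<And>u. u \<in> I \<Longrightarrow> 2 \<le> card (N u)" "3 \<le> card I"
    and k: "2 \<le> card (leaves_at s)" "1 - card (leaves_at s) / n \<le> (\<Sum>q\<in>leaves_at s. excess q)"
    and k': "2 \<le> card (leaves_at s')" "1 - card (leaves_at s') / n \<le> (\<Sum>q\<in>leaves_at s'. excess q)"
  shows "threshold (1 / n) \<le> total_excess"
proof -
  note c = two_families_count[OF ss I(1,2)]
  have Iex: "0 \<le> (\<Sum>u\<in>I. excess u)" using I(1) excess_nonneg by (intro sum_nonneg) auto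
  have kk: "card (leaves_at s) + card (leaves_at s') + 3 \<le> card V" using c(1) I(3) by linarith
  then have n: "7 \<le> n" using k(1) k'(1) by linarith
  have "(card (leaves_at s) + card (leaves_at s')) / n \<le> (n - 3) / n"
    using kk n by (intro divide_right_mono) linarith+
  then have "card (leaves_at s) / n + card (leaves_at s') / n \<le> 1 - 3 * (1 / n)"
    using n by (simp add: add_divide_distrib diff_divide_distrib)
  then have "1 + 3 * (1 / n) \<le> total_excess" using c(2) k(2) k'(2) Iex by linarith
  moreover have "1 / n \<le> 1 / 7" using n by (simp add: field_simps)
  ultimately show ?thesis using threshold_le_tangent[of "1 / n" 0] by simp
qed

end

section \<open>Case distinction by the length of a longest path\<close>

context tree_graph
begin

lemma pre_end_of_longest_path:
  assumes p: "longest_path G (x # b # a # c # e # r)"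
  shows "pre_end a c" "end_at b a" "b \<in> N a - {c}"
proof -
  have vp: "vertex_path G (x # b # a # c # e # r)" using p by (simp add: longest_path_def)
  then have adj: "b \<in> N x" "a \<in> N b" "c \<in> N a" "e \<in> N c"
    and dist: "distinct [x, b, a, c, e]" by (auto simp: vertex_path_def)
  have sym: "b \<in> N a" "x \<in> N b" "a \<in> N c" using adj N_sym by blast+
  have Nb: "N v = {b}" if "v \<in> N b" "v \<noteq> a" for v
    using longest_path_second[OF p that(1)] that(2) by simp
  have "x \<noteq> a" using dist by auto
  then have "N b \<noteq> {a}" using sym(2) by blast
  then show 1: "end_at b a" using Nb adj(2) unfolding end_at_def by blast
  show 2: "b \<in> N a - {c}" using sym dist by simp
  have "card {a, e} \<le> card (N c)" using sym(3) adj(4) finite_N by (intro card_mono) auto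
  then have "2 \<le> card (N c)" using dist by simp
  moreover have "N v = {w}" if "w \<in> N a - {c}" "v \<in> N w - {a}" for w v
    by (rule longest_path_third[OF p, of w]) (use that in auto)
  ultimately show "pre_end a c" using adj(3) 1 2 unfolding pre_end_def by blast
qed

text \<open>From six vertices on, the third vertices from the two ends are distinct, and neither is
  the second vertex of the other end, so the branches behind them are disjoint.\<close>

lemma excess_long:
  assumes p: "longest_path G p" "6 \<le> length p"
  shows "threshold (1 / n) \<le> total_excess"
proof -
  have split: "\<exists>x b a c e r. q = x # b # a # c # e # r" if "6 \<le> length q" for q :: "'a list"
    using that by (auto simp: Suc_le_length_iff numeral_eq_Suc)
  obtain x b a c e r where q: "p = x # b # a # c # e # r" using split[OF p(2)] by blast
  have "6 \<le> length (rev p)" using p(2) by simp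
  from split[OF this] obtain x' b' a' c' e' r' where q': "rev p = x' # b' # a' # c' # e' # r'" by blast
  have m: "length p \<ge> 6" "distinct p" using p by (auto simp: longest_path_def vertex_path_def)
  have at: "b = p ! 1" "a = p ! 2" using q by auto
  have "b' = rev p ! 1" "a' = rev p ! 2" using q' by auto
  then have at': "b' = p ! (length p - 2)" "a' = p ! (length p - 3)"
    using m by (auto simp: rev_nth numeral_eq_Suc)
  have ne: "a \<noteq> a'" "b \<noteq> a'" "b' \<noteq> a"
    unfolding at at' using m by (auto simp: nth_eq_iff_index_eq)
  note f = pre_end_of_longest_path[OF p(1)[unfolded q]]
  note f' = pre_end_of_longest_path[OF longest_path_rev[OF p(1), unfolded q']]
  show ?thesis
    using f(3) f'(3)
    by (intro excess_two_branches[OF f(1) f'(1)] branch_disjoint[OF f(1) f'(1) ne(1) _ f(2) ne(2) _ f'(2) ne(3)])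
       blast+
qed

text \<open>Both ends share the third vertex a, so the two-branch argument fails. Two pendant paths
  at a are covered by \<open>excess_pendant_star\<close>. Otherwise some end e is a broom: with a
  second broom, or with two leaves at a, there are two families; else exactly one pendant path e'
  remains, a has at most one leaf, and the degree of a is 2 or 3.\<close>

lemma excess_diameter_4:
  assumes p: "longest_path G [x, b, a, b', x']"
  shows "threshold (1 / n) \<le> total_excess"
proof -
  have vp: "vertex_path G [x, b, a, b', x']" using p by (simp add: longest_path_def)
  then have adj: "b \<in> N x" "a \<in> N b" "b' \<in> N a" "x' \<in> N b'"
    and dist: "distinct [x, b, a, b', x']" by (auto simp: vertex_path_def)
  have sym: "b \<in> N a" "x \<in> N b" "a \<in> N b'" using adj N_sym by blast+
  have p': "longest_path G [x', b', a, b, x]" using longest_path_rev[OF p] by simp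
  have bb: "b \<noteq> b'" using dist by auto
  have third: "N v = {w}" if w: "w \<in> N a" "v \<in> N w" "v \<noteq> a" for w v
  proof (cases "w = b'")
    case True
    then show ?thesis using longest_path_third[OF p' w(1) _ w(2,3)] bb by simp
  next
    case False
    then show ?thesis using longest_path_third[OF p w(1) _ w(2,3)] by simp
  qed
  have D: "2 \<le> card (N a)"
  proof -
    have "card {b, b'} \<le> card (N a)" using sym adj finite_N by (intro card_mono) auto
    then show ?thesis using bb by simp
  qed
  have aV: "a \<in> V" using adj N_in by blast
  have type: "end_at w a" if w: "w \<in> N a" "N w \<noteq> {a}" for w
  proof -
    have "a \<in> N w" using w N_sym by blast
    then show ?thesis using w third unfolding end_at_def by blast
  qed
  have "x \<noteq> a" "x' \<noteq> a" using dist by auto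
  then have "N b \<noteq> {a}" "N b' \<noteq> {a}" using sym adj by blast+
  then have ends: "end_at b a" "end_at b' a" using type sym adj by blast+
  have zero: "z w = 0" if z: "z \<in> eig 1" and w: "end_at w a" for z w
    using eigen_one_support[OF z] end_at_leaves(4)[OF w D] by blast
  \<comment> \<open>If a has no leaf, all its neighbours are ends and have value 0 at the eigenvalue
    1, so the equation at a leaves (card (N a) - 1) * z a = 0. Hence all families here have their
    exact mass.\<close>
  have zero_a: "z a = 0" if z: "z \<in> eig 1" for z
  proof (cases "leaves_at a = {}")
    case True
    have "z w = 0" if "w \<in> N a" for w
    proof -
      have "N w \<noteq> {a}" using True by (auto simp: leaves_at_def)
      then show ?thesis using zero[OF z type] that by blast
    qed
    then have "(real (card (N a)) - 1) * z a = 0" using eigen_eq[OF z aV] by simp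
    then show ?thesis using D by simp
  qed (rule eigen_one_support[OF z])
  have fam: "1 - card (leaves_at w) / n \<le> (\<Sum>q\<in>leaves_at w. excess q)"
    if w: "end_at w a" and k: "2 \<le> card (leaves_at w)" for w
  proof (rule excess_family(1)[OF _ k])
    have "N w - leaves_at w \<subseteq> {a}" using end_at_leaves(1)[OF w D] by blast
    then show "\<forall>z\<in>eig 1. \<forall>v\<in>N w - leaves_at w. z v = 0" using zero_a by blast
  qed
  have fam_a: "1 - card (leaves_at a) / n \<le> (\<Sum>q\<in>leaves_at a. excess q)"
    if k: "2 \<le> card (leaves_at a)"
  proof (rule excess_family(1)[OF _ k])
    have "end_at w a" if "w \<in> N a - leaves_at a" for w
      using that type unfolding leaves_at_def by blast
    then show "\<forall>z\<in>eig 1. \<forall>v\<in>N a - leaves_at a. z v = 0" using zero by blast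
  qed
  have eV: "w \<in> V" "2 \<le> card (N w)" "w \<noteq> a" if "end_at w a" for w
  proof -
    have aN: "a \<in> N w" using that unfolding end_at_def by blast
    show "w \<in> V" by (rule N_in(2)[OF aN])
    show "2 \<le> card (N w)" by (rule end_at_leaves(5)[OF that D])
    show "w \<noteq> a" using aN N_irrefl[of a] by blast
  qed
  define A where "A = {w \<in> N a. \<exists>q. N q = {w} \<and> N w = {q, a} \<and> q \<noteq> a}"
  have finA: "finite A" using finite_N by (simp add: A_def)
  have notA: "2 \<le> card (leaves_at w)" if w: "end_at w a" "w \<notin> A" for w
  proof (rule ccontr)
    assume "\<not> 2 \<le> card (leaves_at w)"
    then have "card (leaves_at w) = 1" using end_at_leaves(3)[OF w(1) D] by linarith
    then obtain q where q: "N q = {w}" "N w = {q, a}" "a \<noteq> q"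
      by (rule end_at_pendant[OF w(1) D])
    have "w \<in> N a" using q(2) N_sym by blast
    then show False using w(2) q unfolding A_def by blast
  qed
  have three: "threshold (1 / n) \<le> total_excess"
    if w: "end_at w a" "end_at w' a" "w \<noteq> w'"
      and s: "2 \<le> card (leaves_at s)" "1 - card (leaves_at s) / n \<le> (\<Sum>q\<in>leaves_at s. excess q)"
      and s': "2 \<le> card (leaves_at s')" "1 - card (leaves_at s') / n \<le> (\<Sum>q\<in>leaves_at s'. excess q)"
      and ss: "s \<noteq> s'" for w w' s s'
  proof (rule excess_two_families[OF ss _ _ _ s s'])
    show "{a, w, w'} \<subseteq> V" "3 \<le> card {a, w, w'}" using aV eV[OF w(1)] eV[OF w(2)] w(3) by auto
    show "2 \<le> card (N u)" if "u \<in> {a, w, w'}" for u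
      using that D eV[OF w(1)] eV[OF w(2)] by auto
  qed
  show ?thesis
  proof (cases "2 \<le> card A")
    case True
    have "12 / 5 - 4 / n \<le> total_excess"
    proof (rule excess_pendant_star[OF A_def True])
      fix w assume w: "w \<in> N a - A"
      show "N w = {a} \<or> (\<exists>F. N w = insert a F \<and> a \<notin> F \<and> 2 \<le> card F \<and> (\<forall>q\<in>F. N q = {w}))"
      proof (cases "N w = {a}")
        case False
        then have "end_at w a" using type w by blast
        then have "N w = insert a (leaves_at w)" "a \<notin> leaves_at w" "2 \<le> card (leaves_at w)"
          using end_at_leaves(1,2)[of w a] D notA w by blast+
        moreover have "\<forall>q\<in>leaves_at w. N q = {w}" by (simp add: leaves_at_def)
        ultimately show ?thesis by blast
      qed simp
    qed
    moreover have "5 \<le> card V"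
    proof -
      have "card {x, b, a, b', x'} \<le> card V"
        using vp finite_verts by (intro card_mono) (auto simp: vertex_path_def)
      then show ?thesis using dist by simp
    qed
    then have "1 / n \<le> 1 / 5" by (simp add: field_simps)
    \<comment> \<open>At n = 5 both 12 / 5 - 4 / n and the threshold equal 8 / 5, so only the
      tangent at 1/5 will do.\<close>
    ultimately show ?thesis
      using threshold_le_tangent[of "1 / n" "1 / 5"] by (simp add: power2_eq_square)
  next
    case few: False
    have notboth: "\<not> (b \<in> A \<and> b' \<in> A)"
    proof
      assume "b \<in> A \<and> b' \<in> A"
      then have "card {b, b'} \<le> card A" using finA by (intro card_mono) auto
      then show False using few bb by simp
    qed
    have main: "threshold (1 / n) \<le> total_excess"
      if e: "end_at e a" "e \<notin> A" and e': "end_at e' a" "e \<noteq> e'" for e e'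
    proof (cases "\<exists>w. end_at w a \<and> w \<noteq> e \<and> w \<notin> A")
      case True
      then obtain w where w: "end_at w a" "w \<noteq> e" "w \<notin> A" by blast
      show ?thesis
        by (rule three[OF w(1) e(1) w(2) notA[OF w(1,3)] fam[OF w(1) notA[OF w(1,3)]]
              notA[OF e] fam[OF e(1) notA[OF e]] w(2)])
    next
      case onlye: False
      then have e'A: "e' \<in> A" using e' by blast
      show ?thesis
      proof (cases "2 \<le> card (leaves_at a)")
        case True
        show ?thesis
          by (rule three[OF e(1) e'(1) e'(2) notA[OF e] fam[OF e(1) notA[OF e]] True fam_a[OF True]
                eV(3)[OF e(1)]])
      next
        case False
        obtain q where q: "N q = {e'}" "N e' = {q, a}" "a \<noteq> q"
          using e'A unfolding A_def by blast
        have le: "leaves_at e' = {q}"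
        proof -
          have "a \<notin> leaves_at e'" by (rule leaf_not_internal[OF D])
          then show ?thesis using q leaves_at_subset[of e'] by (auto simp: leaves_at_def)
        qed
        have Na: "N a \<subseteq> insert e (insert e' (leaves_at a))"
        proof
          fix w assume w: "w \<in> N a"
          have "w = e'" if "w \<in> A"
          proof (rule ccontr)
            assume "w \<noteq> e'"
            then have "card {w, e'} \<le> card A" using that e'A finA by (intro card_mono) auto
            then show False using few \<open>w \<noteq> e'\<close> by simp
          qed
          then show "w \<in> insert e (insert e' (leaves_at a))"
            using w type[OF w] onlye unfolding leaves_at_def by blast
        qed
        have eN: "e \<in> N a" "e' \<in> N a"
          using e(1) e'(1) N_sym unfolding end_at_def by blast+
        have nla: "e \<notin> leaves_at a" "e' \<notin> leaves_at a"
          using leaf_not_internal eV(2)[OF e(1)] eV(2)[OF e'(1)] by blast+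
        have "N a = insert e (insert e' (leaves_at a))"
          using Na eN leaves_at_subset[of a] by blast
        then have cardN: "card (N a) = card (leaves_at a) + 2"
          using nla e'(2) finite_leaves_at by simp
        have I: "{a, e, e'} \<subseteq> V" "\<And>u. u \<in> {a, e, e'} \<Longrightarrow> 2 \<le> card (N u)" "card {a, e, e'} = 3"
          using aV D eV[OF e(1)] eV[OF e'(1)] e'(2) by auto
        note c = two_families_count[OF e'(2) I(1,2)]
        have ee: "0 \<le> excess e" using excess_nonneg eV(1)[OF e(1)] by blast
        have sumI: "(\<Sum>u\<in>{a, e, e'}. excess u) = excess a + excess e + excess e'"
          using eV(3)[OF e(1)] eV(3)[OF e'(1)] e'(2) by simp
        define k where "k = card (leaves_at e)"
        have k: "2 \<le> k" "1 - k / n \<le> (\<Sum>q\<in>leaves_at e. excess q)"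
          using notA[OF e] fam[OF e(1)] by (auto simp: k_def)
        have tot: "(1 - k / n) + (excess q + excess e' + excess a) \<le> total_excess"
          using c(2) k(2) ee unfolding le sumI by simp
        \<comment> \<open>Besides the k leaves of e there are a, e, e' and q. The family therefore
          contributes at least 4 / n, offsetting the 1 / n terms of the pendant path.\<close>
        have kn: "k + 4 \<le> card V" using c(1) I(3) by (simp add: le k_def)
        consider "card (leaves_at a) = 0" | "card (leaves_at a) = 1" using False by linarith
        then show ?thesis
        proof cases
          case 1
          have "1452 / 1000 - 352 / 100 / n \<le> excess q + excess e' + excess a"
            by (rule excess_pendant_deg2[OF q]) (use cardN 1 in simp)
          moreover have "4 / n \<le> 1 - k / n" using kn n_pos by (simp add: field_simps)
          moreover have "6 \<le> n" using kn k(1) by linarith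
          then have "1 / n \<le> 1 / 6" by (simp add: field_simps)
          ultimately show ?thesis
            using tot threshold_le_tangent[of "1 / n" "1 / 6"] by (simp add: power2_eq_square)
        next
          case 2
          have "138 / 100 - 376 / 100 / n \<le> excess q + excess e' + excess a"
            by (rule excess_pendant_deg3[OF q]) (use cardN 2 in simp)
          moreover have "4 / n \<le> 1 - k / n" using kn n_pos by (simp add: field_simps)
          moreover have "7 \<le> card V"
          proof -
            obtain l where l: "leaves_at a = {l}" using 2 card_1_singletonE by blast
            have lV: "l \<in> V" using l leaves_at_verts by blast
            have nl: "l \<notin> leaves_at e" "l \<notin> leaves_at e'"
              using l leaves_at_disjoint[OF eV(3)[OF e(1)]] leaves_at_disjoint[OF eV(3)[OF e'(1)]]
              by auto
            have nl': "l \<notin> {a, e, e'}" using l I(2)[of l] leaf_not_internal[of l a] by auto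
            let ?W = "leaves_at e \<union> (leaves_at e' \<union> ({a, e, e'} \<union> {l}))"
            have "card ?W = k + (1 + (3 + 1))"
            proof -
              have "leaves_at e \<inter> (leaves_at e' \<union> ({a, e, e'} \<union> {l})) = {}"
                "leaves_at e' \<inter> ({a, e, e'} \<union> {l}) = {}"
                using leaves_at_disjoint[OF e'(2)] nl nl' I(2) leaf_not_internal by blast+
              moreover have "card ({a, e, e'} \<union> {l}) = 4"
                using nl' I(3) by (subst card_Un_disjoint) auto
              moreover have "card (leaves_at e' \<union> ({a, e, e'} \<union> {l})) = 5"
                using calculation finite_leaves_at by (subst card_Un_disjoint) (auto simp: le)
              ultimately show ?thesis
                using finite_leaves_at by (subst card_Un_disjoint) (auto simp: k_def)
            qed
            moreover have "card ?W \<le> card V"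
              using leaves_at_verts I(1) lV finite_verts by (intro card_mono) auto
            ultimately show ?thesis using k(1) by linarith
          qed
          then have "1 / n \<le> 1 / 7" by (simp add: field_simps)
          ultimately show ?thesis
            using tot threshold_le_tangent[of "1 / n" "1 / 7"] by (simp add: power2_eq_square)
        qed
      qed
    qed
    from notboth show ?thesis using main ends bb by metis
  qed
qed

text \<open>The tree is a double star with at least two leaves at each centre, and the masses of
  both families are exact. If one family has three leaves, its factor rises from 1 to 4 / 3, which
  is enough; two and two leaves on six vertices fall short by the families alone and need the excess
  of a centre.\<close>

lemma excess_diameter_3:
  assumes p: "longest_path G [x, y, a, w]"
    and ndouble: "\<not> double_star_shaped"
  shows "5 \<le> card V" "threshold (1 / n) \<le> total_excess"
proof -
  have vp: "vertex_path G [x, y, a, w]" using p by (simp add: longest_path_def)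
  then have adj: "y \<in> N x" "a \<in> N y" "w \<in> N a"
    and dist: "distinct [x, y, a, w]" by (auto simp: vertex_path_def)
  have sym: "x \<in> N y" "y \<in> N a" using adj N_sym by blast+
  have p': "longest_path G [w, a, y, x]" using longest_path_rev[OF p] by simp
  have "N v = {y}" if "v \<in> N y" "v \<noteq> a" for v using longest_path_second[OF p] that by simp
  moreover have xa: "x \<noteq> a" "w \<noteq> y" using dist by auto
  ultimately have ey: "end_at y a" using adj sym unfolding end_at_def by blast
  have "N v = {a}" if "v \<in> N a" "v \<noteq> y" for v using longest_path_second[OF p'] that by simp
  then have ea: "end_at a y" using adj sym xa unfolding end_at_def by blast
  have D: "2 \<le> card (N a)" "2 \<le> card (N y)"
  proof -
    have "card {y, w} \<le> card (N a)" "card {x, a} \<le> card (N y)"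
      using adj sym finite_N by (auto intro!: card_mono)
    then show "2 \<le> card (N a)" "2 \<le> card (N y)" using dist by auto
  qed
  note ly = end_at_leaves[OF ey D(1)] and la = end_at_leaves[OF ea D(2)]
  have ya: "y \<noteq> a" using dist by auto
  have yV: "y \<in> V" "a \<in> V" using adj N_in by blast+
  have ky: "2 \<le> card (leaves_at y)"
  proof (rule ccontr)
    assume "\<not> 2 \<le> card (leaves_at y)"
    then have "card (leaves_at y) = 1" using ly(3) by linarith
    then obtain q where q: "N q = {y}" "N y = {q, a}" "a \<noteq> q"
      by (rule end_at_pendant[OF ey D(1)])
    moreover have "\<forall>v\<in>leaves_at a. N v = {a}" by (simp add: leaves_at_def)
    ultimately show False using ndouble la(1,2,4) by blast
  qed
  have ka: "2 \<le> card (leaves_at a)"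
  proof (rule ccontr)
    assume "\<not> 2 \<le> card (leaves_at a)"
    then have "card (leaves_at a) = 1" using la(3) by linarith
    then obtain q where q: "N q = {a}" "N a = {q, y}" "y \<noteq> q"
      by (rule end_at_pendant[OF ea D(2)])
    moreover have "\<forall>v\<in>leaves_at y. N v = {y}" by (simp add: leaves_at_def)
    ultimately show False using ndouble ly(1,2,4) by blast
  qed
  have zy: "\<forall>z\<in>eig 1. \<forall>v\<in>N y - leaves_at y. z v = 0"
  proof (intro ballI)
    fix z v assume z: "z \<in> eig 1" and "v \<in> N y - leaves_at y"
    then have "v = a" using ly(1) by blast
    then show "z v = 0" using eigen_one_support[OF z la(4)] by simp
  qed
  have za: "\<forall>z\<in>eig 1. \<forall>v\<in>N a - leaves_at a. z v = 0"
  proof (intro ballI)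
    fix z v assume z: "z \<in> eig 1" and "v \<in> N a - leaves_at a"
    then have "v = y" using la(1) by blast
    then show "z v = 0" using eigen_one_support[OF z ly(4)] by simp
  qed
  have I: "{y, a} \<subseteq> V" "\<And>u. u \<in> {y, a} \<Longrightarrow> 2 \<le> card (N u)" using yV D by auto
  note c = two_families_count[OF ya I]
  define k where "k = card (leaves_at y)"
  define r where "r = card (leaves_at a)"
  have I2: "(\<Sum>u\<in>{y, a}. excess u) = excess y + excess a" "card {y, a} = 2" using ya by auto
  have pos: "0 \<le> excess y" "0 \<le> excess a" using excess_nonneg yV by blast+
  have kr: "k + r + 2 \<le> card V" "2 \<le> k" "2 \<le> r" using c(1) ky ka I2 by (auto simp: k_def r_def)
  have fy: "1 - k / n \<le> (\<Sum>q\<in>leaves_at y. excess q)" "3 \<le> k \<Longrightarrow> 4 / 3 * (1 - k / n) \<le> (\<Sum>q\<in>leaves_at y. excess q)"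
    using excess_family[OF zy ky] by (auto simp: k_def)
  have fa: "1 - r / n \<le> (\<Sum>q\<in>leaves_at a. excess q)" "3 \<le> r \<Longrightarrow> 4 / 3 * (1 - r / n) \<le> (\<Sum>q\<in>leaves_at a. excess q)"
    using excess_family[OF za ka] by (auto simp: r_def)
  have tot: "(\<Sum>q\<in>leaves_at y. excess q) + (\<Sum>q\<in>leaves_at a. excess q) + excess a \<le> total_excess"
    using c(2) I2 pos by linarith
  have mixed: "threshold (1 / n) \<le> F + F'"
    if "2 \<le> i" "3 \<le> j" "i + j + 2 \<le> card V" "1 - i / n \<le> F" "4 / 3 * (1 - j / n) \<le> F'" for i j :: nat and F F'
  proof -
    have n7: "7 \<le> n" using that(1-3) by linarith
    then have z: "1 / n \<le> 1 / 7" by (simp add: field_simps)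
    have "(real i + real j) / n \<le> (n - 2) / n" using that(3) n7 by (intro divide_right_mono) linarith+
    then have 1: "i / n + j / n \<le> 1 - 2 * (1 / n)"
      using n7 by (simp add: add_divide_distrib diff_divide_distrib)
    have "2 / n \<le> i / n" using that(1) n7 by (intro divide_right_mono) auto
    then have 2: "2 * (1 / n) \<le> i / n" by simp
    show ?thesis using that(4,5) 1 2 z threshold_le_tangent[of "1 / n" 0] by simp
  qed
  show "5 \<le> card V" using kr by linarith
  consider "3 \<le> r" | "3 \<le> k" | "k = 2" "r = 2" using kr by linarith
  then show "threshold (1 / n) \<le> total_excess"
  proof cases
    case 1
    show ?thesis using mixed[OF kr(2) 1 kr(1) fy(1) fa(2)[OF 1]] tot pos by linarith
  next
    case 2
    have "threshold (1 / n) \<le> (\<Sum>q\<in>leaves_at a. excess q) + (\<Sum>q\<in>leaves_at y. excess q)"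
      using mixed[OF kr(3) 2 _ fa(1) fy(2)[OF 2]] kr(1) by simp
    then show ?thesis using tot pos by linarith
  next
    case 3
    have Veq: "V = {y, a} \<union> (leaves_at y \<union> leaves_at a)"
    proof (rule closed_eq_verts[symmetric])
      show "{y, a} \<union> (leaves_at y \<union> leaves_at a) \<subseteq> V" using yV leaves_at_verts by blast
      show "N u \<subseteq> {y, a} \<union> (leaves_at y \<union> leaves_at a)" if "u \<in> {y, a} \<union> (leaves_at y \<union> leaves_at a)" for u
        using that ly(1) la(1) unfolding leaves_at_def by auto
    qed simp
    have dj: "leaves_at y \<inter> leaves_at a = {}" "{y, a} \<inter> (leaves_at y \<union> leaves_at a) = {}"
      using leaves_at_disjoint[OF ya] I(2) leaf_not_internal by blast+
    have n6: "n = 6"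
      unfolding Veq using ya dj finite_leaves_at 3 by (simp add: card_Un_disjoint k_def r_def)
    \<comment> \<open>The families give 4 / 3 against a threshold of about 1.478 at n = 6. The
      missing part comes from the mass of the eigenvalue 3 at a, whose eigenvector has - 2 at the
      centres and 1 at the leaves: 4 of its squared norm 12 sit at a.\<close>
    define z where "z = (\<lambda>u. E 3 u a)"
    have z: "z \<in> eig 3" unfolding z_def by (rule E_column[OF yV(2)])
    have lz: "z q = - z s / 2" if "q \<in> leaves_at s" for q s
      using leaf_value[OF z, of q s] that by (simp add: leaves_at_def)
    have dega: "card (N a) = 3" using la finite_leaves_at 3 by (simp add: r_def)
    have degy: "card (N y) = 3" using ly finite_leaves_at 3 by (simp add: k_def)
    have "(\<Sum>v\<in>N a. z v) = z y + (\<Sum>v\<in>leaves_at a. - z a / 2)"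
      using la finite_leaves_at lz by simp
    also have "\<dots> = z y - z a" using 3 by (simp add: r_def)
    finally have zz: "z y = z a" using eigen_eq[OF z yV(2)] dega by simp
    define s where "s = (\<lambda>u. if u \<in> {y, a} then - 2 else if u \<in> leaves_at y \<union> leaves_at a then 1 else (0::real))"
    have sl: "s v = 1" if "v \<in> leaves_at y \<union> leaves_at a" for v using that dj by (auto simp: s_def)
    have se: "s \<in> eig 3"
      unfolding eigen_iff
    proof (intro conjI allI impI ballI)
      fix u assume "u \<notin> V" then show "s u = 0" unfolding Veq by (auto simp: s_def)
    next
      fix u assume "u \<in> V"
      then consider "u = y" | "u = a" | "u \<in> leaves_at y" | "u \<in> leaves_at a" unfolding Veq by blast
      then show "(\<Sum>v\<in>N u. s v) = (real (card (N u)) - 3) * s u"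
      proof cases
        case 1
        have "(\<Sum>v\<in>N y. s v) = s a + (\<Sum>v\<in>leaves_at y. 1)" using ly finite_leaves_at sl by simp
        then show ?thesis using 1 3 degy by (simp add: k_def s_def)
      next
        case 2
        have "(\<Sum>v\<in>N a. s v) = s y + (\<Sum>v\<in>leaves_at a. 1)" using la finite_leaves_at sl by simp
        then show ?thesis using 2 3 dega by (simp add: r_def s_def)
      next
        case 3
        then have "N u = {y}" "s u = 1" using sl by (auto simp: leaves_at_def)
        then show ?thesis by (simp add: s_def)
      next
        case 4
        then have "N u = {a}" "s u = 1" using sl by (auto simp: leaves_at_def)
        then show ?thesis by (simp add: s_def)
      qed
    qed
    have "(\<Sum>u\<in>V. z u * s u) = (\<Sum>u\<in>{y, a}. z u * s u)
        + ((\<Sum>u\<in>leaves_at y. z u * s u) + (\<Sum>u\<in>leaves_at a. z u * s u))"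
      unfolding Veq using ya dj finite_leaves_at by (simp add: sum.union_disjoint)
    also have "(\<Sum>u\<in>leaves_at y. z u * s u) = (\<Sum>u\<in>leaves_at y. - z y / 2)"
      using lz sl by (intro sum.cong) auto
    also have "(\<Sum>u\<in>leaves_at a. z u * s u) = (\<Sum>u\<in>leaves_at a. - z a / 2)"
      using lz sl by (intro sum.cong) auto
    also have "(\<Sum>u\<in>{y, a}. z u * s u) = - 4 * z a" using ya zz by (simp add: s_def)
    finally have "(\<Sum>u\<in>V. z u * s u) = - 6 * z a" using 3 zz by (simp add: k_def r_def)
    moreover have "(\<Sum>u\<in>V. z u * s u) = - 2"
      unfolding z_def using E_reproduce[OF yV(2) se] by (simp add: s_def)
    ultimately have E3: "E 3 a a = 1 / 3" by (simp add: z_def)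
    have "1 / 3 \<le> excess a" using excess_atom[OF yV(2), of 3] unfolding E3 n6 by simp
    then show ?thesis using tot fy(1) fa(1) 3 n6 by (simp add: threshold_def power2_eq_square)
  qed
qed

theorem excess_ge_threshold:
  assumes nstar: "\<not> (\<exists>c\<in>V. \<forall>v\<in>V - {c}. N v = {c})"
    and ndouble: "\<not> double_star_shaped"
  shows "5 \<le> card V \<and> threshold (1 / n) \<le> total_excess"
proof -
  obtain p where p: "longest_path G p" by (rule longest_path_exists)
  then have len: "length p \<le> card V"
    using distinct_card[of p] card_mono[OF finite_verts, of "set p"]
    by (auto simp: longest_path_def vertex_path_def)
  have pne: "p \<noteq> []" "set p \<subseteq> V" using p by (auto simp: longest_path_def vertex_path_def)
  have star: False if c: "c \<in> V" and l: "\<And>v. v \<in> N c \<Longrightarrow> N v = {c}" for c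
  proof -
    have "insert c (N c) = V"
      using c l N_subset by (intro closed_eq_verts) auto
    then have "\<forall>v\<in>V - {c}. N v = {c}" using l by blast
    then show False using nstar c by blast
  qed
  consider "length p \<le> 3" | "length p = 4" | "length p = 5" | "6 \<le> length p" by linarith
  then show ?thesis
  proof cases
    case 1
    consider x where "p = [x]" | x y where "p = [x, y]" | x y w where "p = [x, y, w]"
      using 1 pne(1) by (cases p rule: remdups_adj.cases; auto simp: le_Suc_eq length_Suc_conv numeral_eq_Suc)
    then have False
    proof cases
      case (1 x)
      have "w \<notin> N x" for w using longest_path_hd[of x "[]" w] p 1 by blast
      then show False using star[of x] pne(2) 1 by simp
    next
      case (2 x y)
      have "N w = {y}" if "w \<in> N y" for w
        by (rule longest_path_second[of x y "[]"]) (use p 2 that in simp_all)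
      moreover have "y \<in> V" using pne(2) 2 by simp
      ultimately show False using star[of y] by blast
    next
      case (3 x y w)
      have "longest_path G [w, y, x]" using longest_path_rev[OF p] 3 by simp
      then have w: "N w = {y}" by (rule longest_path_leaf)
      have "N v = {y}" if "v \<in> N y" for v
      proof (cases "v = w")
        case False
        show ?thesis
          by (rule longest_path_second[of x y "[w]"]) (use p 3 that False in simp_all)
      qed (simp add: w)
      moreover have "y \<in> V" using pne(2) 3 by simp
      ultimately show False using star[of y] by blast
    qed
    then show ?thesis ..
  next
    case 2
    then obtain x y a w where "p = [x, y, a, w]" by (auto simp: length_Suc_conv numeral_eq_Suc)
    then show ?thesis using excess_diameter_3 p ndouble by blast
  next
    case 3
    then obtain x b a b' x' where "p = [x, b, a, b', x']" by (auto simp: length_Suc_conv numeral_eq_Suc)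
    then have "threshold (1 / n) \<le> total_excess" using excess_diameter_4 p by blast
    then show ?thesis using len 3 by simp
  next
    case 4
    then have "threshold (1 / n) \<le> total_excess" using excess_long p by blast
    then show ?thesis using len 4 by simp
  qed
qed

end

section \<open>Isomorphism invariance and the extremal tree\<close>

lemma digraph_iso_with_projI:
  assumes wf: "pair_wf_digraph G" and f: "inj_on f (pverts G)" "f ` pverts G = pverts H"
    and arcs: "parcs H = map_prod f f ` parcs G"
  shows "digraph_iso (with_proj G) (with_proj H)"
proof -
  define h where "h = \<lparr> iso_verts = f, iso_arcs = map_prod f f, iso_head = snd, iso_tail = fst \<rparr>"
  have sub: "parcs G \<subseteq> pverts G \<times> pverts G"
    using wf by (auto simp: pair_wf_digraph_def)
  have "inj_on (map_prod f f) (parcs G)"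
    using map_prod_inj_on[OF f(1) f(1)] sub inj_on_subset by blast
  then have "pre_digraph.digraph_isomorphism (with_proj G) h"
    using wf f by (auto simp: pre_digraph.digraph_isomorphism_def h_def wf_digraph_wp_iff)
  moreover have "with_proj H = app_iso h (with_proj G)"
    using f(2) arcs by (simp add: app_iso_def h_def with_proj_def)
  ultimately show ?thesis unfolding digraph_iso_def by blast
qed

lemma digraph_iso_with_projE:
  assumes "digraph_iso (with_proj G) (with_proj H)"
  obtains f where "inj_on f (pverts G)" "f ` pverts G = pverts H" "parcs H = map_prod f f ` parcs G"
proof -
  obtain h where h: "pre_digraph.digraph_isomorphism (with_proj G) h"
    and H: "with_proj H = app_iso h (with_proj G)"
    using assms unfolding digraph_iso_def by blast
  have proj: "iso_tail h = fst" "iso_head h = snd" "pverts H = iso_verts h ` pverts G"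
    "parcs H = iso_arcs h ` parcs G"
    using H by (simp_all add: app_iso_def with_proj_def)
  have "iso_arcs h e = map_prod (iso_verts h) (iso_verts h) e" if "e \<in> parcs G" for e
    using h that unfolding pre_digraph.digraph_isomorphism_def
    by (auto simp: proj prod_eq_iff)
  then have "parcs H = map_prod (iso_verts h) (iso_verts h) ` parcs G"
    unfolding proj(4) by (rule image_cong[OF refl])
  moreover have "inj_on (iso_verts h) (pverts G)"
    using h by (simp add: pre_digraph.digraph_isomorphism_def)
  ultimately show ?thesis using that proj(3) by metis
qed

lemma map_prod_symcl: "map_prod f f ` symcl A = symcl (map_prod f f ` A)"
  by (force simp: symcl_def)

context connected_graph
begin

text \<open>The spectrum in terms of the diagonal entries alone, so that an isomorphism that
  preserves the entries of the projections also preserves the spectrum.\<close>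

lemma evs_eq: "evs = {\<theta>. \<exists>v\<in>V. E \<theta> v v \<noteq> 0}"
proof (intro set_eqI iffI)
  fix \<theta> assume "\<theta> \<in> evs"
  then obtain x where x: "x \<in> eig \<theta>" "x \<noteq> (\<lambda>_. 0)" by (auto simp: eigenvalues_on_def)
  then obtain v where v: "x v \<noteq> 0" by auto
  have vV: "v \<in> V" using x(1) v by (auto simp: eigen_iff)
  have "E \<theta> v v \<noteq> 0"
  proof
    assume "E \<theta> v v = 0"
    then have "\<forall>u\<in>V. (E \<theta> u v)^2 = 0"
      using E_diag[OF vV, of \<theta>] finite_verts by (simp add: sum_nonneg_eq_0_iff)
    then show False using E_reproduce[OF vV x(1)] v by simp
  qed
  then show "\<theta> \<in> {\<theta>. \<exists>v\<in>V. E \<theta> v v \<noteq> 0}" using vV by blast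
next
  fix \<theta> assume "\<theta> \<in> {\<theta>. \<exists>v\<in>V. E \<theta> v v \<noteq> 0}"
  then show "\<theta> \<in> evs" using E_not_eigenvalue by blast
qed

lemma laziness_eq_sum: "laziness G = (\<Sum>u\<in>V. \<Sum>\<theta>\<in>evs. (E \<theta> u u)^2)"
  by (simp add: laziness_def average_mixing_matrix_def power2_eq_square eigenprojection_def
      proj_entry_def)

end

text \<open>The transported column of a projection again has the reproducing property, so by
  \<open>E_eqI\<close> it is the corresponding column for the other graph.\<close>

lemma laziness_iso:
  assumes G: "connected_graph G" and H: "connected_graph H"
    and iso: "digraph_iso (with_proj G) (with_proj H)"
  shows "laziness G = laziness H"
proof -
  interpret G: connected_graph G by (rule G)
  interpret H: connected_graph H by (rule H)
  obtain f where f: "inj_on f (pverts G)" "f ` pverts G = pverts H" "parcs H = map_prod f f ` parcs G"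
    using digraph_iso_with_projE[OF iso] by blast
  have N: "nbrs H (f u) = f ` nbrs G u" if u: "u \<in> pverts G" for u
  proof -
    have "x \<in> f ` nbrs G u" if x: "(f u, x) \<in> parcs H" for x
    proof -
      obtain u' v where "(u', v) \<in> parcs G" "f u' = f u" "x = f v"
        using x unfolding f(3) by auto
      moreover have "u' = u"
        using inj_onD[OF f(1), of u' u] calculation u G.N_in(2)[of v u'] by (auto simp: nbrs_def)
      ultimately show ?thesis by (auto simp: nbrs_def)
    qed
    moreover have "(f u, f v) \<in> parcs H" if "v \<in> nbrs G u" for v
      using that unfolding f(3) nbrs_def by force
    ultimately show ?thesis by (auto simp: nbrs_def)
  qed
  have injN: "inj_on f (nbrs G u)" for u using f(1) G.N_subset inj_on_subset by blast
  define g where "g = inv_into (pverts G) f"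
  have gf: "g (f u) = u" if "u \<in> pverts G" for u using f(1) that by (simp add: g_def)
  have E: "H.E \<theta> (f u) (f v) = G.E \<theta> u v" if u: "u \<in> pverts G" and v: "v \<in> pverts G" for \<theta> u v
  proof -
    define p where "p = (\<lambda>w. if w \<in> pverts H then G.E \<theta> (g w) v else 0)"
    have pf: "p (f u) = G.E \<theta> u v" if "u \<in> pverts G" for u
      using that f(2) gf by (auto simp: p_def)
    have sumV: "(\<Sum>w\<in>pverts H. h w) = (\<Sum>u\<in>pverts G. h (f u))" for h :: "'b \<Rightarrow> real"
      unfolding f(2)[symmetric] by (simp add: sum.reindex[OF f(1)])
    have sumN: "(\<Sum>w\<in>nbrs H (f u). h w) = (\<Sum>w\<in>nbrs G u. h (f w))" if "u \<in> pverts G"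
      for u and h :: "'b \<Rightarrow> real"
      unfolding N[OF that] by (simp add: sum.reindex[OF injN])
    have cardN: "card (nbrs H (f u)) = card (nbrs G u)" if "u \<in> pverts G" for u
      unfolding N[OF that] by (simp add: card_image[OF injN])
    have "p \<in> H.eig \<theta>"
      unfolding H.eigen_iff
    proof (intro conjI allI impI ballI)
      fix w assume "w \<in> pverts H"
      then obtain u where u: "u \<in> pverts G" "w = f u" using f(2) by blast
      have "(\<Sum>x\<in>nbrs H w. p x) = (\<Sum>x\<in>nbrs G u. G.E \<theta> x v)"
        unfolding u(2) sumN[OF u(1)] using pf G.N_subset by (intro sum.cong) auto
      also have "\<dots> = (real (card (nbrs G u)) - \<theta>) * G.E \<theta> u v"
        by (rule G.eigen_eq[OF G.E_column[OF v] u(1)])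
      finally show "(\<Sum>x\<in>nbrs H w. p x) = (real (card (nbrs H w)) - \<theta>) * p w"
        using u pf cardN by simp
    qed (simp add: p_def)
    moreover have "(\<Sum>w\<in>pverts H. p w * s w) = s (f v)" if s: "s \<in> H.eig \<theta>" for s
    proof -
      define s' where "s' = (\<lambda>u. if u \<in> pverts G then s (f u) else 0)"
      have "s' \<in> G.eig \<theta>"
        unfolding G.eigen_iff
      proof (intro conjI allI impI ballI)
        fix u assume u: "u \<in> pverts G"
        have "(\<Sum>x\<in>nbrs G u. s' x) = (\<Sum>x\<in>nbrs H (f u). s x)"
          unfolding sumN[OF u] using G.N_subset by (intro sum.cong) (auto simp: s'_def)
        then show "(\<Sum>x\<in>nbrs G u. s' x) = (real (card (nbrs G u)) - \<theta>) * s' u"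
          using H.eigen_eq[OF s, of "f u"] u f(2) cardN by (auto simp: s'_def)
      qed (simp add: s'_def)
      then have "(\<Sum>u\<in>pverts G. G.E \<theta> u v * s' u) = s' v" by (rule G.E_reproduce[OF v])
      then show ?thesis unfolding sumV using v pf by (simp add: s'_def)
    qed
    ultimately have "H.E \<theta> (f u) (f v) = p (f u)"
      using v f(2) by (intro H.E_eqI) auto
    then show ?thesis using pf[OF u] by simp
  qed
  have evs: "H.evs = G.evs"
  proof -
    have "(\<exists>w\<in>pverts H. H.E \<theta> w w \<noteq> 0) \<longleftrightarrow> (\<exists>v\<in>pverts G. G.E \<theta> v v \<noteq> 0)" for \<theta>
    proof -
      have "(\<exists>w\<in>pverts H. H.E \<theta> w w \<noteq> 0) \<longleftrightarrow> (\<exists>w\<in>f ` pverts G. H.E \<theta> w w \<noteq> 0)"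
        by (simp only: f(2))
      also have "\<dots> \<longleftrightarrow> (\<exists>v\<in>pverts G. G.E \<theta> v v \<noteq> 0)" using E by simp
      finally show ?thesis .
    qed
    then show ?thesis unfolding H.evs_eq G.evs_eq by simp
  qed
  have "laziness H = (\<Sum>u\<in>pverts G. \<Sum>\<theta>\<in>G.evs. (H.E \<theta> (f u) (f u))^2)"
    unfolding H.laziness_eq_sum evs using sum.reindex[OF f(1), of "\<lambda>w. \<Sum>\<theta>\<in>G.evs. (H.E \<theta> w w)^2"]
    by (simp add: f(2))
  then show ?thesis unfolding G.laziness_eq_sum using E by simp
qed

section \<open>The extremal tree and the identification of stars and double stars\<close>

lemma nbrs_double_star:
  shows "nbrs (double_star l 1) (l + 2) = {1}" "nbrs (double_star l 1) 1 = {l + 2, 0}"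
    "nbrs (double_star l 1) 0 = insert 1 {2..<l + 2}"
    "y \<in> {2..<l + 2} \<Longrightarrow> nbrs (double_star l 1) y = {0}"
  by (auto simp: nbrs_def double_star_def symcl_def)

lemma connected_graph_double_star: "connected_graph (double_star l 1)"
proof -
  let ?G = "double_star l 1"
  have verts: "pverts ?G = {0..<l + 3}" by (auto simp: double_star_def)
  have arcs: "parcs ?G \<subseteq> {0..<l + 3} \<times> {0..<l + 3}"
    by (auto simp: double_star_def symcl_def)
  have sym: "sym (parcs ?G)"
    by (auto simp: sym_def double_star_def symcl_def)
  have graph: "pair_graph ?G"
  proof
    show "fst e \<in> pverts ?G" "snd e \<in> pverts ?G" if "e \<in> parcs ?G" for e
      using arcs that verts by auto
    show "finite (pverts ?G)" unfolding verts by simp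
    show "finite (parcs ?G)" using arcs finite_subset by blast
    show "fst e \<noteq> snd e" if "e \<in> parcs ?G" for e
      using that by (auto simp: double_star_def symcl_def)
    show "symmetric (with_proj ?G)" using sym by (simp add: symmetric_def)
  qed
  interpret G: pair_graph ?G by (rule graph)
  have 01: "0 \<rightarrow>\<^sup>*\<^bsub>with_proj ?G\<^esub> 1"
    by (rule G.reachable_adjI) (auto simp: double_star_def symcl_def)
  have from0: "0 \<rightarrow>\<^sup>*\<^bsub>with_proj ?G\<^esub> v" if v: "v \<in> pverts ?G" for v
  proof -
    consider "v = 0" | "v = 1" | "v \<in> {2..<l + 2}" | "v = l + 2" using v verts by force
    then show ?thesis
    proof cases
      case 1
      then show ?thesis using G.reachable_refl v by blast
    next
      case 3
      then show ?thesis by (intro G.reachable_adjI) (auto simp: double_star_def symcl_def)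
    next
      case 4
      have "1 \<rightarrow>\<^sup>*\<^bsub>with_proj ?G\<^esub> (l + 2)"
        by (rule G.reachable_adjI) (auto simp: double_star_def symcl_def)
      then show ?thesis using 01 4 G.reachable_trans by blast
    qed (use 01 in simp)
  qed
  have "u \<rightarrow>\<^sup>*\<^bsub>with_proj ?G\<^esub> v" if "u \<in> pverts ?G" "v \<in> pverts ?G" for u v
    using from0[OF that(1)] from0[OF that(2)] G.symmetric_reachable' G.reachable_trans by blast
  then have "u \<rightarrow>\<^sup>*\<^bsub>with_proj (mk_symmetric (with_proj ?G))\<^esub> v" if "u \<in> pverts ?G" "v \<in> pverts ?G" for u v
    using that G.reachable_mk_symmetricI by blast
  then have "Digraph_Component.connected (with_proj ?G)"
    unfolding connected_def strongly_connected_def using verts by auto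
  then show ?thesis using graph by unfold_locales
qed

text \<open>A strict one-sided estimate suffices for the uniqueness claim: any tree whose total
  excess reaches the threshold is strictly less lazy. Five is the least order of a tree that is
  neither a star nor of the extremal shape.\<close>

lemma laziness_double_star_gt:
  assumes "5 \<le> m"
  shows "laziness (double_star (m - 3) 1) > real m - 2 * (1 - 1 / real m) - threshold (1 / real m)"
proof -
  define l where "l = m - 3"
  have l: "2 \<le> l" "m = l + 3" using assms by (auto simp: l_def)
  interpret G: connected_graph "double_star l 1" by (rule connected_graph_double_star)
  have card: "card (pverts (double_star l 1)) = m" using l by (simp add: double_star_def)
  have "(\<Sum>u\<in>pverts (double_star l 1). G.excess u)
      < 4 / 5 + 22 / 5 / real m - 2 / (real m)^2"
    unfolding card[symmetric]
    by (rule G.excess_double_star[OF nbrs_double_star(1,2) _ nbrs_double_star(3) _ nbrs_double_star(4)])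
       (use l in auto)
  also have "\<dots> = threshold (1 / real m)" by (simp add: threshold_def power_divide)
  finally have "(\<Sum>u\<in>pverts (double_star l 1). G.excess u) < threshold (1 / real m)" .
  then show ?thesis
    unfolding l_def[symmetric] G.laziness_eq card by linarith
qed

context connected_graph
begin

lemma star_iso:
  assumes c: "c \<in> V" "\<forall>v\<in>V - {c}. N v = {c}"
  shows "digraph_iso (with_proj G) (with_proj (star_graph (card V)))"
proof -
  have "card (V - {c}) = card {1..<card V}" using c finite_verts by simp
  then obtain h where h: "bij_betw h (V - {c}) {1..<card V}"
    using finite_same_card_bij[of "V - {c}" "{1..<card V}"] finite_verts by auto
  define f where "f = (\<lambda>v. if v = c then 0 else h v)"
  have fh: "f ` (V - {c}) = {1..<card V}" "inj_on f (V - {c})"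
    using h by (auto simp: bij_betw_def f_def inj_on_def)
  have fc: "f c = 0" by (simp add: f_def)
  note V = insert_Diff[OF c(1)]
  have "inj_on f (insert c (V - {c}))"
    unfolding inj_on_insert using fh fc by simp
  then have "inj_on f V" by (simp only: V)
  moreover have "f ` V = pverts (star_graph (card V))"
  proof -
    have "f ` insert c (V - {c}) = insert 0 {1..<card V}" unfolding image_insert fh(1) fc ..
    moreover have "0 < card V" using c(1) finite_verts by (auto simp: card_gt_0_iff)
    then have "insert 0 {1..<card V} = {0..<card V}" by auto
    ultimately show ?thesis by (simp only: V star_graph_def pair_pre_digraph.simps)
  qed
  moreover have "parcs (star_graph (card V)) = map_prod f f ` parcs G"
  proof -
    have "parcs G = symcl (Pair c ` (V - {c}))"
    proof (intro set_eqI, clarify)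
      fix u v
      have "v \<in> N u \<longleftrightarrow> (u = c \<and> v \<in> V - {c}) \<or> (v = c \<and> u \<in> V - {c})"
      proof (cases "u = c")
        case True
        have "v \<in> N c \<longleftrightarrow> v \<in> V - {c}"
          using c N_sym[of v c] N_in(1)[of v c] N_irrefl[of c] by blast
        then show ?thesis using True by blast
      next
        case False
        then show ?thesis using c(2) N_in(2)[of v u] by blast
      qed
      then show "(u, v) \<in> parcs G \<longleftrightarrow> (u, v) \<in> symcl (Pair c ` (V - {c}))"
        by (auto simp: nbrs_def symcl_def)
    qed
    moreover have "map_prod f f ` Pair c ` (V - {c}) = Pair 0 ` f ` (V - {c})"
      by (auto simp: f_def image_image)
    moreover have "{(0::nat, i) | i. i \<in> {1..<card V}} = Pair 0 ` {1..<card V}" by auto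
    ultimately show ?thesis by (simp add: map_prod_symcl star_graph_def fh(1))
  qed
  ultimately show ?thesis
    using graph by (intro digraph_iso_with_projI)
      (auto simp: pair_graph_def pair_pseudo_graph_def pair_sym_digraph_def)
qed

lemma double_star_iso:
  assumes q: "N q = {b}" and b: "N b = {q, a}" "a \<noteq> q" and a: "N a = insert b F" "b \<notin> F"
    and F: "\<And>y. y \<in> F \<Longrightarrow> N y = {a}"
  shows "digraph_iso (with_proj G) (with_proj (double_star (card V - 3) 1))"
proof -
  have finF: "finite F" using a(1) finite_N[of a] by simp
  have mem: "q \<in> V" "b \<in> V" "a \<in> V" using b(1) N_in[of _ b] by auto
  have FV: "F \<subseteq> V" using a(1) N_subset by blast
  have V: "V = {q, b, a} \<union> F"
    using q b a F mem FV by (intro closed_eq_verts[symmetric]) auto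
  have ba: "b \<noteq> a" "q \<noteq> b" using b N_irrefl[of b] by auto
  have notF: "q \<notin> F" "a \<notin> F" using F[of q] F[of a] q a ba by auto
  define l where "l = card F"
  have cardV: "card V - 3 = l"
    using V finF notF a(2) ba b(2) by (simp add: l_def)
  have "card F = card {2..<l + 2}" by (simp add: l_def)
  then obtain h where h: "bij_betw h F {2..<l + 2}"
    using finite_same_card_bij[OF finF] by blast
  define f where "f = (\<lambda>v. if v = a then 0 else if v = b then 1 else if v = q then l + 2 else h v)"
  have f: "f a = 0" "f b = 1" "f q = l + 2" "\<And>v. v \<in> F \<Longrightarrow> f v = h v"
    using ba b(2) notF a(2) by (auto simp: f_def)
  have fF: "f ` F = {2..<l + 2}" "inj_on f F"
    using h f(4) by (auto simp: bij_betw_def inj_on_def)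
  have "f ` {q, b, a} \<inter> f ` F = {}" unfolding fF(1) using f(1-3) by auto
  moreover have "inj_on f {q, b, a}" unfolding inj_on_def using f(1-3) by auto
  ultimately have "inj_on f V" unfolding V inj_on_Un using fF(2) by blast
  moreover have "f ` V = pverts (double_star l 1)"
    unfolding V image_Un fF(1) using f(1-3) by (auto simp: double_star_def)
  moreover have "parcs (double_star l 1) = map_prod f f ` parcs G"
  proof -
    have "parcs G = symcl ({(a, b)} \<union> Pair a ` F \<union> {(b, q)})"
    proof (intro set_eqI, clarify)
      fix u v
      have "v \<in> N u \<longleftrightarrow> u = q \<and> v = b \<or> u = b \<and> v \<in> {q, a} \<or> u = a \<and> v \<in> insert b F
          \<or> u \<in> F \<and> v = a"
      proof (cases "u \<in> V")
        case True
        then consider "u = q" | "u = b" | "u = a" | "u \<in> F" unfolding V by blast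
        then show ?thesis by cases (use q b a F ba notF in auto)
      next
        case False
        then show ?thesis using N_in(2)[of v u] V by blast
      qed
      then show "(u, v) \<in> parcs G \<longleftrightarrow> (u, v) \<in> symcl ({(a, b)} \<union> Pair a ` F \<union> {(b, q)})"
        by (auto simp: nbrs_def symcl_def)
    qed
    moreover have "map_prod f f ` ({(a, b)} \<union> Pair a ` F \<union> {(b, q)})
        = {(0, 1)} \<union> Pair 0 ` f ` F \<union> {(1, l + 2)}"
      using f(1-3) by (auto simp: image_Un image_image)
    moreover have "{(0::nat, i) | i. i \<in> {2..<l + 2}} = Pair 0 ` {2..<l + 2}"
      "{(1::nat, i) | i. i \<in> {l + 2..<l + 1 + 2}} = {(1, l + 2)}" by auto
    ultimately show ?thesis by (simp only: map_prod_symcl double_star_def fF(1) pair_pre_digraph.simps)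
  qed
  ultimately show ?thesis
    unfolding cardV using graph by (intro digraph_iso_with_projI)
      (auto simp: pair_graph_def pair_pseudo_graph_def pair_sym_digraph_def)
qed

end

theorem theorem6p25:
  fixes T :: "'a pair_pre_digraph" and n :: nat
  assumes "undirected_tree T"
    and "card (pverts T) = n"
    and "\<not> digraph_iso (with_proj T) (with_proj (star_graph n))"
  shows "laziness T \<le> laziness (double_star (n - 3) 1) \<and>
         (laziness T = laziness (double_star (n - 3) 1) \<longleftrightarrow>
            digraph_iso (with_proj T) (with_proj (double_star (n - 3) 1)))"
proof -
  interpret tree_graph T
    using assms(1) unfolding undirected_tree_def
    by (intro tree_graph.intro connected_graph.intro tree_graph_axioms.intro) blast+
  have T: "connected_graph T" by unfold_locales
  have nstar: "\<not> (\<exists>c\<in>V. \<forall>v\<in>V - {c}. N v = {c})"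
    using star_iso assms(2,3) by blast
  show ?thesis
  proof (cases double_star_shaped)
    case True
    then obtain q b a F where d: "N q = {b}" "N b = {q, a}" "a \<noteq> q" "N a = insert b F" "b \<notin> F"
      "\<forall>y\<in>F. N y = {a}" by blast
    have iso: "digraph_iso (with_proj T) (with_proj (double_star (n - 3) 1))"
      using double_star_iso[OF d(1-5)] d(6) assms(2) by blast
    then show ?thesis using laziness_iso[OF T connected_graph_double_star] by simp
  next
    case False
    have n: "5 \<le> n" "threshold (1 / real n) \<le> total_excess"
      using excess_ge_threshold[OF nstar False] assms(2) by auto
    have "laziness T < laziness (double_star (n - 3) 1)"
      using laziness_double_star_gt[OF n(1)] n(2) laziness_eq assms(2) by simp
    moreover from this have "\<not> digraph_iso (with_proj T) (with_proj (double_star (n - 3) 1))"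
      using laziness_iso[OF T connected_graph_double_star] by fastforce
    ultimately show ?thesis by simp
  qed
qed

end
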